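(* Let $k$ be a field of characteristic $0$. The derived Harish-Chandra homomorphism $$\Phi_2:\ \mathrm{DRep}_2(k[x,y])^{\mathrm{GL}}\to k[x_1,x_2,y_1,y_2,\theta_1,\theta_2]^{S_2}$$ is a quasi-isomorphism. Consequently, there is an isomorphism of graded commutative algebras $\mathrm H_\bullet(k[x,y],2)^{\mathrm{GL}}\cong k[x_1,x_2,y_1,y_2,\theta_1,\theta_2]^{S_2}$.
   Context: For $n\ge1$, $\mathrm{DRep}_n(k[x,y])$ is (represented by) the commutative DG algebra freely generated by $x_{ij},y_{ij}$ of homological degree $0$ and $\theta_{ij}$ of homological degree $1$ ($1\le i,j\le n$), with differential of degree $-1$ given by $d\theta_{ij}=\sum_{l}(x_{il}y_{lj}-y_{il}x_{lj})$, $dx_{ij}=dy_{ij}=0$ (it arises from the cofibrant resolution $k\langle x,y,\theta\mid d\theta=[x,y]\rangle$ of $k[x,y]$). $\mathrm{GL}_n(k)$ acts by simultaneous conjugation of the matrices $\|x_{ij}\|,\|y_{ij}\|,\|\theta_{ij}\|$; $\mathrm{DRep}_n(k[x,y])^{\mathrm{GL}}$ is the DG subalgebra of invariants, and $\mathrm H_\bullet(k[x,y],n)^{\mathrm{GL}}$ is its homology. The graded commutative algebra $k[x_1,\dots,x_n,y_1,\dots,y_n,\theta_1,\dots,\theta_n]$ has $x_i,y_i$ in degree $0$, $\theta_i$ in degree $1$ and zero differential; $S_n$ permutes the triples $(x_i,y_i,\theta_i)$. $\Phi_n$ is the restriction to invariants of the DG algebra map $x_{ij}\mapsto\delta_{ij}x_i$,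 $y_{ij}\mapsto\delta_{ij}y_i$, $\theta_{ij}\mapsto\delta_{ij}\theta_i$. *)

theory Defs
  imports
    "HOL-Analysis.Cartesian_Space"
    "HOL-Algebra.QuotRing"
    "HOL-Algebra.Module"
    "HOL-Library.Poly_Mapping"
begin

section \<open>DG algebras and quasi-isomorphisms\<close>

text \<open>
  A (non-negatively graded, homological) DG algebra over \<open>'k\<close> is represented by its total ring
  \<open>carrier\<close>, together with the subspaces \<open>degree_part A p\<close> of homogeneous elements of degree \<open>p\<close> and the
  differential.
\<close>

record ('k, 'a) dga = "('k, 'a) module" +
  degree_part :: "nat \<Rightarrow> 'a set"
  differential :: "'a \<Rightarrow> 'a"

definition linear_on :: "('k, 'a) dga \<Rightarrow> ('k, 'b) dga \<Rightarrow> ('a \<Rightarrow> 'b) \<Rightarrow> bool" where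
  "linear_on A B f \<longleftrightarrow>
     (\<forall>a\<in>carrier A. \<forall>b\<in>carrier A. f (a \<oplus>\<^bsub>A\<^esub> b) = f a \<oplus>\<^bsub>B\<^esub> f b) \<and>
     (\<forall>c. \<forall>a\<in>carrier A. f (c \<odot>\<^bsub>A\<^esub> a) = c \<odot>\<^bsub>B\<^esub> f a)"

definition dga_hom :: "('k, 'a) dga \<Rightarrow> ('k, 'b) dga \<Rightarrow> ('a \<Rightarrow> 'b) \<Rightarrow> bool" where
  "dga_hom A B f \<longleftrightarrow>
     f \<in> ring_hom A B \<and> linear_on A B f \<and>
     (\<forall>p. f ` degree_part A p \<subseteq> degree_part B p) \<and>
     (\<forall>a\<in>carrier A. f (differential A a) = differential B (f a))"

definition cycles :: "('k, 'a) dga \<Rightarrow> 'a set" where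
  "cycles A = {a \<in> carrier A. differential A a = \<zero>\<^bsub>A\<^esub>}"

definition boundaries :: "('k, 'a) dga \<Rightarrow> 'a set" where
  "boundaries A = differential A ` carrier A"

definition homology_class :: "('k, 'a) dga \<Rightarrow> 'a \<Rightarrow> 'a set" where
  "homology_class A z = boundaries A +>\<^bsub>A\<^esub> z"

definition homology :: "('k, 'a) dga \<Rightarrow> ('k, 'a set) dga" where
  "homology A =
     (let H = A\<lparr>carrier := cycles A\<rparr> Quot boundaries A in
      \<lparr>carrier = carrier H, mult = mult H, one = one H, zero = zero H, add = add H,
       smult = (\<lambda>c X. \<Union>z\<in>X. homology_class A (c \<odot>\<^bsub>A\<^esub> z)),
       degree_part = (\<lambda>p. homology_class A ` (cycles A \<inter> degree_part A p)),
       differential = (\<lambda>_. zero H)\<rparr>)"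

definition homology_map :: "('k, 'a) dga \<Rightarrow> ('k, 'b) dga \<Rightarrow> ('a \<Rightarrow> 'b) \<Rightarrow> 'a set \<Rightarrow> 'b set" where
  "homology_map A B f X = (\<Union>z\<in>X. homology_class B (f z))"

definition quasi_isomorphism :: "('k, 'a) dga \<Rightarrow> ('k, 'b) dga \<Rightarrow> ('a \<Rightarrow> 'b) \<Rightarrow> bool" where
  "quasi_isomorphism A B f \<longleftrightarrow>
     dga_hom A B f \<and>
     (\<forall>p. bij_betw (homology_map A B f) (degree_part (homology A) p) (degree_part (homology B) p))"

text \<open>Isomorphism of the underlying graded algebras; the differentials play no role.\<close>

definition graded_algebra_isomorphic :: "('k, 'a) dga \<Rightarrow> ('k, 'b) dga \<Rightarrow> bool" where
  "graded_algebra_isomorphic A B \<longleftrightarrow>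
     (\<exists>f \<in> ring_iso A B. linear_on A B f \<and> (\<forall>p. f ` degree_part A p = degree_part B p))"

definition invariants :: "('k, 'a) dga \<Rightarrow> ('a \<Rightarrow> 'a) set \<Rightarrow> ('k, 'a) dga" where
  "invariants A G =
     A\<lparr>carrier := {a \<in> carrier A. \<forall>\<phi>\<in>G. \<phi> a = a},
       degree_part := (\<lambda>p. {a \<in> degree_part A p. \<forall>\<phi>\<in>G. \<phi> a = a})\<rparr>"


section \<open>The free graded commutative algebra on \<open>x\<^sub>i, y\<^sub>i\<close> (degree 0) and \<open>\<theta>\<^sub>i\<close> (degree 1)\<close>

datatype 'i xy = XVar 'i | YVar 'i

type_synonym ('i, 'k) xy_poly = "('i xy \<Rightarrow>\<^sub>0 nat) \<Rightarrow>\<^sub>0 'k"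

text \<open>
  The free algebra is \<open>k[x\<^sub>i, y\<^sub>i] \<otimes> \<Lambda>(\<theta>\<^sub>i)\<close>. Since the index type is finite, an element is a family of
  polynomials \<open>f\<^sub>S\<close>, \<open>S\<close> ranging over all subsets of the index type, standing for
  \<open>\<Sum>\<^sub>S f\<^sub>S \<theta>\<^sub>S\<close>, where \<open>\<theta>\<^sub>S\<close> is the product of the \<open>\<theta>\<^sub>i\<close>, \<open>i \<in> S\<close>, in the order of
  \<^const>\<open>enum_class.enum\<close>. (The \<^class>\<open>enum\<close> order is used because it is available on pairs; the
  choice of order only affects the basis.)
\<close>

typedef (overloaded) ('i, 'k) gca = "UNIV :: ('i set \<Rightarrow> ('i, 'k::zero) xy_poly) set"
  morphisms coef Gca by simp

lemma coef_Gca [simp]: "coef (Gca f) = f"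
  by (simp add: Gca_inverse)

lemma gca_eq_iff: "f = g \<longleftrightarrow> (\<forall>S. coef f S = coef g S)"
  by (metis coef_inject ext)

definition enum_pos :: "'i::enum \<Rightarrow> nat" where
  "enum_pos i = (LEAST p. enum_class.enum ! p = i)"

text \<open>The sign \<open>\<epsilon>\<close> in \<open>\<theta>\<^sub>S \<theta>\<^sub>T = \<epsilon> \<theta>\<^bsub>S \<union> T\<^esub>\<close> for disjoint \<open>S\<close>, \<open>T\<close>: count the inversions.\<close>

definition koszul_sign :: "'i::enum set \<Rightarrow> 'i set \<Rightarrow> 'a::ring_1" where
  "koszul_sign S T = (-1) ^ card {(s, t) \<in> S \<times> T. enum_pos t < enum_pos s}"

lemma koszul_sign_empty [simp]: "koszul_sign {} T = 1" "koszul_sign S {} = 1"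
  by (simp_all add: koszul_sign_def)

lemma koszul_sign_Un_left:
  assumes "S \<inter> T = {}"
  shows "koszul_sign (S \<union> T) R = koszul_sign S R * koszul_sign T R"
proof -
  have "{(s, t) \<in> (S \<union> T) \<times> R. enum_pos t < enum_pos s} =
        {(s, t) \<in> S \<times> R. enum_pos t < enum_pos s} \<union> {(s, t) \<in> T \<times> R. enum_pos t < enum_pos s}" by auto
  moreover have "card \<dots> = card {(s, t) \<in> S \<times> R. enum_pos t < enum_pos s} + card {(s, t) \<in> T \<times> R. enum_pos t < enum_pos s}"
    using assms by (intro card_Un_disjoint) auto
  ultimately show ?thesis by (simp add: koszul_sign_def power_add)
qed

lemma koszul_sign_Un_right:
  assumes "S \<inter> T = {}"
  shows "koszul_sign R (S \<union> T) = koszul_sign R S * koszul_sign R T"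
proof -
  have "{(s, t) \<in> R \<times> (S \<union> T). enum_pos t < enum_pos s} =
        {(s, t) \<in> R \<times> S. enum_pos t < enum_pos s} \<union> {(s, t) \<in> R \<times> T. enum_pos t < enum_pos s}" by auto
  moreover have "card \<dots> = card {(s, t) \<in> R \<times> S. enum_pos t < enum_pos s} + card {(s, t) \<in> R \<times> T. enum_pos t < enum_pos s}"
    using assms by (intro card_Un_disjoint) auto
  ultimately show ?thesis by (simp add: koszul_sign_def power_add)
qed

instantiation gca :: (enum, comm_ring_1) ring_1
begin

definition "0 = Gca (\<lambda>_. 0)"
definition "1 = Gca (\<lambda>S. if S = {} then 1 else 0)"
definition "f + g = Gca (\<lambda>S. coef f S + coef g S)"
definition "f - g = Gca (\<lambda>S. coef f S - coef g S)"
definition "- f = Gca (\<lambda>S. - coef f S)"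
definition "f * g =
  Gca (\<lambda>U. \<Sum>S\<in>Pow U. koszul_sign S (U - S) * coef f S * coef g (U - S))"

instance
proof
  fix a b c :: "('a, 'b) gca"
  show "a * b * c = a * (b * c)"
    unfolding gca_eq_iff
  proof
    fix U :: "'a set"
    define t where "t S T = koszul_sign S (U - S) * koszul_sign T (U - S - T) *
      coef a S * coef b T * coef c (U - S - T)" for S T
    define u where "u V S = koszul_sign V (U - V) *
      (koszul_sign S (V - S) * coef a S * coef b (V - S)) * coef c (U - V)" for V S
    have tu: "t S (V - S) = u V S" if VS: "V \<subseteq> U" "S \<subseteq> V" for V S
    proof -
      have "koszul_sign V (U - V) = (koszul_sign S (U - V) * koszul_sign (V - S) (U - V)
              :: ('a, 'b) xy_poly)"
        using koszul_sign_Un_left[of S "V - S" "U - V"] VS by (simp add: Un_absorb1)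
      moreover have "koszul_sign S (U - S) = (koszul_sign S (V - S) * koszul_sign S (U - V)
              :: ('a, 'b) xy_poly)"
      proof -
        have "U - S = (V - S) \<union> (U - V)" using VS by auto
        then show ?thesis using koszul_sign_Un_right[of "V - S" "U - V" S] by auto
      qed
      moreover have "U - S - (V - S) = U - V" using VS by auto
      ultimately show ?thesis by (simp add: t_def u_def mult_ac)
    qed
    have "coef (a * b * c) U = (\<Sum>(V, S)\<in>(SIGMA V:Pow U. Pow V). u V S)"
      by (simp add: u_def times_gca_def sum_distrib_left sum_distrib_right sum.Sigma)
    also have "\<dots> = (\<Sum>(S, T)\<in>(SIGMA S:Pow U. Pow (U - S)). t S T)"
      by (rule sum.reindex_bij_witness[where i = "\<lambda>(S, T). (S \<union> T, S)" and j = "\<lambda>(V, S). (S, V - S)"])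
         (auto simp: tu)
    also have "\<dots> = coef (a * (b * c)) U"
      by (simp add: t_def times_gca_def sum_distrib_left sum.Sigma mult_ac)
    finally show "coef (a * b * c) U = coef (a * (b * c)) U" .
  qed
  show "1 * a = a"
  proof -
    have "(\<Sum>S\<in>Pow U. koszul_sign S (U - S) * (if S = {} then 1 else 0) * coef a (U - S)) = coef a U"
      for U
      by (subst sum.mono_neutral_right[where S = "{{}}"]) auto
    then show ?thesis by (simp add: gca_eq_iff times_gca_def one_gca_def)
  qed
  show "a * 1 = a"
  proof -
    have "(\<Sum>S\<in>Pow U. koszul_sign S (U - S) * coef a S * (if U - S = {} then 1 else 0)) = coef a U"
      for U
      by (subst sum.mono_neutral_right[where S = "{U}"]) auto
    then show ?thesis by (simp add: gca_eq_iff times_gca_def one_gca_def)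
  qed
  show "(0::('a, 'b) gca) \<noteq> 1"
    by (auto simp: gca_eq_iff zero_gca_def one_gca_def)
qed (simp_all add: gca_eq_iff zero_gca_def plus_gca_def minus_gca_def uminus_gca_def times_gca_def
       algebra_simps sum.distrib)

end

definition pconst :: "'k::comm_ring_1 \<Rightarrow> ('i, 'k) xy_poly" where
  "pconst c = Poly_Mapping.single 0 c"

definition pvar :: "'i xy \<Rightarrow> ('i, 'k::comm_ring_1) xy_poly" where
  "pvar v = Poly_Mapping.single (Poly_Mapping.single v 1) 1"

definition of_poly :: "('i, 'k) xy_poly \<Rightarrow> ('i, 'k::comm_ring_1) gca" where
  "of_poly p = Gca (\<lambda>S. if S = {} then p else 0)"

definition scale :: "'k \<Rightarrow> ('i, 'k) gca \<Rightarrow> ('i, 'k::comm_ring_1) gca" where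
  "scale c f = Gca (\<lambda>S. pconst c * coef f S)"

definition \<theta> :: "'i \<Rightarrow> ('i, 'k::comm_ring_1) gca" where
  "\<theta> i = Gca (\<lambda>S. if S = {i} then 1 else 0)"

definition homogeneous :: "nat \<Rightarrow> ('i, 'k::comm_ring_1) gca set" where
  "homogeneous p = {f. \<forall>S. card S \<noteq> p \<longrightarrow> coef f S = 0}"

text \<open>
  The \<open>k[x\<^sub>i, y\<^sub>i]\<close>-linear differential with \<open>d \<theta>\<^sub>i = a\<^sub>i\<close>: one has
  \<open>d (\<theta>\<^sub>i \<theta>\<^sub>S) = a\<^sub>i \<theta>\<^sub>S - \<theta>\<^sub>i d \<theta>\<^sub>S\<close>, whence the coefficient of \<open>\<theta>\<^sub>S\<close> in \<open>d f\<close> is the sum of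
  \<open>\<plusminus> a\<^sub>i f\<^bsub>insert i S\<^esub>\<close> over \<open>i \<notin> S\<close>.
\<close>

definition koszul_diff :: "('i \<Rightarrow> ('i, 'k) xy_poly) \<Rightarrow> ('i::enum, 'k::comm_ring_1) gca \<Rightarrow> ('i, 'k) gca"
  where "koszul_diff a f =
    Gca (\<lambda>S. \<Sum>i\<in>-S. koszul_sign {i} S * a i * coef f (insert i S))"

lemma koszul_diff_of_poly: "koszul_diff a (of_poly p) = 0"
  by (simp add: koszul_diff_def of_poly_def gca_eq_iff zero_gca_def)

lemma koszul_diff_theta: "koszul_diff a (\<theta> i) = of_poly (a i)"
proof -
  have "insert j S = {i} \<longleftrightarrow> S = {} \<and> j = i" if "j \<notin> S" for j S
    using that by auto
  then have "(\<Sum>j\<in>- S. koszul_sign {j} S * a j * (if insert j S = {i} then 1 else 0)) =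
      (if S = {} then a i else 0)" for S
    by (cases "S = {}") (auto simp: if_distrib cong: if_cong)
  then show ?thesis by (simp add: koszul_diff_def of_poly_def \<theta>_def gca_eq_iff)
qed

lemma koszul_sign_square [simp]: "koszul_sign S T * koszul_sign S T = (1::'a::comm_ring_1)"
  unfolding koszul_sign_def by (simp flip: power_mult_distrib)

lemma koszul_sign_swap:
  fixes i :: "'i::enum"
  assumes "i \<notin> T"
  shows "koszul_sign {i} T * koszul_sign T {i} = ((-1) ^ card T :: 'a::comm_ring_1)"
proof -
  have inj: "inj (enum_pos :: 'i \<Rightarrow> nat)"
  proof (rule injI)
    fix x y :: 'i
    assume xy: "enum_pos x = enum_pos y"
    have *: "enum_class.enum ! enum_pos z = z" for z :: 'i
    proof -
      have "z \<in> set enum_class.enum" by (simp add: enum_UNIV)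
      then have "\<exists>p. enum_class.enum ! p = z" unfolding in_set_conv_nth by blast
      then show ?thesis
        unfolding enum_pos_def by (rule LeastI_ex[of "\<lambda>p. enum_class.enum ! p = z"])
    qed
    show "x = y" using *[of x] *[of y] unfolding xy by (rule trans[OF sym])
  qed
  have "{(s, t) \<in> {i} \<times> T. enum_pos t < enum_pos s} = Pair i ` {t \<in> T. enum_pos t < enum_pos i}"
    "{(s, t) \<in> T \<times> {i}. enum_pos t < enum_pos s} = (\<lambda>t. (t, i)) ` {t \<in> T. enum_pos i < enum_pos t}"
    by auto
  then have c: "card {(s, t) \<in> {i} \<times> T. enum_pos t < enum_pos s} = card {t \<in> T. enum_pos t < enum_pos i}"
    "card {(s, t) \<in> T \<times> {i}. enum_pos t < enum_pos s} = card {t \<in> T. enum_pos i < enum_pos t}"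
    by (simp_all add: card_image inj_on_def)
  have "enum_pos t \<noteq> enum_pos i" if "t \<in> T" for t
    using assms injD[OF inj, of t i] that by blast
  then have "{t \<in> T. enum_pos t < enum_pos i} \<union> {t \<in> T. enum_pos i < enum_pos t} = T"
    using nat_neq_iff by blast
  moreover have "card ({t \<in> T. enum_pos t < enum_pos i} \<union> {t \<in> T. enum_pos i < enum_pos t}) =
      card {t \<in> T. enum_pos t < enum_pos i} + card {t \<in> T. enum_pos i < enum_pos t}"
    by (rule card_Un_disjoint) auto
  ultimately have "card T = card {t \<in> T. enum_pos t < enum_pos i} + card {t \<in> T. enum_pos i < enum_pos t}"
    by simp
  then show ?thesis unfolding koszul_sign_def c by (simp add: power_add)
qed

lemma koszul_diff_mult:
  fixes f g :: "('i::enum, 'k::comm_ring_1) gca"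
  assumes f: "f \<in> homogeneous p"
  shows "koszul_diff a (f * g) = koszul_diff a f * g + (- 1) ^ p * (f * koszul_diff a g)"
  unfolding gca_eq_iff
proof
  fix S :: "'i set"
  let ?k = "koszul_sign :: 'i set \<Rightarrow> 'i set \<Rightarrow> ('i, 'k) xy_poly"
  define A where "A i T = ?k T (S - T) * ?k {i} T * a i * coef f (insert i T) * coef g (S - T)" for i T
  define B where "B i T = (-1) ^ p * ?k T (S - T) * ?k {i} (S - T) * a i * coef f T *
    coef g (insert i (S - T))" for i T
  have minus: "coef ((-1) ^ p * h) S = (-1) ^ p * coef h S" for h :: "('i, 'k) gca"
  proof (induction p arbitrary: h)
    case (Suc p)
    have "coef ((-1) ^ Suc p * h) S = coef (- ((-1) ^ p * h)) S" by simp
    also have "\<dots> = - coef ((-1) ^ p * h) S" by (simp only: uminus_gca_def coef_Gca)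
    finally show ?case using Suc by simp
  qed simp
  have sq: "?k U V * (?k U V * w) = w" for U V w
    by (simp flip: mult.assoc)
  have split: "(\<Sum>T\<in>Pow (insert i S). F T) = (\<Sum>T\<in>Pow S. F (insert i T)) + (\<Sum>T\<in>Pow S. F T)"
    if "i \<notin> S" for i and F :: "'i set \<Rightarrow> ('i, 'k) xy_poly"
  proof -
    have "inj_on (insert i) (Pow S)" using that by (auto simp: inj_on_def)
    moreover have "Pow S \<inter> insert i ` Pow S = {}" using that by auto
    ultimately show ?thesis
      by (simp add: Pow_insert sum.union_disjoint sum.reindex add.commute)
  qed
  have L1: "?k {i} S * a i * (?k (insert i T) (insert i S - insert i T) * coef f (insert i T) *
      coef g (insert i S - insert i T)) = A i T" if "i \<notin> S" "T \<subseteq> S" for i T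
  proof -
    have e: "insert i S - insert i T = S - T" using that by auto
    have "?k {i} S = ?k {i} T * ?k {i} (S - T)"
      using koszul_sign_Un_right[of T "S - T" "{i}"] that by (simp add: Un_absorb1)
    moreover have "?k (insert i T) (S - T) = ?k {i} (S - T) * ?k T (S - T)"
      using koszul_sign_Un_left[of "{i}" T "S - T"] that by auto
    ultimately show ?thesis by (simp add: A_def e mult.left_commute mult.commute sq)
  qed
  have L2: "?k {i} S * a i * (?k T (insert i S - T) * coef f T * coef g (insert i S - T)) = B i T"
    if "i \<notin> S" "T \<subseteq> S" for i T
  proof (cases "card T = p")
    case True
    have "i \<notin> T" and e: "insert i S - T = insert i (S - T)" using that by auto
    have "?k {i} S = ?k {i} T * ?k {i} (S - T)"
      using koszul_sign_Un_right[of T "S - T" "{i}"] that by (simp add: Un_absorb1)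
    moreover have "?k T (insert i (S - T)) = ?k T {i} * ?k T (S - T)"
      using koszul_sign_Un_right[of "{i}" "S - T" T] that by auto
    moreover have "(-1) ^ p = ?k {i} T * ?k T {i}"
      using koszul_sign_swap[of i T, where 'a = "('i, 'k) xy_poly"] True \<open>i \<notin> T\<close> by simp
    ultimately show ?thesis by (simp add: B_def e mult_ac)
  next
    case False
    then have "coef f T = 0" using f by (simp add: homogeneous_def)
    then show ?thesis by (simp add: B_def)
  qed
  have AB: "A i T = - B i (insert i T)" if "T \<subseteq> S" "i \<in> S - T" for i T
  proof (cases "p = Suc (card T)")
    case True
    have e: "insert i (S - insert i T) = S - T" using that by auto
    let ?R = "S - insert i T"
    have "?k T (S - T) = ?k T {i} * ?k T ?R"
      using koszul_sign_Un_right[of "{i}" ?R T] by (simp add: e)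
    moreover have "?k (insert i T) ?R = ?k {i} ?R * ?k T ?R"
      using koszul_sign_Un_left[of "{i}" T ?R] that by auto
    moreover have "(-1) ^ p = - (?k {i} T * ?k T {i})"
      using koszul_sign_swap[of i T, where 'a = "('i, 'k) xy_poly"] True that by auto
    ultimately show ?thesis by (simp add: A_def B_def e mult_ac sq)
  next
    case False
    moreover have "card (insert i T) = Suc (card T)" using that by simp
    ultimately have "coef f (insert i T) = 0" using f by (simp add: homogeneous_def)
    then show ?thesis by (simp add: A_def B_def)
  qed
  have "coef (koszul_diff a (f * g)) S =
      (\<Sum>i\<in>-S. \<Sum>T\<in>Pow (insert i S). ?k {i} S * a i *
        (?k T (insert i S - T) * coef f T * coef g (insert i S - T)))"
    by (simp add: koszul_diff_def times_gca_def sum_distrib_left)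
  also have "\<dots> = (\<Sum>i\<in>-S. (\<Sum>T\<in>Pow S. A i T) + (\<Sum>T\<in>Pow S. B i T))"
  proof (intro sum.cong refl)
    fix i assume "i \<in> - S"
    then have i: "i \<notin> S" by simp
    show "(\<Sum>T\<in>Pow (insert i S). ?k {i} S * a i *
        (?k T (insert i S - T) * coef f T * coef g (insert i S - T))) =
      (\<Sum>T\<in>Pow S. A i T) + (\<Sum>T\<in>Pow S. B i T)"
      unfolding split[OF i] by (intro arg_cong2[where f = "(+)"] sum.cong refl L1 L2 i) auto
  qed
  also have "\<dots> = (\<Sum>T\<in>Pow S. \<Sum>i\<in>-S. A i T) + (\<Sum>T\<in>Pow S. \<Sum>i\<in>-S. B i T)"
    unfolding sum.distrib by (intro arg_cong2[where f = "(+)"] sum.swap)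
  finally have lhs: "coef (koszul_diff a (f * g)) S = \<dots>" .
  have "coef (koszul_diff a f * g) S = (\<Sum>T\<in>Pow S. \<Sum>i\<in>-T. A i T)"
    by (simp add: koszul_diff_def times_gca_def A_def sum_distrib_left sum_distrib_right mult_ac)
  also have "\<dots> = (\<Sum>T\<in>Pow S. (\<Sum>i\<in>-S. A i T) + (\<Sum>i\<in>S - T. A i T))"
  proof (intro sum.cong refl)
    fix T assume "T \<in> Pow S"
    then have e: "- T = - S \<union> (S - T)" and d: "- S \<inter> (S - T) = {}" by auto
    show "(\<Sum>i\<in>-T. A i T) = (\<Sum>i\<in>-S. A i T) + (\<Sum>i\<in>S - T. A i T)"
      by (subst e) (rule sum.union_disjoint[OF finite finite d])
  qed
  finally have r1: "coef (koszul_diff a f * g) S = \<dots>" .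
  have "coef ((-1) ^ p * (f * koszul_diff a g)) S = (\<Sum>T\<in>Pow S. \<Sum>i\<in>-(S - T). B i T)"
    by (simp only: minus) (simp add: koszul_diff_def times_gca_def B_def sum_distrib_left mult_ac)
  also have "\<dots> = (\<Sum>T\<in>Pow S. (\<Sum>i\<in>-S. B i T) + (\<Sum>i\<in>T. B i T))"
  proof (intro sum.cong refl)
    fix T assume "T \<in> Pow S"
    then have e: "- (S - T) = - S \<union> T" and d: "- S \<inter> T = {}" by auto
    show "(\<Sum>i\<in>-(S - T). B i T) = (\<Sum>i\<in>-S. B i T) + (\<Sum>i\<in>T. B i T)"
      by (subst e) (rule sum.union_disjoint[OF finite finite d])
  qed
  finally have r2: "coef ((-1) ^ p * (f * koszul_diff a g)) S = \<dots>" .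
  have "(\<Sum>T\<in>Pow S. \<Sum>i\<in>S - T. A i T) = (\<Sum>(T, i)\<in>(SIGMA T:Pow S. S - T). A i T)"
    by (simp add: sum.Sigma)
  also have "\<dots> = (\<Sum>(T, i)\<in>(SIGMA T:Pow S. T). - B i T)"
    by (rule sum.reindex_bij_witness[where i = "\<lambda>(T, i). (T - {i}, i)" and j = "\<lambda>(T, i). (insert i T, i)"])
       (auto simp: AB)
  also have "\<dots> = - (\<Sum>T\<in>Pow S. \<Sum>i\<in>T. B i T)"
    by (simp add: sum.Sigma sum_negf case_prod_unfold)
  finally have "(\<Sum>T\<in>Pow S. \<Sum>i\<in>S - T. A i T) + (\<Sum>T\<in>Pow S. \<Sum>i\<in>T. B i T) = 0"
    by simp
  then show "coef (koszul_diff a (f * g)) S =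
      coef (koszul_diff a f * g + (- 1) ^ p * (f * koszul_diff a g)) S"
    by (simp only: lhs plus_gca_def coef_Gca r1 r2 sum.distrib) (simp add: algebra_simps)
qed

definition free_dga :: "('i \<Rightarrow> ('i, 'k) xy_poly) \<Rightarrow> ('k, ('i::enum, 'k::comm_ring_1) gca) dga" where
  "free_dga a =
     \<lparr>carrier = UNIV, mult = (*), one = 1, zero = 0, add = (+), smult = scale,
      degree_part = homogeneous, differential = koszul_diff a\<rparr>"

text \<open>
  The homomorphism of graded algebras with \<open>v \<mapsto> \<sigma> v\<close> for \<open>v\<close> one of the \<open>x\<^sub>i, y\<^sub>i\<close> and
  \<open>\<theta>\<^sub>i \<mapsto> \<tau> i\<close> (where \<open>\<tau> i\<close> is of degree 1).
\<close>

definition psubst :: "('i xy \<Rightarrow> ('j, 'k) xy_poly) \<Rightarrow> ('i, 'k) xy_poly \<Rightarrow> ('j, 'k::comm_ring_1) xy_poly"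
  where "psubst \<sigma> p =
    (\<Sum>m\<in>Poly_Mapping.keys p. pconst (Poly_Mapping.lookup p m) *
       (\<Prod>v\<in>Poly_Mapping.keys m. \<sigma> v ^ Poly_Mapping.lookup m v))"

definition gca_hom :: "('i xy \<Rightarrow> ('j, 'k) xy_poly) \<Rightarrow> ('i \<Rightarrow> ('j, 'k) gca) \<Rightarrow>
    ('i::enum, 'k) gca \<Rightarrow> ('j::enum, 'k::comm_ring_1) gca"
  where "gca_hom \<sigma> \<tau> f =
    (\<Sum>S\<in>UNIV. of_poly (psubst \<sigma> (coef f S)) *
       prod_list (map \<tau> (filter (\<lambda>i. i \<in> S) enum_class.enum)))"

lemma psubst_pvar: "psubst \<sigma> (pvar v) = \<sigma> v"
  by (simp add: psubst_def pvar_def pconst_def)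

lemma gca_hom_of_poly: "gca_hom \<sigma> \<tau> (of_poly p) = of_poly (psubst \<sigma> p)"
proof -
  have z: "of_poly 0 = 0" "psubst \<sigma> 0 = 0"
    by (simp_all add: of_poly_def zero_gca_def psubst_def)
  have c: "coef (of_poly p) S = (if S = {} then p else 0)" for S
    by (simp add: of_poly_def)
  show ?thesis
    unfolding gca_hom_def c
    by (subst sum.mono_neutral_right[where S = "{{}}"]) (auto simp: z)
qed

lemma gca_hom_theta: "gca_hom \<sigma> \<tau> (\<theta> i) = \<tau> i"
proof -
  have z: "of_poly 0 = 0" "psubst \<sigma> 0 = 0" "of_poly (psubst \<sigma> 1) = 1"
    by (simp_all add: of_poly_def zero_gca_def one_gca_def psubst_def pconst_def)
  have "filter (\<lambda>j. j = i) xs = (if i \<in> set xs then [i] else [])" if "distinct xs" for xs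
    using that by (induction xs) auto
  then have e: "filter (\<lambda>j. j = i) enum_class.enum = [i]"
    by (simp add: enum_distinct enum_UNIV)
  show ?thesis
    unfolding gca_hom_def
    by (subst sum.mono_neutral_right[where S = "{{i}}"]) (auto simp: \<theta>_def z e)
qed


section \<open>The derived Harish-Chandra homomorphism\<close>


text \<open>
  The size of the matrices is the cardinality of the index type \<open>'n\<close>; e.g. the numeral type \<open>2\<close>
  for 2-by-2 matrices.
\<close>

definition DRep :: "('k::field, ('n::enum \<times> 'n, 'k) gca) dga" where
  "DRep = free_dga (\<lambda>(i, j).
     \<Sum>l\<in>UNIV. pvar (XVar (i, l)) * pvar (YVar (l, j)) - pvar (YVar (i, l)) * pvar (XVar (l, j)))"

text \<open>Conjugation: each of the generic matrices \<open>M = x, y, \<theta>\<close> is sent to \<open>g M g\<^sup>-\<^sup>1\<close>.\<close>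

definition conj_action :: "(('k, 'n) vec, 'n) vec \<Rightarrow> ('n::enum \<times> 'n, 'k::field) gca \<Rightarrow> ('n \<times> 'n, 'k) gca" where
  "conj_action g = gca_hom
     (\<lambda>v. case v of
        XVar (i, j) \<Rightarrow> \<Sum>l\<in>UNIV. \<Sum>m\<in>UNIV. pconst (g $ i $ l * matrix_inv g $ m $ j) * pvar (XVar (l, m))
      | YVar (i, j) \<Rightarrow> \<Sum>l\<in>UNIV. \<Sum>m\<in>UNIV. pconst (g $ i $ l * matrix_inv g $ m $ j) * pvar (YVar (l, m)))
     (\<lambda>(i, j). \<Sum>l\<in>UNIV. \<Sum>m\<in>UNIV. scale (g $ i $ l * matrix_inv g $ m $ j) (\<theta> (l, m)))"

definition DRep_GL :: "('k::field, ('n::enum \<times> 'n, 'k) gca) dga" where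
  "DRep_GL = invariants DRep (conj_action ` {g. invertible g})"

definition diag_algebra :: "('k::field, ('n::enum, 'k) gca) dga" where
  "diag_algebra = free_dga (\<lambda>_. 0)"

definition perm_action :: "('n \<Rightarrow> 'n) \<Rightarrow> ('n::enum, 'k::field) gca \<Rightarrow> ('n, 'k) gca" where
  "perm_action \<pi> = gca_hom
     (\<lambda>v. case v of XVar i \<Rightarrow> pvar (XVar (\<pi> i)) | YVar i \<Rightarrow> pvar (YVar (\<pi> i))) (\<lambda>i. \<theta> (\<pi> i))"

definition diag_algebra_S :: "('k::field, ('n::enum, 'k) gca) dga" where
  "diag_algebra_S = invariants diag_algebra (perm_action ` {\<pi>. bij \<pi>})"

definition \<Phi> :: "('n::enum \<times> 'n, 'k::field) gca \<Rightarrow> ('n, 'k) gca" where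
  "\<Phi> = gca_hom
     (\<lambda>v. case v of
        XVar (i, j) \<Rightarrow> if i = j then pvar (XVar i) else 0
      | YVar (i, j) \<Rightarrow> if i = j then pvar (YVar i) else 0)
     (\<lambda>(i, j). if i = j then \<theta> i else 0)"

end

theory Submission
  imports Defs "HOL-Analysis.Determinants" "HOL-Computational_Algebra.Polynomial"
begin

text \<open>
  After splitting off \<open>tt = tr \<theta>\<close>, an element is \<open>p + tr (W \<theta>) + tr (V \<theta>\<^sup>2) + q tr (\<theta>\<^sup>3) / 3\<close> with polynomials
  \<open>p, q\<close> and traceless matrices \<open>W, V\<close> of polynomials, and it is invariant iff \<open>p, q\<close> are invariant and
  \<open>W, V\<close> are covariant under simultaneous conjugation of \<open>X, Y\<close>. By the first fundamental theorem, the
  invariant polynomials form \<open>R = k[tr X, tr Y, qa, qb, qc]\<close>, where \<open>X\<^sub>0, Y\<^sub>0\<close> are the traceless parts,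
  \<open>qa = tr (X\<^sub>0\<^sup>2) / 2\<close>, \<open>qb = tr (X\<^sub>0 Y\<^sub>0)\<close> and \<open>qc = tr (Y\<^sub>0\<^sup>2) / 2\<close>; the traceless covariants are free over \<open>R\<close>
  with basis \<open>X\<^sub>0, Y\<^sub>0, M = [X, Y]\<close>. In these bases
  \<open>d (p + tr (W \<theta>) + tr (V \<theta>\<^sup>2) + q tr (\<theta>\<^sup>3) / 3) = tr (W M) + tr ([V, M] \<theta>) + q tr (M \<theta>\<^sup>2)\<close>
  with \<open>tr (M\<^sup>2) = 2 D\<close>, \<open>D = qb\<^sup>2 - 4 qa qc\<close>, and \<open>[X\<^sub>0, M] = 4 qa Y\<^sub>0 - 2 qb X\<^sub>0\<close>, \<open>[Y\<^sub>0, M] = 2 qb Y\<^sub>0 - 4 qc X\<^sub>0\<close>.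
  So the homology is \<open>R / D\<close> in degree 0 and the cokernel of a matrix factorization of \<open>D\<close> in degree 1.
  Restriction to diagonal matrices identifies these with the even and the odd part, under
  \<open>(u, v) \<mapsto> (-u, -v)\<close>, of the polynomials in the traces and the half differences \<open>u, v\<close> of the diagonal entries.
\<close>

subsection \<open>Evaluation of polynomials\<close>

text \<open>The field need not be algebraically closed, so a matrix over \<open>k\<close> may have
  no eigenvalue and pairs cannot be brought to a triangular shape at will. What remains is that
  \<open>k\<close> is infinite: a polynomial is determined by its values at \<open>k\<close>-points,
  even away from a hypersurface, and along a polynomial curve finitely many exceptional parameters
  may be ignored. The first fundamental theorem is therefore proved on an explicit slice, reached by
  prescribing an eigenvector instead of solving for an eigenvalue. Most of the rest hangs on one
  divisibility: an invariant that vanishes on diagonal pairs is a multiple of \<open>D\<close>. It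
  yields the coefficients of covariants, since Cramer's rule for the trace form has \<open>D\<close>
  as denominator, and it yields the kernel in degree 0. In degree 1, commutation with
  \<open>M\<close> acts on the span of the traceless parts by a matrix whose square is
  \<open>4 D\<close>; on diagonal pairs that same matrix produces the syzygies of
  \<open>(u, v)\<close>. As \<open>tt\<close> is a cycle, every element is \<open>F + tt G\<close>
  with \<open>F\<close> and \<open>G\<close> free of \<open>tt\<close>, and both summands are
  treated alike.\<close>

lemma xy_poly_induct [case_names const var add mult]:
  fixes p :: "('i, 'k::comm_ring_1) xy_poly"
  assumes const: "\<And>c. P (pconst c)" and var: "\<And>v. P (pvar v)"
    and add: "\<And>p q. P p \<Longrightarrow> P q \<Longrightarrow> P (p + q)" and mult: "\<And>p q. P p \<Longrightarrow> P q \<Longrightarrow> P (p * q)"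
  shows "P p"
proof -
  have one: "P 1"
    using const[of 1] by (simp add: pconst_def)
  have var_power: "P (Poly_Mapping.single (Poly_Mapping.single v n) 1)" for v n
  proof (induction n)
    case 0
    then show ?case using one by simp
  next
    case (Suc n)
    have "Poly_Mapping.single (Poly_Mapping.single v (Suc n)) (1::'k) =
        pvar v * Poly_Mapping.single (Poly_Mapping.single v n) 1"
      by (simp add: pvar_def mult_single flip: single_add)
    then show ?case using mult[OF var Suc] by simp
  qed
  have mon: "P (Poly_Mapping.single m 1)" for m
  proof (induction m rule: Poly_Mapping.update_induct)
    case const
    then show ?case using one by simp
  next
    case (update f a b)
    have "Poly_Mapping.update a b f = Poly_Mapping.single a b + f"
      using update(1) by (intro poly_mapping_eqI)
        (auto simp: lookup_update lookup_add lookup_single when_def in_keys_iff)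
    then have "Poly_Mapping.single (Poly_Mapping.update a b f) (1::'k) =
        Poly_Mapping.single (Poly_Mapping.single a b) 1 * Poly_Mapping.single f 1"
      by (simp add: mult_single)
    then show ?case using mult[OF var_power update(3)] by simp
  qed
  show ?thesis
  proof (induction p rule: Poly_Mapping.update_induct)
    case const
    then show ?case using assms(1)[of 0] by (simp add: pconst_def)
  next
    case (update f a b)
    have "Poly_Mapping.update a b f = pconst b * Poly_Mapping.single a 1 + f"
      using update(1) by (intro poly_mapping_eqI)
        (auto simp: pconst_def mult_single lookup_update lookup_add lookup_single when_def in_keys_iff)
    then show ?case using add[OF mult[OF assms(1) mon] update(3)] by simp
  qed
qed

section \<open>Ring homomorphisms out of polynomial rings\<close>

definition mon :: "('i xy \<Rightarrow> 'r) \<Rightarrow> ('i xy \<Rightarrow>\<^sub>0 nat) \<Rightarrow> 'r::comm_ring_1" where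
  "mon \<sigma> m = (\<Prod>v\<in>Poly_Mapping.keys m. \<sigma> v ^ Poly_Mapping.lookup m v)"

text \<open>The coefficient map \<open>h\<close> is left open so that substitution
  (\<open>h = pconst\<close>) and evaluation at points of the base field (\<open>h\<close> the
  identity) share one proof of being ring homomorphisms.\<close>

definition peval :: "('k \<Rightarrow> 'r) \<Rightarrow> ('i xy \<Rightarrow> 'r) \<Rightarrow> ('i, 'k::comm_ring_1) xy_poly \<Rightarrow> 'r::comm_ring_1"
  where "peval h \<sigma> p =
    (\<Sum>m\<in>Poly_Mapping.keys p. h (Poly_Mapping.lookup p m) * mon \<sigma> m)"

lemma mon_superset:
  assumes "finite V" "Poly_Mapping.keys m \<subseteq> V"
  shows "mon \<sigma> m = (\<Prod>v\<in>V. \<sigma> v ^ Poly_Mapping.lookup m v)"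
  unfolding mon_def by (rule prod.mono_neutral_left) (use assms in \<open>auto simp: in_keys_iff\<close>)

lemma mon_0 [simp]: "mon \<sigma> 0 = 1"
  by (simp add: mon_def)

lemma mon_add: "mon \<sigma> (m + n) = mon \<sigma> m * mon \<sigma> n"
proof -
  let ?V = "Poly_Mapping.keys m \<union> Poly_Mapping.keys n"
  have "mon \<sigma> (m + n) = (\<Prod>v\<in>?V. \<sigma> v ^ Poly_Mapping.lookup (m + n) v)"
    by (rule mon_superset) (simp_all add: keys_add)
  also have "\<dots> = mon \<sigma> m * mon \<sigma> n"
    by (simp add: mon_superset[of ?V] lookup_add power_add prod.distrib)
  finally show ?thesis .
qed

lemma peval_superset:
  assumes "h 0 = 0" "finite K" "Poly_Mapping.keys p \<subseteq> K"
  shows "peval h \<sigma> p = (\<Sum>m\<in>K. h (Poly_Mapping.lookup p m) * mon \<sigma> m)"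
  unfolding peval_def by (rule sum.mono_neutral_left) (use assms in \<open>auto simp: in_keys_iff\<close>)

lemma peval_single: "h 0 = 0 \<Longrightarrow> peval h \<sigma> (Poly_Mapping.single m c) = h c * mon \<sigma> m"
  by (simp add: peval_superset[of h "{m}"])

lemma peval_add:
  assumes "h 0 = 0" "\<And>a b. h (a + b) = h a + h b"
  shows "peval h \<sigma> (p + q) = peval h \<sigma> p + peval h \<sigma> q"
proof -
  let ?K = "Poly_Mapping.keys p \<union> Poly_Mapping.keys q"
  have "Poly_Mapping.keys (p + q) \<subseteq> ?K" by (rule keys_add)
  then show ?thesis
    by (simp add: peval_superset[of h ?K] assms lookup_add sum.distrib distrib_right)
qed

lemma peval_mult:
  assumes h: "h 0 = 0" "\<And>a b. h (a + b) = h a + h b" "\<And>a b. h (a * b) = h a * h b"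
  shows "peval h \<sigma> (p * q) = peval h \<sigma> p * peval h \<sigma> q"
proof -
  have decompose: "p = (\<Sum>m\<in>Poly_Mapping.keys p. Poly_Mapping.single m (Poly_Mapping.lookup p m))" for p :: "('c, 'b) xy_poly"
    by (rule poly_mapping_eqI)
      (auto simp: lookup_sum lookup_single when_def in_keys_iff sum.delta)
  have sum: "peval h \<sigma> (\<Sum>x\<in>S. F x) = (\<Sum>x\<in>S. peval h \<sigma> (F x))" if "finite S" for S F
    using that by induction (simp_all add: peval_add h, simp add: peval_def)
  have "p * q = (\<Sum>m\<in>Poly_Mapping.keys p. \<Sum>n\<in>Poly_Mapping.keys q.
      Poly_Mapping.single (m + n) (Poly_Mapping.lookup p m * Poly_Mapping.lookup q n))"
    by (subst decompose[of p], subst decompose[of q]) (simp add: sum_product mult_single)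
  also have "peval h \<sigma> \<dots> = peval h \<sigma> p * peval h \<sigma> q"
    by (simp add: sum peval_single h mon_add) (simp add: peval_def sum_product mult_ac)
  finally show ?thesis .
qed

lemma pconst_simps:
  "pconst 0 = 0" "pconst 1 = 1" "pconst (a + b) = pconst a + pconst b"
  "pconst (a * b) = pconst a * pconst b" "pconst (a - b) = pconst a - pconst b" "pconst (- a) = - pconst a"
  by (simp_all add: pconst_def single_add mult_single single_diff single_uminus)

lemma pconst_numeral: "pconst (numeral n) = numeral n"
  by (simp add: pconst_def)

lemma psubst_eq_peval: "psubst \<sigma> = peval pconst \<sigma>"
  by (simp add: psubst_def peval_def mon_def fun_eq_iff)

lemma psubst_pconst: "psubst \<sigma> (pconst c) = pconst c"
  unfolding psubst_eq_peval by (simp add: pconst_def peval_single)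

lemma psubst_add: "psubst \<sigma> (p + q) = psubst \<sigma> p + psubst \<sigma> q"
  unfolding psubst_eq_peval by (rule peval_add) (simp_all add: pconst_simps)

lemma psubst_mult: "psubst \<sigma> (p * q) = psubst \<sigma> p * psubst \<sigma> q"
  unfolding psubst_eq_peval by (rule peval_mult) (simp_all add: pconst_simps)

lemma psubst_0: "psubst \<sigma> 0 = 0"
  using psubst_pconst[of \<sigma> 0] by (simp add: pconst_simps)

lemma psubst_1: "psubst \<sigma> 1 = 1"
  using psubst_pconst[of \<sigma> 1] by (simp add: pconst_simps)

lemma psubst_uminus: "psubst \<sigma> (- p) = - psubst \<sigma> p"
  using psubst_add[of \<sigma> p "- p"] by (simp add: psubst_0 eq_neg_iff_add_eq_0 add.commute)

lemma psubst_diff: "psubst \<sigma> (p - q) = psubst \<sigma> p - psubst \<sigma> q"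
  using psubst_add[of \<sigma> p "- q"] by (simp add: psubst_uminus)

lemma psubst_numeral: "psubst \<sigma> (numeral n) = numeral n"
  using psubst_pconst[of \<sigma> "numeral n"] by (simp add: pconst_numeral)

lemma psubst_sum: "psubst \<sigma> (\<Sum>x\<in>S. F x) = (\<Sum>x\<in>S. psubst \<sigma> (F x))"
  by (induction S rule: infinite_finite_induct) (simp_all add: psubst_0 psubst_add)

lemmas psubst_simps = psubst_pconst psubst_pvar psubst_add psubst_mult psubst_0 psubst_1
  psubst_uminus psubst_diff psubst_numeral psubst_sum

definition ev :: "('i xy \<Rightarrow> 'k) \<Rightarrow> ('i, 'k::comm_ring_1) xy_poly \<Rightarrow> 'k" where
  "ev = peval (\<lambda>c. c)"

lemma ev_add: "ev \<rho> (p + q) = ev \<rho> p + ev \<rho> q"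
  unfolding ev_def by (rule peval_add) simp_all

lemma ev_mult: "ev \<rho> (p * q) = ev \<rho> p * ev \<rho> q"
  unfolding ev_def by (rule peval_mult) simp_all

lemma ev_pconst: "ev \<rho> (pconst c) = c"
  by (simp add: ev_def pconst_def peval_single)

lemma ev_pvar: "ev \<rho> (pvar v) = \<rho> v"
  by (simp add: ev_def pvar_def peval_single mon_def)

lemma ev_0: "ev \<rho> 0 = 0"
  using ev_pconst[of \<rho> 0] by (simp add: pconst_simps)

lemma ev_1: "ev \<rho> 1 = 1"
  using ev_pconst[of \<rho> 1] by (simp add: pconst_simps)

lemma ev_uminus: "ev \<rho> (- p) = - ev \<rho> p"
  using ev_add[of \<rho> p "- p"] by (simp add: ev_0 eq_neg_iff_add_eq_0 add.commute)

lemma ev_diff: "ev \<rho> (p - q) = ev \<rho> p - ev \<rho> q"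
  using ev_add[of \<rho> p "- q"] by (simp add: ev_uminus)

lemma ev_numeral: "ev \<rho> (numeral n) = numeral n"
  using ev_pconst[of \<rho> "numeral n"] by (simp add: pconst_numeral)

lemma ev_sum: "ev \<rho> (\<Sum>x\<in>S. F x) = (\<Sum>x\<in>S. ev \<rho> (F x))"
  by (induction S rule: infinite_finite_induct) (simp_all add: ev_0 ev_add)

lemma ev_power: "ev \<rho> (p ^ n) = ev \<rho> p ^ n"
  by (induction n) (simp_all add: ev_1 ev_mult)

lemmas ev_simps = ev_add ev_mult ev_pconst ev_pvar ev_0 ev_1 ev_uminus ev_diff ev_numeral ev_sum
  ev_power

lemma ev_psubst: "ev \<rho> (psubst \<sigma> p) = ev (\<lambda>v. ev \<rho> (\<sigma> v)) p"
  by (induction p rule: xy_poly_induct) (simp_all add: psubst_simps ev_simps)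

text \<open>Artin's argument: the monomials are pairwise distinct characters of a torus, separated by
  the points with one coordinate 2 and all others 1.\<close>

lemma mon_independent:
  fixes c :: "('i xy \<Rightarrow>\<^sub>0 nat) \<Rightarrow> 'k::field_char_0"
  assumes "finite K" "\<And>\<rho>. (\<Sum>m\<in>K. c m * mon \<rho> m) = 0"
  shows "\<forall>m\<in>K. c m = 0"
  using assms
proof (induction K arbitrary: c)
  case (insert n K)
  have "c m = 0" if m: "m \<in> K" for m
  proof -
    from m insert.hyps have "m \<noteq> n" by auto
    then obtain v where v: "Poly_Mapping.lookup m v \<noteq> Poly_Mapping.lookup n v"
      using poly_mapping_eqI[of m n] by blast
    define \<delta> where "\<delta> w = (if w = v then 2 else 1 :: 'k)" for w
    have \<delta>: "mon (\<lambda>w. \<delta> w * \<rho> w) k = 2 ^ Poly_Mapping.lookup k v * mon \<rho> k" for \<rho> k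
    proof -
      have "(\<Prod>w\<in>Poly_Mapping.keys k. \<delta> w ^ Poly_Mapping.lookup k w) = 2 ^ Poly_Mapping.lookup k v"
        unfolding \<delta>_def
        by (auto simp: if_distrib[of "\<lambda>x. x ^ _"] prod.delta in_keys_iff cong: if_cong)
      then show ?thesis
        by (simp add: mon_def power_mult_distrib prod.distrib)
    qed
    \<comment> \<open>Subtracting \<open>2 ^ lookup n v\<close> times the relation from its
      translate under \<open>\<delta>\<close> cancels the term of \<open>n\<close> and multiplies
      the term of each other \<open>k\<close> by \<open>e k\<close>.\<close>
    define e where "e k = 2 ^ Poly_Mapping.lookup k v - (2 ^ Poly_Mapping.lookup n v :: 'k)" for k
    have "(\<Sum>k\<in>K. (c k * e k) * mon \<rho> k) = 0" for \<rho>
    proof -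
      have "(\<Sum>k\<in>insert n K. (c k * e k) * mon \<rho> k) =
          (\<Sum>k\<in>insert n K. c k * mon (\<lambda>w. \<delta> w * \<rho> w) k) -
          2 ^ Poly_Mapping.lookup n v * (\<Sum>k\<in>insert n K. c k * mon \<rho> k)"
        by (simp add: \<delta> e_def sum_distrib_left algebra_simps flip: sum_subtractf)
      then show ?thesis using insert.hyps by (simp add: insert.prems e_def)
    qed
    then have "c m * e m = 0" using insert.IH[of "\<lambda>k. c k * e k"] m by blast
    moreover have "e m \<noteq> 0"
    proof -
      have "of_nat (2 ^ Poly_Mapping.lookup m v) \<noteq> (of_nat (2 ^ Poly_Mapping.lookup n v) :: 'k)"
        unfolding of_nat_eq_iff using v by simp
      then show ?thesis by (simp add: e_def)
    qed
    ultimately show ?thesis by simp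
  qed
  moreover have "mon (\<lambda>_. 1) n = (1 :: 'k)" by (simp add: mon_def)
  ultimately show ?case using insert.prems[of "\<lambda>_. 1"] insert.hyps by simp
qed simp

section \<open>Polynomials vanishing at many points\<close>

lemma ev_eq_0:
  fixes p :: "('i, 'k::field_char_0) xy_poly"
  assumes "\<And>\<rho>. ev \<rho> p = 0"
  shows "p = 0"
proof -
  have "\<forall>m\<in>Poly_Mapping.keys p. Poly_Mapping.lookup p m = 0"
    by (rule mon_independent) (use assms in \<open>simp_all add: ev_def peval_def\<close>)
  then show ?thesis
    by (intro poly_mapping_eqI) (metis in_keys_iff lookup_zero)
qed

lemma ev_eqI:
  fixes p q :: "('i, 'k::field_char_0) xy_poly"
  assumes "\<And>\<rho>. ev \<rho> p = ev \<rho> q"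
  shows "p = q"
  using ev_eq_0[of "p - q"] assms by (simp add: ev_diff)

text \<open>Reduces many variables to one: along a curve with polynomial coordinates a polynomial
  becomes univariate, and there finitely many parameters can be discarded.\<close>

lemma ev_curve:
  fixes \<gamma> :: "'k::field_char_0 \<Rightarrow> 'i xy \<Rightarrow> 'k"
  assumes "\<And>v. \<exists>q. \<forall>s. \<gamma> s v = poly q s"
  shows "\<exists>q. \<forall>s. ev (\<gamma> s) p = poly q s"
proof (induction p rule: xy_poly_induct)
  case (const c)
  show ?case by (rule exI[of _ "[:c:]"]) (simp add: ev_simps)
next
  case (var v)
  then show ?case using assms by (simp add: ev_simps)
next
  case (add p q)
  then show ?case by (metis ev_add poly_add)
next
  case (mult p q)
  then show ?case by (metis ev_mult poly_mult)
qed

lemma poly_eq_0_cofinite: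
  fixes q r :: "'k::field_char_0 poly"
  assumes "r \<noteq> 0" "\<And>s. poly r s \<noteq> 0 \<Longrightarrow> poly q s = 0"
  shows "q = 0"
proof -
  have "poly (q * r) s = 0" for s using assms(2)[of s] by auto
  then have "q * r = 0" using poly_all_0_iff_0 by blast
  then show ?thesis using assms(1) by simp
qed

text \<open>A nonzero polynomial remains nonzero on almost all of the line joining any point to a point
  where it does not vanish.\<close>

lemma ev_density:
  fixes p :: "('i, 'k::field_char_0) xy_poly"
  assumes "g \<noteq> 0" "\<And>\<rho>. ev \<rho> g \<noteq> 0 \<Longrightarrow> ev \<rho> p = 0"
  shows "p = 0"
proof (rule ev_eq_0)
  fix \<rho>
  obtain \<rho>1 where \<rho>1: "ev \<rho>1 g \<noteq> 0" using assms(1) ev_eq_0 by blast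
  define \<gamma> where "\<gamma> s v = \<rho> v + s * (\<rho>1 v - \<rho> v)" for s v
  have c: "\<exists>q. \<forall>s. \<gamma> s v = poly q s" for v
    by (rule exI[of _ "[:\<rho> v, \<rho>1 v - \<rho> v:]"]) (simp add: \<gamma>_def)
  obtain P G where P: "\<And>s. ev (\<gamma> s) p = poly P s" and G: "\<And>s. ev (\<gamma> s) g = poly G s"
    using ev_curve[of \<gamma> p, OF c] ev_curve[of \<gamma> g, OF c] by blast
  have "\<gamma> 1 = \<rho>1" "\<gamma> 0 = \<rho>" by (simp_all add: \<gamma>_def fun_eq_iff)
  then have "G \<noteq> 0" using \<rho>1 G[of 1] by auto
  then have "P = 0" by (rule poly_eq_0_cofinite) (metis G P assms(2))
  then show "ev \<rho> p = 0" using P[of 0] \<open>\<gamma> 0 = \<rho>\<close> by simp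
qed

text \<open>Wherever \<open>q\<close> is nonzero, \<open>p\<close> must vanish; density of such
  points then forces \<open>p = 0\<close>.\<close>

lemma xy_poly_no_zero_divisors:
  fixes p q :: "('i, 'k::field_char_0) xy_poly"
  assumes "p * q = 0"
  shows "p = 0 \<or> q = 0"
  using ev_density[of p q] assms by (metis ev_0 ev_mult mult_eq_0_iff)

lemma xy_poly_mult_cancel:
  fixes p q r :: "('i, 'k::field_char_0) xy_poly"
  assumes "r \<noteq> 0"
  shows "r * p = r * q \<longleftrightarrow> p = q"
  using xy_poly_no_zero_divisors[of r "p - q"] assms by (auto simp: right_diff_distrib)

subsection \<open>Homomorphisms of free graded commutative algebras\<close>

lemma coef_simps:
  "coef 0 S = 0" "coef 1 S = (if S = {} then 1 else 0)" "coef (f + g) S = coef f S + coef g S"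
  "coef (f - g) S = coef f S - coef g S" "coef (- f) S = - coef f S"
  "coef (of_poly p) S = (if S = {} then p else 0)" "coef (scale c f) S = pconst c * coef f S"
  "coef (\<theta> i) S = (if S = {i} then 1 else 0)"
  by (simp_all add: zero_gca_def one_gca_def plus_gca_def minus_gca_def uminus_gca_def of_poly_def
      scale_def \<theta>_def)

lemma gca_eqI: "(\<And>S. coef f S = coef g S) \<Longrightarrow> f = g"
  by (simp add: gca_eq_iff)

lemma coef_sum: "coef (\<Sum>x\<in>X. F x) S = (\<Sum>x\<in>X. coef (F x) S)"
  by (induction X rule: infinite_finite_induct) (simp_all add: coef_simps)

lemma coef_mult: "coef (f * g) U = (\<Sum>S\<in>Pow U. koszul_sign S (U - S) * coef f S * coef g (U - S))"
  by (simp add: times_gca_def)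

lemma coef_of_poly_mult:
  fixes f :: "('i::enum, 'k::comm_ring_1) gca"
  shows "coef (of_poly p * f) S = p * coef f S"
  unfolding coef_mult
  by (subst sum.mono_neutral_right[where S = "{{}}"]) (auto simp: coef_simps)

lemma coef_mult_of_poly:
  fixes f :: "('i::enum, 'k::comm_ring_1) gca"
  shows "coef (f * of_poly p) S = p * coef f S"
  unfolding coef_mult
  by (subst sum.mono_neutral_right[where S = "{S}"]) (auto simp: coef_simps mult.commute)

lemma coef_theta_mult:
  fixes f :: "('i::enum, 'k::comm_ring_1) gca"
  shows "coef (\<theta> i * f) S = (if i \<in> S then koszul_sign {i} (S - {i}) * coef f (S - {i}) else 0)"
proof (cases "i \<in> S")
  case True
  then show ?thesis unfolding coef_mult
    by (subst sum.mono_neutral_right[where S = "{{i}}"]) (auto simp: coef_simps)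
next
  case False
  then have "X \<in> Pow S \<Longrightarrow> coef (\<theta> i) X = (0 :: ('i, 'k) xy_poly)" for X
    by (auto simp: coef_simps)
  then have "coef (\<theta> i * f) S = (\<Sum>X\<in>Pow S. 0)" unfolding coef_mult
    by (intro sum.cong) simp_all
  then show ?thesis using False by simp
qed

lemma of_poly_central:
  fixes f :: "('i::enum, 'k::comm_ring_1) gca"
  shows "f * of_poly p = of_poly p * f"
  by (rule gca_eqI) (simp add: coef_mult_of_poly coef_of_poly_mult)

lemma of_poly_simps:
  "of_poly (0 :: ('i::enum, 'k::comm_ring_1) xy_poly) = 0"
  "of_poly (1 :: ('i, 'k) xy_poly) = 1"
  "of_poly (p + q :: ('i, 'k) xy_poly) = of_poly p + of_poly q"
  "of_poly (p - q :: ('i, 'k) xy_poly) = of_poly p - of_poly q"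
  "of_poly (- p :: ('i, 'k) xy_poly) = - of_poly p"
  "of_poly (p * q :: ('i, 'k) xy_poly) = of_poly p * of_poly q"
  by (rule gca_eqI; simp add: coef_simps coef_of_poly_mult)+

lemma of_poly_numeral:
  "of_poly (numeral n :: ('i::enum, 'k::comm_ring_1) xy_poly) = numeral n"
proof -
  have "of_poly (of_nat m :: ('i, 'k) xy_poly) = of_nat m" for m
    by (induction m) (simp_all add: of_poly_simps)
  then show ?thesis by (metis of_nat_numeral)
qed

lemma scale_eq: "scale c f = of_poly (pconst c) * (f :: ('i::enum, 'k::comm_ring_1) gca)"
  by (rule gca_eqI) (simp add: coef_simps coef_of_poly_mult)

lemma koszul_sign_cases: "koszul_sign S T = (1 :: 'a::ring_1) \<or> koszul_sign S T = (-1 :: 'a)"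
  unfolding koszul_sign_def
  by (cases "even (card {(s, t) \<in> S \<times> T. enum_pos t < enum_pos s})") simp_all

section \<open>The basis of products of odd generators\<close>

definition \<theta>set :: "'i::enum set \<Rightarrow> ('i, 'k::comm_ring_1) gca" where
  "\<theta>set S = Gca (\<lambda>T. if T = S then 1 else 0)"

lemma gca_expansion: "f = (\<Sum>S\<in>UNIV. of_poly (coef f S) * \<theta>set S)"
  by (rule gca_eqI) (simp add: coef_sum coef_of_poly_mult \<theta>set_def if_distrib cong: if_cong)

lemma theta_mult_\<theta>set:
  "i \<notin> S \<Longrightarrow> \<theta> i * \<theta>set S = of_poly (koszul_sign {i} S) * (\<theta>set (insert i S) :: ('i::enum, 'k::comm_ring_1) gca)"
  by (rule gca_eqI) (auto simp: coef_theta_mult coef_of_poly_mult \<theta>set_def)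

lemma \<theta>set_insert:
  assumes "i \<notin> S"
  shows "\<theta>set (insert i S) = of_poly (koszul_sign {i} S) * (\<theta> i * \<theta>set S :: ('i::enum, 'k::comm_ring_1) gca)"
  unfolding theta_mult_\<theta>set[OF assms] by (simp add: of_poly_simps(2) flip: mult.assoc of_poly_simps(6))

text \<open>Each basis product is reached from 1 by left multiplication with generators, up to a
  sign absorbed by \<open>of_poly\<close>. Multiplicativity of a map thus needs checking only for
  generators as left factors.\<close>

lemma gca_induct [case_names one add of_poly theta]:
  fixes f :: "('i::enum, 'k::comm_ring_1) gca"
  assumes one: "P 1" and add: "\<And>f g. P f \<Longrightarrow> P g \<Longrightarrow> P (f + g)"
    and of_poly: "\<And>p f. P f \<Longrightarrow> P (of_poly p * f)" and theta: "\<And>i f. P f \<Longrightarrow> P (\<theta> i * f)"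
  shows "P f"
proof -
  have "\<theta>set {} = (1 :: ('i, 'k) gca)"
    by (simp add: \<theta>set_def one_gca_def)
  then have "P (\<theta>set S)" for S
    by (induction S rule: infinite_finite_induct) (use one in \<open>simp_all add: \<theta>set_insert theta of_poly\<close>)
  moreover have "P 0" using of_poly[OF one, of 0] by (simp add: of_poly_simps)
  ultimately have sum: "P (\<Sum>S\<in>X. of_poly (coef f S) * \<theta>set S)" for X
    by (induction X rule: infinite_finite_induct) (simp_all add: add of_poly)
  show ?thesis using sum[of UNIV] unfolding gca_expansion[of f, symmetric] .
qed

lemma homogeneous_closed:
  fixes f :: "('i::enum, 'k::comm_ring_1) gca"
  shows "(0 :: ('i, 'k) gca) \<in> homogeneous p" "f \<in> homogeneous p \<Longrightarrow> g \<in> homogeneous p \<Longrightarrow> f + g \<in> homogeneous p"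
    "f \<in> homogeneous p \<Longrightarrow> g \<in> homogeneous p \<Longrightarrow> f - g \<in> homogeneous p"
    "f \<in> homogeneous p \<Longrightarrow> of_poly q * f \<in> homogeneous p"
    "f \<in> homogeneous p \<Longrightarrow> scale c f \<in> homogeneous p"
    "(of_poly q :: ('i, 'k) gca) \<in> homogeneous 0" "(1 :: ('i, 'k) gca) \<in> homogeneous 0"
    "(\<theta> i :: ('i, 'k) gca) \<in> homogeneous 1"
  by (auto simp: homogeneous_def coef_simps coef_of_poly_mult)

lemma homogeneous_sum: "(\<And>x. x \<in> X \<Longrightarrow> F x \<in> homogeneous p) \<Longrightarrow> (\<Sum>x\<in>X. F x) \<in> homogeneous p"
  by (induction X rule: infinite_finite_induct) (simp_all add: homogeneous_closed)

lemma homogeneous_mult: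
  fixes f g :: "('i::enum, 'k::comm_ring_1) gca"
  assumes "f \<in> homogeneous p" "g \<in> homogeneous q"
  shows "f * g \<in> homogeneous (p + q)"
  unfolding homogeneous_def mem_Collect_eq coef_mult
proof (intro allI impI sum.neutral ballI)
  fix U S :: "'i set" assume "card U \<noteq> p + q" "S \<in> Pow U"
  moreover have "card U = card S + card (U - S)" if "S \<subseteq> U"
    using that by (metis card_Un_disjoint Diff_disjoint Un_Diff_cancel finite sup.absorb2)
  ultimately have "card S \<noteq> p \<or> card (U - S) \<noteq> q" by auto
  then show "koszul_sign S (U - S) * coef f S * coef g (U - S) = 0"
    using assms by (auto simp: homogeneous_def)
qed

lemma homogeneous_1_expansion:
  fixes f :: "('i::enum, 'k::comm_ring_1) gca"
  assumes "f \<in> homogeneous 1"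
  shows "f = (\<Sum>i\<in>UNIV. of_poly (coef f {i}) * \<theta> i)"
proof (rule gca_eqI)
  fix S
  show "coef f S = coef (\<Sum>i\<in>UNIV. of_poly (coef f {i}) * \<theta> i) S"
  proof (cases "card S = 1")
    case True
    then obtain j where "S = {j}" by (auto simp: card_1_singleton_iff)
    then show ?thesis
      by (simp add: coef_sum coef_of_poly_mult coef_simps if_distrib cong: if_cong)
  next
    case False
    then have "coef f S = 0" "\<And>i. S \<noteq> {i}" using assms by (auto simp: homogeneous_def)
    then show ?thesis by (simp add: coef_sum coef_of_poly_mult coef_simps)
  qed
qed

lemma theta_square: "\<theta> i * \<theta> i = (0 :: ('i::enum, 'k::comm_ring_1) gca)"
  by (rule gca_eqI) (auto simp: coef_theta_mult coef_simps)

lemma enum_nth_enum_pos: "enum_class.enum ! enum_pos z = z"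
proof -
  have "z \<in> set enum_class.enum" by (simp add: enum_UNIV)
  then have "\<exists>p. enum_class.enum ! p = z" unfolding in_set_conv_nth by blast
  then show ?thesis
    unfolding enum_pos_def by (rule LeastI_ex[of "\<lambda>p. enum_class.enum ! p = z"])
qed

lemma enum_pos_less_length: "enum_pos (z :: 'i) < length (enum_class.enum :: 'i::enum list)"
proof -
  have "z \<in> set enum_class.enum" by (simp add: enum_UNIV)
  then obtain p where p: "p < length (enum_class.enum :: 'i list)" "enum_class.enum ! p = z"
    unfolding in_set_conv_nth by blast
  have "enum_pos z \<le> p" unfolding enum_pos_def by (rule Least_le) (rule p(2))
  then show ?thesis using p(1) by simp
qed

lemma enum_pos_nth:
  assumes "p < length (enum_class.enum :: 'i::enum list)"
  shows "enum_pos (enum_class.enum ! p :: 'i) = p"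
  using nth_eq_iff_index_eq[OF enum_distinct assms enum_pos_less_length[of "enum_class.enum ! p :: 'i"]]
    enum_nth_enum_pos[of "enum_class.enum ! p :: 'i"] by simp

text \<open>For distinct indices, \<open>koszul_sign_swap\<close> with a one-element set says that
  the signs of the two orders have product \<open>-1\<close>, so they are opposite.\<close>

lemma theta_anticommute: "\<theta> i * \<theta> j = - (\<theta> j * \<theta> i :: ('i::enum, 'k::comm_ring_1) gca)"
proof (cases "i = j")
  case False
  have "enum_pos i \<noteq> enum_pos j" using enum_nth_enum_pos[of i] enum_nth_enum_pos[of j] False by metis
  have s: "koszul_sign {i} {j} = - (koszul_sign {j} {i} :: ('i, 'k) xy_poly)"
    using koszul_sign_swap[of i "{j}", where 'a = "('i, 'k) xy_poly"] False
      koszul_sign_cases[of "{i}" "{j}", where 'a = "('i, 'k) xy_poly"]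
      koszul_sign_cases[of "{j}" "{i}", where 'a = "('i, 'k) xy_poly"]
    by auto
  have t: "\<theta> l = (\<theta>set {l} :: ('i, 'k) gca)" for l
    by (simp add: \<theta>_def \<theta>set_def)
  show ?thesis
    using theta_mult_\<theta>set[of i "{j}", where 'k = 'k] theta_mult_\<theta>set[of j "{i}", where 'k = 'k] False
    by (simp add: s insert_commute of_poly_simps flip: t)
qed (simp add: theta_square)

lemma mult_of_poly_left_commute:
  fixes f g :: "('i::enum, 'k::comm_ring_1) gca"
  shows "f * (of_poly p * g) = of_poly p * (f * g)"
  by (metis mult.assoc of_poly_central)

lemma of_poly_mult_mult:
  fixes f g :: "('i::enum, 'k::comm_ring_1) gca"
  shows "(of_poly p * f) * (of_poly q * g) = of_poly (p * q) * (f * g)"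
  by (metis mult.assoc mult_of_poly_left_commute of_poly_simps(6))

lemma homogeneous_1_anticommute:
  fixes f g :: "('i::enum, 'k::comm_ring_1) gca"
  assumes "f \<in> homogeneous 1" "g \<in> homogeneous 1"
  shows "f * g = - (g * f)"
proof -
  let ?F = "\<lambda>i. of_poly (coef f {i}) * \<theta> i" and ?G = "\<lambda>i. of_poly (coef g {i}) * \<theta> i"
  note ef = homogeneous_1_expansion[OF assms(1)] and eg = homogeneous_1_expansion[OF assms(2)]
  have fg: "f * g = (\<Sum>i\<in>UNIV. ?F i) * (\<Sum>j\<in>UNIV. ?G j)"
    by (rule arg_cong2[where f = "(*)", OF ef eg])
  have gf: "g * f = (\<Sum>j\<in>UNIV. ?G j) * (\<Sum>i\<in>UNIV. ?F i)"
    by (rule arg_cong2[where f = "(*)", OF eg ef])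
  have "f * g = (\<Sum>i\<in>UNIV. \<Sum>j\<in>UNIV. ?F i * ?G j)"
    by (simp only: fg sum_product)
  also have "\<dots> = (\<Sum>i\<in>UNIV. \<Sum>j\<in>UNIV. - (?G j * ?F i))"
  proof (intro sum.cong refl)
    fix i j
    have "?F i * ?G j = of_poly (coef f {i} * coef g {j}) * (\<theta> i * \<theta> j)"
      by (rule of_poly_mult_mult)
    also have "\<dots> = - (of_poly (coef g {j} * coef f {i}) * (\<theta> j * \<theta> i))"
      by (simp add: theta_anticommute[of i j] mult.commute)
    also have "\<dots> = - (?G j * ?F i)"
      by (simp only: of_poly_mult_mult)
    finally show "?F i * ?G j = - (?G j * ?F i)" .
  qed
  also have "\<dots> = - (\<Sum>j\<in>UNIV. \<Sum>i\<in>UNIV. ?G j * ?F i)"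
    by (subst sum.swap) (simp add: sum_negf)
  also have "\<dots> = - (g * f)"
    by (simp only: gf sum_product)
  finally show ?thesis .
qed

lemma gca_double_eq_0:
  fixes f :: "('i::enum, 'k::field_char_0) gca"
  assumes "f = - f"
  shows "f = 0"
proof -
  have "of_poly (pconst (1 / 2)) * (f + f) = 0"
    using assms by (metis add.right_inverse mult_zero_right)
  moreover have "of_poly (pconst (1 / 2)) * (f + f) = of_poly (pconst (1 / 2 + 1 / 2)) * f"
    by (simp only: pconst_simps(3) of_poly_simps(3) distrib_left distrib_right)
  ultimately show ?thesis by (simp add: pconst_simps of_poly_simps)
qed

text \<open>The square equals its own negative; this is where 2 has to be invertible.\<close>

lemma homogeneous_1_square:
  fixes f :: "('i::enum, 'k::field_char_0) gca"
  assumes "f \<in> homogeneous 1"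
  shows "f * f = 0"
  by (rule gca_double_eq_0, rule homogeneous_1_anticommute[OF assms assms])

section \<open>Multiplicativity of maps given on generators\<close>

definition \<theta>prod :: "('i \<Rightarrow> ('j, 'k) gca) \<Rightarrow> 'i::enum set \<Rightarrow> ('j::enum, 'k::comm_ring_1) gca" where
  "\<theta>prod \<tau> S = prod_list (map \<tau> (filter (\<lambda>i. i \<in> S) enum_class.enum))"

lemma gca_hom_eq: "gca_hom \<sigma> \<tau> f = (\<Sum>S\<in>UNIV. of_poly (psubst \<sigma> (coef f S)) * \<theta>prod \<tau> S)"
  by (simp add: gca_hom_def \<theta>prod_def)

text \<open>The new factor is moved to the right past the others, changing only the sign, until it
  meets its own copy and the square vanishes.\<close>

lemma prod_list_filter_in:
  fixes \<tau> :: "'i \<Rightarrow> ('j::enum, 'k::field_char_0) gca"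
  assumes "\<And>i. \<tau> i \<in> homogeneous 1" "i \<in> set xs" "i \<in> S"
  shows "\<tau> i * prod_list (map \<tau> (filter (\<lambda>i. i \<in> S) xs)) = 0"
  using assms(2)
proof (induction xs)
  case (Cons x xs)
  let ?r = "prod_list (map \<tau> (filter (\<lambda>i. i \<in> S) xs))"
  show ?case
  proof (cases "x = i")
    case True
    then show ?thesis using assms homogeneous_1_square[of "\<tau> i"] by (simp flip: mult.assoc)
  next
    case False
    then have IH: "\<tau> i * ?r = 0" using Cons by auto
    have "\<tau> i * (\<tau> x * ?r) = - (\<tau> x * (\<tau> i * ?r))"
      using homogeneous_1_anticommute[OF assms(1)[of i] assms(1)[of x]] by (simp flip: mult.assoc)
    then show ?thesis using IH by simp
  qed
qed simp

text \<open>The new factor is moved to its place in the list; each element of \<open>S\<close>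
  listed before \<open>i\<close> costs one transposition.\<close>

lemma prod_list_filter_notin:
  fixes \<tau> :: "'i \<Rightarrow> ('j::enum, 'k::field_char_0) gca"
  assumes "\<And>i. \<tau> i \<in> homogeneous 1" "distinct xs" "i \<in> set xs" "i \<notin> S"
  shows "\<tau> i * prod_list (map \<tau> (filter (\<lambda>i. i \<in> S) xs)) =
    (-1) ^ length (filter (\<lambda>i. i \<in> S) (takeWhile (\<lambda>x. x \<noteq> i) xs)) *
    prod_list (map \<tau> (filter (\<lambda>x. x \<in> insert i S) xs))"
  using assms(2,3)
proof (induction xs)
  case (Cons x xs)
  let ?r = "\<lambda>S. prod_list (map \<tau> (filter (\<lambda>i. i \<in> S) xs))"
  show ?case
  proof (cases "x = i")
    case True
    then have "filter (\<lambda>x. x = i \<or> x \<in> S) xs = filter (\<lambda>i. i \<in> S) xs"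
      using Cons.prems by (intro filter_cong) auto
    then show ?thesis using True assms(4) by simp
  next
    case False
    then have IH: "\<tau> i * ?r S = (-1) ^ length (filter (\<lambda>i. i \<in> S) (takeWhile (\<lambda>x. x \<noteq> i) xs)) * ?r (insert i S)"
      using Cons by auto
    have "(-1) ^ n * f = f * (-1) ^ n" for n and f :: "('j, 'k) gca"
      by (cases "even n") simp_all
    then have "\<tau> x * ((-1) ^ n * f) = (-1) ^ n * (\<tau> x * f)" for n and f
      by (metis mult.assoc)
    moreover have "\<tau> i * (\<tau> x * ?r S) = - (\<tau> x * (\<tau> i * ?r S))"
      using homogeneous_1_anticommute[OF assms(1)[of i] assms(1)[of x]] by (simp flip: mult.assoc)
    ultimately show ?thesis using IH False by auto
  qed
qed simp

lemma length_filter_takeWhile_enum: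
  "length (filter (\<lambda>i. i \<in> S) (takeWhile (\<lambda>x. x \<noteq> i) enum_class.enum)) =
    card {(s, t) \<in> {i} \<times> S. enum_pos t < enum_pos (s :: 'i::enum)}"
proof -
  let ?xs = "enum_class.enum :: 'i list"
  have "takeWhile (\<lambda>x. x \<noteq> i) ?xs = take (enum_pos i) ?xs"
  proof (rule takeWhile_eq_take_P_nth)
    fix n assume "n < enum_pos i" "n < length ?xs"
    then show "?xs ! n \<noteq> i" using enum_pos_nth[where 'i = 'i, of n] by auto
  qed (simp add: enum_nth_enum_pos)
  moreover have "set (take (enum_pos i) ?xs) = {t. enum_pos t < enum_pos i}"
  proof -
    have "t \<in> set (take (enum_pos i) ?xs) \<longleftrightarrow> enum_pos t < enum_pos i" for t
    proof
      assume "t \<in> set (take (enum_pos i) ?xs)"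
      then obtain p where "p < enum_pos i" "p < length ?xs" "?xs ! p = t"
        by (auto simp: in_set_conv_nth)
      then show "enum_pos t < enum_pos i" using enum_pos_nth by metis
    next
      assume "enum_pos t < enum_pos i"
      then show "t \<in> set (take (enum_pos i) ?xs)"
        using enum_pos_less_length[of t] enum_nth_enum_pos[of t] by (auto simp: in_set_conv_nth)
    qed
    then show ?thesis by blast
  qed
  moreover have "distinct (filter (\<lambda>i. i \<in> S) (take (enum_pos i) ?xs))"
    by (simp add: enum_distinct)
  ultimately have "length (filter (\<lambda>i. i \<in> S) (takeWhile (\<lambda>x. x \<noteq> i) ?xs)) =
      card {t \<in> S. enum_pos t < enum_pos i}"
    by (subst distinct_card[symmetric]) (auto intro: arg_cong[where f = card])
  also have "\<dots> = card (Pair i ` {t \<in> S. enum_pos t < enum_pos i})"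
    by (simp add: card_image inj_on_def)
  also have "Pair i ` {t \<in> S. enum_pos t < enum_pos i} = {(s, t) \<in> {i} \<times> S. enum_pos t < enum_pos s}"
    by auto
  finally show ?thesis .
qed

text \<open>Exactly the sign rule of the basis products of the source: the transpositions counted
  along the enumeration are the inversions in \<open>koszul_sign {i} S\<close>.\<close>

lemma theta_mult_\<theta>prod:
  fixes \<tau> :: "'i::enum \<Rightarrow> ('j::enum, 'k::field_char_0) gca"
  assumes "\<And>i. \<tau> i \<in> homogeneous 1"
  shows "\<tau> i * \<theta>prod \<tau> S = (if i \<in> S then 0 else koszul_sign {i} S * \<theta>prod \<tau> (insert i S))"
proof (cases "i \<in> S")
  case True
  then show ?thesis
    using prod_list_filter_in[of \<tau>, OF assms, of i enum_class.enum S] by (simp add: \<theta>prod_def enum_UNIV)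
next
  case False
  then show ?thesis
    using prod_list_filter_notin[of \<tau>, OF assms enum_distinct _ False]
    unfolding \<theta>prod_def koszul_sign_def length_filter_takeWhile_enum[symmetric]
    by (simp add: enum_UNIV)
qed

lemma psubst_koszul_sign: "psubst \<sigma> (koszul_sign S T * p) = koszul_sign S T * psubst \<sigma> p"
  using koszul_sign_cases[of S T, where 'a = "('a, 'b) xy_poly"]
  by (auto simp: koszul_sign_def psubst_simps minus_one_power_iff)

lemma of_poly_koszul_sign:
  "of_poly (koszul_sign S T * p) = koszul_sign S T * (of_poly p :: ('i::enum, 'k::comm_ring_1) gca)"
  by (auto simp: koszul_sign_def of_poly_simps minus_one_power_iff)

lemma gca_hom_add: "gca_hom \<sigma> \<tau> (f + g) = gca_hom \<sigma> \<tau> f + gca_hom \<sigma> \<tau> g"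
  by (simp add: gca_hom_def coef_simps psubst_simps of_poly_simps distrib_right sum.distrib)

lemma gca_hom_of_poly_mult: "gca_hom \<sigma> \<tau> (of_poly p * f) = of_poly (psubst \<sigma> p) * gca_hom \<sigma> \<tau> f"
  by (simp add: gca_hom_def coef_of_poly_mult psubst_simps of_poly_simps sum_distrib_left mult.assoc)

lemma gca_hom_1: "gca_hom \<sigma> \<tau> 1 = 1"
  using gca_hom_of_poly[of \<sigma> \<tau> 1] by (simp add: of_poly_simps psubst_simps)

lemma gca_hom_0: "gca_hom \<sigma> \<tau> 0 = 0"
  using gca_hom_of_poly[of \<sigma> \<tau> 0] by (simp add: of_poly_simps psubst_simps)

lemma gca_hom_uminus: "gca_hom \<sigma> \<tau> (- f) = - gca_hom \<sigma> \<tau> f"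
  using gca_hom_add[of \<sigma> \<tau> f "- f"] by (simp add: gca_hom_0 eq_neg_iff_add_eq_0 add.commute)

lemma gca_hom_diff: "gca_hom \<sigma> \<tau> (f - g) = gca_hom \<sigma> \<tau> f - gca_hom \<sigma> \<tau> g"
  using gca_hom_add[of \<sigma> \<tau> f "- g"] by (simp add: gca_hom_uminus)

lemma gca_hom_scale: "gca_hom \<sigma> \<tau> (scale c f) = scale c (gca_hom \<sigma> \<tau> f)"
  by (simp add: scale_eq gca_hom_of_poly_mult psubst_simps)

text \<open>Only sets containing \<open>i\<close> contribute on the left, only sets avoiding
  \<open>i\<close> on the right. Removing \<open>i\<close> matches the terms, and the two equal
  signs cancel.\<close>

lemma gca_hom_theta_mult:
  fixes \<tau> :: "'i::enum \<Rightarrow> ('j::enum, 'k::field_char_0) gca"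
  assumes "\<And>i. \<tau> i \<in> homogeneous 1"
  shows "gca_hom \<sigma> \<tau> (\<theta> i * f) = \<tau> i * gca_hom \<sigma> \<tau> f"
proof -
  have "gca_hom \<sigma> \<tau> (\<theta> i * f) = (\<Sum>S\<in>{S. i \<in> S}. of_poly (psubst \<sigma> (coef (\<theta> i * f) S)) * \<theta>prod \<tau> S)"
    unfolding gca_hom_eq
    by (rule sum.mono_neutral_right) (auto simp: coef_theta_mult psubst_simps of_poly_simps)
  also have "\<dots> = (\<Sum>S\<in>{S. i \<notin> S}. of_poly (psubst \<sigma> (coef f S)) * (\<tau> i * \<theta>prod \<tau> S))"
  proof (rule sum.reindex_bij_witness[where i = "insert i" and j = "\<lambda>S. S - {i}"])
    fix S assume "S \<in> {S. i \<in> S}"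
    then have "insert i (S - {i}) = S" "i \<in> S" by auto
    then show "of_poly (psubst \<sigma> (coef f (S - {i}))) * (\<tau> i * \<theta>prod \<tau> (S - {i})) =
        of_poly (psubst \<sigma> (coef (\<theta> i * f) S)) * \<theta>prod \<tau> S"
      using koszul_sign_cases[of "{i}" "S - {i}", where 'a = "('j, 'k) gca"]
      by (auto simp: coef_theta_mult psubst_koszul_sign of_poly_koszul_sign theta_mult_\<theta>prod[of \<tau>, OF assms])
  qed auto
  also have "\<dots> = (\<Sum>S\<in>UNIV. of_poly (psubst \<sigma> (coef f S)) * (\<tau> i * \<theta>prod \<tau> S))"
    by (rule sum.mono_neutral_left) (auto simp: theta_mult_\<theta>prod[of \<tau>, OF assms])
  also have "\<dots> = \<tau> i * gca_hom \<sigma> \<tau> f"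
    by (simp add: gca_hom_eq sum_distrib_left mult_of_poly_left_commute)
  finally show ?thesis .
qed

lemma gca_hom_mult:
  fixes \<tau> :: "'i::enum \<Rightarrow> ('j::enum, 'k::field_char_0) gca"
  assumes "\<And>i. \<tau> i \<in> homogeneous 1"
  shows "gca_hom \<sigma> \<tau> (f * g) = gca_hom \<sigma> \<tau> f * gca_hom \<sigma> \<tau> g"
  by (induction f rule: gca_induct)
    (simp_all add: gca_hom_1 gca_hom_add gca_hom_of_poly_mult gca_hom_theta_mult[of \<tau>, OF assms]
      distrib_right mult.assoc)

lemma homogeneous_prod_list:
  fixes \<tau> :: "'i \<Rightarrow> ('j::enum, 'k::comm_ring_1) gca"
  assumes "\<And>i. \<tau> i \<in> homogeneous 1"
  shows "prod_list (map \<tau> xs) \<in> homogeneous (length xs)"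
proof (induction xs)
  case (Cons x xs)
  then show ?case using homogeneous_mult[OF assms[of x] Cons] by simp
qed (simp add: homogeneous_closed)

lemma gca_hom_homogeneous:
  fixes \<tau> :: "'i::enum \<Rightarrow> ('j::enum, 'k::comm_ring_1) gca"
  assumes "\<And>i. \<tau> i \<in> homogeneous 1" "f \<in> homogeneous p"
  shows "gca_hom \<sigma> \<tau> f \<in> homogeneous p"
  unfolding gca_hom_eq
proof (rule homogeneous_sum)
  fix S :: "'i set"
  have "length (filter (\<lambda>i. i \<in> S) enum_class.enum) = card S"
    by (subst distinct_card[symmetric]) (simp_all add: enum_distinct enum_UNIV)
  then have "\<theta>prod \<tau> S \<in> homogeneous (card S)"
    using homogeneous_prod_list[of \<tau>, OF assms(1), of "filter (\<lambda>i. i \<in> S) enum_class.enum"]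
    by (simp only: \<theta>prod_def)
  moreover have "coef f S = 0" if "card S \<noteq> p"
    using assms(2) that by (simp add: homogeneous_def)
  ultimately show "of_poly (psubst \<sigma> (coef f S)) * \<theta>prod \<tau> S \<in> homogeneous p"
    by (cases "card S = p") (simp_all add: homogeneous_closed psubst_0 of_poly_simps)
qed

subsection \<open>Two-by-two matrices\<close>

lemma two_neq_one [simp]: "(2::2) \<noteq> 1" "(1::2) \<noteq> 2"
  by simp_all

definition mat2 :: "'a \<Rightarrow> 'a \<Rightarrow> 'a \<Rightarrow> 'a \<Rightarrow> (('a, 2) vec, 2) vec" where
  "mat2 a b c d = (\<chi> i j. if i = 1 then (if j = 1 then a else b) else (if j = 1 then c else d))"

lemma mat2_nth [simp]:
  "mat2 a b c d $ 1 $ 1 = a" "mat2 a b c d $ 1 $ 2 = b" "mat2 a b c d $ 2 $ 1 = c" "mat2 a b c d $ 2 $ 2 = d"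
  by (simp_all add: mat2_def)

lemma mat2_eqI:
  "A $ 1 $ 1 = B $ 1 $ 1 \<Longrightarrow> A $ 1 $ 2 = B $ 1 $ 2 \<Longrightarrow> A $ 2 $ 1 = B $ 2 $ 1 \<Longrightarrow> A $ 2 $ 2 = B $ 2 $ 2 \<Longrightarrow>
    A = (B :: (('a, 2) vec, 2) vec)"
  by (simp add: vec_eq_iff forall_2)

lemma mat2_eq_iff: "mat2 a b c d = mat2 a' b' c' d' \<longleftrightarrow> a = a' \<and> b = b' \<and> c = c' \<and> d = d'"
  by (metis mat2_nth)

lemma mat2_simps:
  "mat2 a b c d ** mat2 a' b' c' d' =
    mat2 (a * a' + b * c') (a * b' + b * d') (c * a' + d * c') (c * b' + d * d')"
  "mat2 a b c d + mat2 a' b' c' d' = mat2 (a + a') (b + b') (c + c') (d + d')"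
  "mat p = mat2 p 0 0 p"
  "trace (mat2 a b c d) = a + d"
  by ((rule mat2_eqI)?; simp add: matrix_matrix_mult_def sum_2 mat_def trace_def)+

lemma mat2_diff:
  "mat2 a b c d - mat2 a' b' c' d' = mat2 (a - a') (b - b') (c - c') (d - d' :: 'a::ab_group_add)"
  by (rule mat2_eqI) simp_all

definition map_mat :: "('a \<Rightarrow> 'b) \<Rightarrow> (('a, 2) vec, 2) vec \<Rightarrow> (('b, 2) vec, 2) vec" where
  "map_mat F A = (\<chi> i j. F (A $ i $ j))"

lemma map_mat_nth [simp]: "map_mat F A $ i $ j = F (A $ i $ j)"
  by (simp add: map_mat_def)

lemma map_mat_mat2 [simp]: "map_mat F (mat2 a b c d) = mat2 (F a) (F b) (F c) (F d)"
  by (rule mat2_eqI) simp_all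

lemma map_mat_mult:
  assumes "\<And>a b. F (a + b) = F a + F b" "\<And>a b. F (a * b) = F a * F b"
  shows "map_mat F (A ** B) = map_mat F A ** map_mat F B"
  by (rule mat2_eqI) (simp_all add: matrix_matrix_mult_def sum_2 assms)

lemma matrix_inv:
  fixes g :: "(('k::field, 2) vec, 2) vec"
  assumes "invertible g"
  shows "g ** matrix_inv g = mat 1" "matrix_inv g ** g = mat 1"
  using someI_ex[OF assms[unfolded invertible_def]] by (simp_all add: matrix_inv_def)

lemma invertible_mat2:
  fixes a b c d :: "'k::field"
  assumes "a * d - b * c \<noteq> 0"
  shows "invertible (mat2 a b c d)"
proof -
  obtain e where e: "a * d = e + b * c" "e \<noteq> 0"
    using assms that[of "a * d - b * c"] by simp
  let ?h = "mat2 (d / e) (- b / e) (- c / e) (a / e)"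
  have "mat2 a b c d ** ?h = mat 1" "?h ** mat2 a b c d = mat 1"
    using e by (simp_all add: mat2_simps mat2_eq_iff field_simps)
  then show ?thesis unfolding invertible_def by blast
qed

subsection \<open>Invariant polynomials and covariant matrices\<close>

type_synonym 'k poly2 = "(2 \<times> 2, 'k) xy_poly"
type_synonym 'a mat2 = "(('a, 2) vec, 2) vec"

definition conj_subst :: "'k::field mat2 \<Rightarrow> (2 \<times> 2) xy \<Rightarrow> 'k poly2" where
  "conj_subst g = (\<lambda>v. case v of
        XVar (i, j) \<Rightarrow> \<Sum>l\<in>UNIV. \<Sum>m\<in>UNIV. pconst (g $ i $ l * matrix_inv g $ m $ j) * pvar (XVar (l, m))
      | YVar (i, j) \<Rightarrow> \<Sum>l\<in>UNIV. \<Sum>m\<in>UNIV. pconst (g $ i $ l * matrix_inv g $ m $ j) * pvar (YVar (l, m)))"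

definition Inv :: "'k::field poly2 \<Rightarrow> bool" where
  "Inv p \<longleftrightarrow> (\<forall>g. invertible g \<longrightarrow> psubst (conj_subst g) p = p)"

definition Cov :: "'k::field poly2 mat2 \<Rightarrow> bool" where
  "Cov W \<longleftrightarrow> (\<forall>g. invertible g \<longrightarrow>
    map_mat (psubst (conj_subst g)) W = map_mat pconst g ** W ** map_mat pconst (matrix_inv g))"

lemma map_mat_pconst_inv:
  fixes g :: "'k::field mat2"
  assumes "invertible g"
  shows "map_mat pconst g ** map_mat pconst (matrix_inv g) = (mat 1 :: 'k poly2 mat2)"
    "map_mat pconst (matrix_inv g) ** map_mat pconst g = (mat 1 :: 'k poly2 mat2)"
  by (simp_all add: matrix_inv[OF assms] mat2_simps(3) pconst_simps flip: map_mat_mult)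

lemma Inv_closed:
  "Inv (pconst c)" "Inv 0" "Inv 1" "Inv (numeral n)"
  "Inv p \<Longrightarrow> Inv q \<Longrightarrow> Inv (p + q)" "Inv p \<Longrightarrow> Inv q \<Longrightarrow> Inv (p - q)"
  "Inv p \<Longrightarrow> Inv q \<Longrightarrow> Inv (p * q)" "Inv p \<Longrightarrow> Inv (- p)"
  by (simp_all add: Inv_def psubst_simps)

lemma Cov_mult:
  assumes "Cov V" "Cov W"
  shows "Cov (V ** W)"
  unfolding Cov_def
proof (intro allI impI)
  fix g :: "'a mat2" assume g: "invertible g"
  let ?G = "map_mat pconst g :: 'a poly2 mat2" and ?H = "map_mat pconst (matrix_inv g) :: 'a poly2 mat2"
  have "map_mat (psubst (conj_subst g)) (V ** W) = (?G ** V ** ?H) ** (?G ** W ** ?H)"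
    using assms g by (simp add: map_mat_mult psubst_simps Cov_def)
  also have "\<dots> = ?G ** V ** (?H ** ?G) ** W ** ?H"
    by (simp add: matrix_mul_assoc)
  finally show "map_mat (psubst (conj_subst g)) (V ** W) = ?G ** (V ** W) ** ?H"
    by (simp add: map_mat_pconst_inv[OF g] matrix_mul_assoc)
qed

lemma Cov_add: "Cov V \<Longrightarrow> Cov W \<Longrightarrow> Cov (V + W)"
  and Cov_diff: "Cov V \<Longrightarrow> Cov W \<Longrightarrow> Cov (V - W)"
  unfolding Cov_def
  by (auto simp: vec_eq_iff forall_2 psubst_simps matrix_matrix_mult_def sum_2 algebra_simps)

lemma Cov_mat: "Inv p \<Longrightarrow> Cov (mat p)"
  unfolding Cov_def
proof (intro allI impI)
  fix g :: "'a mat2" assume p: "Inv p" and g: "invertible g"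
  have "map_mat pconst g ** mat p ** map_mat pconst (matrix_inv g) =
      mat p ** (map_mat pconst g ** map_mat pconst (matrix_inv g))"
    by (rule mat2_eqI) (simp_all add: matrix_matrix_mult_def sum_2 mat_def algebra_simps)
  then show "map_mat (psubst (conj_subst g)) (mat p) =
      map_mat pconst g ** mat p ** map_mat pconst (matrix_inv g)"
    using p g by (simp add: map_mat_pconst_inv mat2_simps(1,3) psubst_simps Inv_def)
qed

lemma Inv_trace:
  assumes "Cov W"
  shows "Inv (trace W)"
  unfolding Inv_def
proof (intro allI impI)
  fix g :: "'a mat2" assume g: "invertible g"
  let ?G = "map_mat pconst g :: 'a poly2 mat2" and ?H = "map_mat pconst (matrix_inv g) :: 'a poly2 mat2"
  have "psubst (conj_subst g) (trace W) = trace (map_mat (psubst (conj_subst g)) W)"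
    by (simp add: trace_def sum_2 psubst_simps)
  also have "\<dots> = trace (?G ** (W ** ?H))"
    using assms g by (simp add: Cov_def matrix_mul_assoc)
  also have "\<dots> = trace (W ** (?H ** ?G))"
    by (subst trace_mul_sym) (simp add: matrix_mul_assoc)
  finally show "psubst (conj_subst g) (trace W) = trace W"
    by (simp add: map_mat_pconst_inv[OF g])
qed

definition Xmat :: "'k::field poly2 mat2" where "Xmat = (\<chi> i j. pvar (XVar (i, j)))"
definition Ymat :: "'k::field poly2 mat2" where "Ymat = (\<chi> i j. pvar (YVar (i, j)))"

lemma Cov_Xmat: "Cov Xmat" and Cov_Ymat: "Cov Ymat"
  unfolding Cov_def
  by (auto simp: vec_eq_iff forall_2 psubst_simps conj_subst_def matrix_matrix_mult_def sum_2
      Xmat_def Ymat_def pconst_simps algebra_simps)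

definition trX :: "'k::field poly2" where "trX = trace Xmat"
definition trY :: "'k::field poly2" where "trY = trace Ymat"
definition X0 :: "'k::field poly2 mat2" where "X0 = Xmat - mat (pconst (1 / 2) * trX)"
definition Y0 :: "'k::field poly2 mat2" where "Y0 = Ymat - mat (pconst (1 / 2) * trY)"
definition Mmat :: "'k::field poly2 mat2" where "Mmat = Xmat ** Ymat - Ymat ** Xmat"
definition qa :: "'k::field poly2" where "qa = pconst (1 / 2) * trace (X0 ** X0)"
definition qb :: "'k::field poly2" where "qb = trace (X0 ** Y0)"
definition qc :: "'k::field poly2" where "qc = pconst (1 / 2) * trace (Y0 ** Y0)"
text \<open>The discriminant of the binary quadratic form \<open>- det (s X0 + t Y0)\<close>, whose
  coefficients are \<open>qa\<close>, \<open>qb\<close>, \<open>qc\<close>. On a diagonal pair this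
  form is the square of a linear form, so the discriminant vanishes there.\<close>

definition Disc :: "'k::field poly2" where "Disc = qb * qb - 4 * qa * qc"

lemma Inv_trX: "Inv trX" and Inv_trY: "Inv trY"
  by (simp_all add: trX_def trY_def Inv_trace Cov_Xmat Cov_Ymat)

lemma Cov_X0: "Cov X0" and Cov_Y0: "Cov Y0" and Cov_Mmat: "Cov Mmat"
  unfolding X0_def Y0_def Mmat_def
  by (intro Cov_diff Cov_Xmat Cov_Ymat Cov_mat Inv_closed Inv_trX Inv_trY Cov_mult)+

lemma Inv_qa: "Inv qa" and Inv_qb: "Inv qb" and Inv_qc: "Inv qc" and Inv_Disc: "Inv Disc"
  unfolding qa_def qb_def qc_def Disc_def
  by (intro Inv_closed Inv_trace Cov_mult Cov_X0 Cov_Y0)+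

definition x0 :: "'k::field poly2" where "x0 = pconst (1 / 2) * (pvar (XVar (1, 1)) - pvar (XVar (2, 2)))"
definition x1 :: "'k::field poly2" where "x1 = pvar (XVar (1, 2))"
definition x2 :: "'k::field poly2" where "x2 = pvar (XVar (2, 1))"
definition y0 :: "'k::field poly2" where "y0 = pconst (1 / 2) * (pvar (YVar (1, 1)) - pvar (YVar (2, 2)))"
definition y1 :: "'k::field poly2" where "y1 = pvar (YVar (1, 2))"
definition y2 :: "'k::field poly2" where "y2 = pvar (YVar (2, 1))"

lemma half_add_half:
  fixes p :: "('i, 'k::field_char_0) xy_poly"
  shows "pconst (1 / 2) * p + pconst (1 / 2) * p = p"
proof -
  have "pconst (1 / 2) * p + pconst (1 / 2) * p = pconst (1 / 2 + 1 / 2) * p"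
    by (simp only: pconst_simps distrib_right)
  then show ?thesis by (simp add: pconst_simps)
qed

lemma X0_eq: "X0 = mat2 x0 x1 x2 (- x0 :: 'k::field_char_0 poly2)"
  and Y0_eq: "Y0 = mat2 y0 y1 y2 (- y0 :: 'k poly2)"
proof -
  have *: "p - pconst (1 / 2) * (p + q) = pconst (1 / 2) * (p - q)"
    "q - pconst (1 / 2) * (p + q) = - (pconst (1 / 2) * (p - q))" for p q :: "'k poly2"
    using half_add_half[of p] half_add_half[of q] by (simp_all add: algebra_simps)
  show "X0 = mat2 x0 x1 x2 (- x0 :: 'k poly2)" "Y0 = mat2 y0 y1 y2 (- y0 :: 'k poly2)"
    by (rule mat2_eqI; simp add: X0_def Y0_def x0_def x1_def x2_def y0_def y1_def y2_def
      Xmat_def Ymat_def mat_def trX_def trY_def trace_def sum_2 *)+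
qed

lemma qa_eq: "qa = x0 * x0 + x1 * (x2 :: 'k::field_char_0 poly2)"
  and qb_eq: "qb = 2 * x0 * y0 + x1 * y2 + x2 * (y1 :: 'k poly2)"
  and qc_eq: "qc = y0 * y0 + y1 * (y2 :: 'k poly2)"
  unfolding qa_def qb_def qc_def X0_eq Y0_eq mat2_simps
  using half_add_half[of "x0 * x0 + x1 * x2 :: 'k poly2"] half_add_half[of "y0 * y0 + y1 * y2 :: 'k poly2"]
  by (simp_all add: algebra_simps)

lemma Mmat_eq_comm: "Mmat = X0 ** Y0 - Y0 ** (X0 :: 'k::field poly2 mat2)"
  by (rule mat2_eqI)
    (simp_all add: Mmat_def X0_def Y0_def matrix_matrix_mult_def sum_2 mat_def algebra_simps)

lemma Mmat_eq: "Mmat = mat2 (x1 * y2 - x2 * y1) (2 * (x0 * y1 - x1 * y0)) (2 * (x2 * y0 - x0 * y2))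
    (- (x1 * y2 - x2 * (y1 :: 'k::field_char_0 poly2)))"
  unfolding Mmat_eq_comm X0_eq Y0_eq by (simp add: mat2_simps mat2_diff mat2_eq_iff algebra_simps)

subsection \<open>Evaluation at pairs of matrices\<close>

text \<open>The half traces \<open>t\<close> and \<open>s\<close> are split off because conjugation
  fixes them and moves only the other six coordinates.\<close>

definition pt :: "'k::field \<Rightarrow> 'k \<Rightarrow> 'k \<Rightarrow> 'k \<Rightarrow> 'k \<Rightarrow> 'k \<Rightarrow> 'k \<Rightarrow> 'k \<Rightarrow> (2 \<times> 2) xy \<Rightarrow> 'k" where
  "pt t a b c s d e f v = (case v of
     XVar (i, j) \<Rightarrow> mat2 (t + a) b c (t - a) $ i $ j
   | YVar (i, j) \<Rightarrow> mat2 (s + d) e f (s - d) $ i $ j)"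

lemma pt_surj:
  fixes \<rho> :: "(2 \<times> 2) xy \<Rightarrow> 'k::field_char_0"
  obtains t a b c s d e f where "\<rho> = pt t a b c s d e f"
proof
  let ?x = "\<lambda>i j. \<rho> (XVar (i, j))" and ?y = "\<lambda>i j. \<rho> (YVar (i, j))"
  show "\<rho> = pt ((?x 1 1 + ?x 2 2) / 2) ((?x 1 1 - ?x 2 2) / 2) (?x 1 2) (?x 2 1)
    ((?y 1 1 + ?y 2 2) / 2) ((?y 1 1 - ?y 2 2) / 2) (?y 1 2) (?y 2 1)"
  proof
    fix v :: "(2 \<times> 2) xy"
    show "\<rho> v = pt ((?x 1 1 + ?x 2 2) / 2) ((?x 1 1 - ?x 2 2) / 2) (?x 1 2) (?x 2 1)
      ((?y 1 1 + ?y 2 2) / 2) ((?y 1 1 - ?y 2 2) / 2) (?y 1 2) (?y 2 1) v"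
      by (cases v; rename_tac w; case_tac w; rename_tac i j; case_tac i rule: exhaust_2[THEN disjE];
        case_tac j rule: exhaust_2[THEN disjE]) (auto simp: pt_def field_simps)
  qed
qed

lemma ev_pt_vars:
  fixes t a b c s d e f :: "'k::field_char_0"
  shows "ev (pt t a b c s d e f) x0 = a" "ev (pt t a b c s d e f) x1 = b" "ev (pt t a b c s d e f) x2 = c"
    "ev (pt t a b c s d e f) y0 = d" "ev (pt t a b c s d e f) y1 = e" "ev (pt t a b c s d e f) y2 = f"
    "ev (pt t a b c s d e f) trX = 2 * t" "ev (pt t a b c s d e f) trY = 2 * s"
  by (simp_all add: x0_def x1_def x2_def y0_def y1_def y2_def trX_def trY_def trace_def sum_2
      Xmat_def Ymat_def ev_simps pt_def)

lemma ev_pt: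
  fixes t a b c s d e f :: "'k::field_char_0"
  shows "ev (pt t a b c s d e f) qa = a * a + b * c"
    "ev (pt t a b c s d e f) qb = 2 * a * d + b * f + c * e"
    "ev (pt t a b c s d e f) qc = d * d + e * f"
    "ev (pt t a b c s d e f) Disc = (2 * a * d + b * f + c * e)\<^sup>2 - 4 * (a * a + b * c) * (d * d + e * f)"
  by (simp_all add: qa_eq qb_eq qc_eq Disc_def ev_pt_vars ev_simps power2_eq_square)

lemma Disc_neq_0: "Disc \<noteq> (0 :: 'k::field_char_0 poly2)"
  and qa_neq_0: "qa \<noteq> (0 :: 'k poly2)" and qc_neq_0: "qc \<noteq> (0 :: 'k poly2)"
  \<comment> \<open>The pair \<open>(1, 0; 0, -1)\<close>, \<open>(0, 1; 1, 0)\<close> has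
    \<open>qa = qc = 1\<close>, \<open>qb = 0\<close> and \<open>Disc = -4\<close>.\<close>
  using ev_pt[of 0 1 0 0 0 0 1 "1 :: 'k"] by (auto simp: ev_0)

text \<open>The eight coordinates are numbered so that a list of polynomials selects which of them
  vary along the curve.\<close>

lemma pt_curve:
  fixes A :: "nat \<Rightarrow> 'k::field_char_0 poly"
  shows "\<exists>q. \<forall>z. ev (pt (poly (A 0) z) (poly (A 1) z) (poly (A 2) z) (poly (A 3) z)
    (poly (A 4) z) (poly (A 5) z) (poly (A 6) z) (poly (A 7) z)) p = poly q z"
proof (rule ev_curve)
  fix v :: "(2 \<times> 2) xy"
  show "\<exists>q. \<forall>z. pt (poly (A 0) z) (poly (A 1) z) (poly (A 2) z) (poly (A 3) z)
    (poly (A 4) z) (poly (A 5) z) (poly (A 6) z) (poly (A 7) z) v = poly q z"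
    by (cases v; rename_tac w; case_tac w; rename_tac i j; case_tac i rule: exhaust_2[THEN disjE];
        case_tac j rule: exhaust_2[THEN disjE])
      (auto simp: pt_def simp flip: poly_add poly_diff)
qed

text \<open>Conjugacy is stated as intertwining, \<open>A' ** g = g ** A\<close>, so that
  applications verify polynomial identities without computing an inverse. The scalar parts commute
  with \<open>g\<close> and follow along.\<close>

lemma ev_conj_subst:
  fixes g :: "'k::field mat2"
  assumes "invertible g"
    "mat2 a' b' c' (- a') ** g = g ** mat2 a b c (- a)" "mat2 d' e' f' (- d') ** g = g ** mat2 d e f (- d)"
  shows "(\<lambda>v. ev (pt t a b c s d e f) (conj_subst g v)) = pt t a' b' c' s d' e' f'"
proof -
  have conj: "g ** mat2 (z + p) q r (z - p) ** matrix_inv g = mat2 (z + p') q' r' (z - p')"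
    if "mat2 p' q' r' (- p') ** g = g ** mat2 p q r (- p)" for p q r p' q' r' z
  proof -
    have "g ** mat2 (z + p) q r (z - p) = g ** mat2 p q r (- p) + mat z ** g"
      by (rule mat2_eqI) (simp_all add: matrix_matrix_mult_def sum_2 mat_def algebra_simps)
    also have "\<dots> = mat2 (z + p') q' r' (z - p') ** g"
      unfolding that[symmetric]
      by (rule mat2_eqI) (simp_all add: matrix_matrix_mult_def sum_2 mat_def algebra_simps)
    finally show ?thesis
      using matrix_inv(1)[OF assms(1)] by (simp flip: matrix_mul_assoc)
  qed
  have X: "g ** mat2 (t + a) b c (t - a) ** matrix_inv g = mat2 (t + a') b' c' (t - a')"
    and Y: "g ** mat2 (s + d) e f (s - d) ** matrix_inv g = mat2 (s + d') e' f' (s - d')"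
    using assms conj by blast+
  show ?thesis
  proof
    fix v :: "(2 \<times> 2) xy"
    show "ev (pt t a b c s d e f) (conj_subst g v) = pt t a' b' c' s d' e' f' v"
      unfolding pt_def conj_subst_def X[symmetric] Y[symmetric]
      by (cases v; rename_tac w; case_tac w)
        (simp_all add: ev_simps matrix_matrix_mult_def sum_2 algebra_simps)
  qed
qed

lemma Inv_conj:
  fixes g :: "'k::field mat2"
  assumes "Inv p" "invertible g"
    "mat2 a' b' c' (- a') ** g = g ** mat2 a b c (- a)" "mat2 d' e' f' (- d') ** g = g ** mat2 d e f (- d)"
  shows "ev (pt t a' b' c' s d' e' f') p = ev (pt t a b c s d e f) p"
  using assms(1,2) ev_psubst[of "pt t a b c s d e f" "conj_subst g" p]
  by (simp add: Inv_def ev_conj_subst[OF assms(2-4)])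

text \<open>Conjugation by \<open>diag (2, 1)\<close> fixes every diagonal pair but multiplies the
  off-diagonal entries of a covariant by 2 and 1/2, so these vanish.\<close>

lemma Cov_diag:
  fixes W :: "'k::field_char_0 poly2 mat2"
  assumes "Cov W"
  shows "ev (pt t a 0 0 s d 0 0) (W $ 1 $ 2) = 0" "ev (pt t a 0 0 s d 0 0) (W $ 2 $ 1) = 0"
proof -
  let ?g = "mat2 2 0 0 1 :: 'k mat2" and ?\<rho> = "pt t a 0 0 s d 0 0"
  have g: "invertible ?g" by (rule invertible_mat2) simp
  have "(\<lambda>v. ev ?\<rho> (conj_subst ?g v)) = ?\<rho>"
    by (rule ev_conj_subst[OF g]) (simp_all add: mat2_simps mult.commute)
  then have "map_mat (ev ?\<rho>) W = map_mat (ev ?\<rho>) (map_mat (psubst (conj_subst ?g)) W)"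
    by (simp add: map_mat_def ev_psubst)
  also have "\<dots> = ?g ** map_mat (ev ?\<rho>) W ** matrix_inv ?g"
    using assms g unfolding Cov_def
    by (simp add: map_mat_mult ev_simps) (simp add: map_mat_def ev_simps)
  finally have "map_mat (ev ?\<rho>) W ** ?g = ?g ** map_mat (ev ?\<rho>) W"
    using matrix_inv(2)[OF g] by (metis matrix_mul_assoc matrix_mul_rid)
  then show "ev ?\<rho> (W $ 1 $ 2) = 0" "ev ?\<rho> (W $ 2 $ 1) = 0"
    by (auto simp: vec_eq_iff forall_2 matrix_matrix_mult_def sum_2)
qed

subsection \<open>The first fundamental theorem\<close>

inductive Rinv :: "'k::field poly2 \<Rightarrow> bool" where
  const: "Rinv (pconst c)" | trX: "Rinv trX" | trY: "Rinv trY"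
| qa: "Rinv qa" | qb: "Rinv qb" | qc: "Rinv qc"
| add: "Rinv p \<Longrightarrow> Rinv q \<Longrightarrow> Rinv (p + q)" | mult: "Rinv p \<Longrightarrow> Rinv q \<Longrightarrow> Rinv (p * q)"

text \<open>These serve as coefficients of remainders modulo \<open>Disc\<close>: there
  \<open>qb * qb\<close> may be replaced by \<open>4 * qa * qc\<close>, so \<open>qb\<close> is
  needed at most linearly.\<close>

inductive Rdiag :: "'k::field poly2 \<Rightarrow> bool" where
  const: "Rdiag (pconst c)" | trX: "Rdiag trX" | trY: "Rdiag trY" | qa: "Rdiag qa" | qc: "Rdiag qc"
| add: "Rdiag p \<Longrightarrow> Rdiag q \<Longrightarrow> Rdiag (p + q)" | mult: "Rdiag p \<Longrightarrow> Rdiag q \<Longrightarrow> Rdiag (p * q)"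

lemma Rinv_Inv: "Rinv p \<Longrightarrow> Inv p"
  by (induction rule: Rinv.induct) (simp_all add: Inv_closed Inv_trX Inv_trY Inv_qa Inv_qb Inv_qc)

lemma Rinv_consts: "Rinv 0" "Rinv 1" "Rinv (numeral n)"
  using Rinv.const[of 0] Rinv.const[of 1] Rinv.const[of "numeral n"]
  by (simp_all add: pconst_simps pconst_numeral)

lemma Rdiag_consts: "Rdiag 0" "Rdiag 1" "Rdiag (numeral n)"
  using Rdiag.const[of 0] Rdiag.const[of 1] Rdiag.const[of "numeral n"]
  by (simp_all add: pconst_simps pconst_numeral)

lemma Rdiag_Rinv: "Rdiag p \<Longrightarrow> Rinv p"
  by (induction rule: Rdiag.induct) (simp_all add: Rinv.intros)

text \<open>On the slice \<open>X = (0, a; 1, 0)\<close>, \<open>Y = (y, w; 0, -y)\<close> (up to scalar matrices), \<open>qa = a\<close>,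
  \<open>qb = w\<close> and \<open>qc = y\<^sup>2\<close>.\<close>

lemma slice_decomposition:
  fixes p :: "'k::field_char_0 poly2"
  shows "\<exists>E F. Rinv E \<and> Rinv F \<and> (\<forall>t a s y w.
    ev (pt t 0 a 1 s y w 0) p = ev (pt t 0 a 1 s y w 0) E + y * ev (pt t 0 a 1 s y w 0) F)"
proof (induction p rule: xy_poly_induct)
  case (const c)
  show ?case by (rule exI[of _ "pconst c"], rule exI[of _ 0]) (simp add: Rinv.const Rinv_consts ev_simps)
next
  case (var v)
  have h: "Rinv (pconst (1 / 2) * trX :: 'k poly2)" "Rinv (pconst (1 / 2) * trY :: 'k poly2)"
    by (intro Rinv.intros)+
  note c = Rinv.const Rinv.qa Rinv.qb Rinv_consts h
  define ok where "ok v E F \<longleftrightarrow> Rinv E \<and> Rinv F \<and> (\<forall>t a s y w.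
    ev (pt t 0 a 1 s y w 0) (pvar v) = ev (pt t 0 a 1 s y w 0) E + y * ev (pt t 0 a 1 s y w 0) F)"
    for v and E F :: "'k poly2"
  have "ok (XVar (1, 1)) (pconst (1 / 2) * trX) 0" "ok (XVar (2, 2)) (pconst (1 / 2) * trX) 0"
    "ok (XVar (1, 2)) qa 0" "ok (XVar (2, 1)) 1 0"
    "ok (YVar (1, 1)) (pconst (1 / 2) * trY) 1" "ok (YVar (2, 2)) (pconst (1 / 2) * trY) (pconst (-1))"
    "ok (YVar (1, 2)) qb 0" "ok (YVar (2, 1)) 0 0"
    unfolding ok_def by (simp_all add: c ev_simps ev_pt ev_pt_vars) (simp_all add: pt_def)
  then have "\<exists>E F. ok v E F"
    by (cases v; rename_tac w; case_tac w; rename_tac i j; case_tac i rule: exhaust_2[THEN disjE];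
        case_tac j rule: exhaust_2[THEN disjE]) blast+
  then show ?case unfolding ok_def .
next
  case (add p q)
  then obtain E F E' F' where *: "Rinv E" "Rinv F" "Rinv E'" "Rinv F'"
    and "\<forall>t a s y w. ev (pt t 0 a 1 s y w 0) p = ev (pt t 0 a 1 s y w 0) E + y * ev (pt t 0 a 1 s y w 0) F"
      "\<forall>t a s y w. ev (pt t 0 a 1 s y w 0) q = ev (pt t 0 a 1 s y w 0) E' + y * ev (pt t 0 a 1 s y w 0) F'"
    by blast
  then show ?case
    by (intro exI[of _ "E + E'"] exI[of _ "F + F'"] conjI Rinv.add *) (simp add: ev_simps algebra_simps)
next
  case (mult p q)
  then obtain E F E' F' where *: "Rinv E" "Rinv F" "Rinv E'" "Rinv F'"
    and "\<forall>t a s y w. ev (pt t 0 a 1 s y w 0) p = ev (pt t 0 a 1 s y w 0) E + y * ev (pt t 0 a 1 s y w 0) F"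
      "\<forall>t a s y w. ev (pt t 0 a 1 s y w 0) q = ev (pt t 0 a 1 s y w 0) E' + y * ev (pt t 0 a 1 s y w 0) F'"
    by blast
  \<comment> \<open>On the slice \<open>qc\<close> takes the value \<open>y * y\<close>, so the
    product of the two odd terms returns to the even component.\<close>
  then show ?case
    by (intro exI[of _ "E * E' + qc * (F * F')"] exI[of _ "E * F' + F * E'"] conjI Rinv.intros *)
      (simp add: ev_simps ev_pt algebra_simps)
qed

text \<open>The pairs for \<open>y\<close> and \<open>- y\<close> are conjugate by
  \<open>2 y X0 - z\<close>, which commutes with \<open>X0\<close> and is invertible where the
  discriminant \<open>z * z - 4 * a * y * y\<close> is nonzero. Both sides are polynomials in the
  upper right entry \<open>z\<close>, so the exceptional values do not matter.\<close>

lemma slice_even: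
  fixes p :: "'k::field_char_0 poly2"
  assumes "Inv p"
  shows "ev (pt t 0 a 1 s (- y) w 0) p = ev (pt t 0 a 1 s y w 0) p"
proof (cases "y = 0")
  case False
  have generic: "ev (pt t 0 a 1 s y z 0) p = ev (pt t 0 a 1 s (- y) z 0) p" if z: "z * z - 4 * a * y * y \<noteq> 0" for z
  proof (rule Inv_conj[OF assms])
    show "invertible (mat2 (- z) (2 * a * y) (2 * y) (- z))"
      by (rule invertible_mat2) (use z in \<open>simp add: algebra_simps\<close>)
    show "mat2 0 a 1 (- 0) ** mat2 (- z) (2 * a * y) (2 * y) (- z) =
        mat2 (- z) (2 * a * y) (2 * y) (- z) ** mat2 0 a 1 (- 0)"
      "mat2 y z 0 (- y) ** mat2 (- z) (2 * a * y) (2 * y) (- z) =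
        mat2 (- z) (2 * a * y) (2 * y) (- z) ** mat2 (- y) z 0 (- (- y))"
      by (simp_all add: mat2_simps mat2_eq_iff algebra_simps)
  qed
  have curve: "\<exists>q. \<forall>z. ev (pt t 0 a 1 s d z 0) p = poly q z" for d
    using pt_curve[of "\<lambda>n. [[:t:], [:0:], [:a:], [:1:], [:s:], [:d:], [:0, 1:], [:0:]] ! n" p] by simp
  obtain P Q where P: "\<And>z. ev (pt t 0 a 1 s y z 0) p = poly P z"
    and Q: "\<And>z. ev (pt t 0 a 1 s (- y) z 0) p = poly Q z"
    using curve[of y] curve[of "- y"] by blast
  have "P - Q = 0"
  proof (rule poly_eq_0_cofinite)
    show "[:- (4 * a * y * y), 0, 1:] \<noteq> 0" by simp
    fix z assume "poly [:- (4 * a * y * y), 0, 1:] z \<noteq> 0"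
    then show "poly (P - Q) z = 0" using generic[of z] by (simp add: algebra_simps flip: P Q)
  qed
  then show ?thesis using P Q by simp
qed simp

text \<open>If \<open>v = (1, z)\<close> is an eigenvector of \<open>Y\<close>, then in the basis \<open>v, X v\<close> the pair lies on the
  slice. The lower left entries of such \<open>Y\<close> are the values of a quadratic polynomial in \<open>z\<close>.\<close>

lemma slice_zero:
  fixes p :: "'k::field_char_0 poly2"
  assumes "Inv p" and slice: "\<And>t a s y w. ev (pt t 0 a 1 s y w 0) p = 0"
  shows "p = 0"
proof (rule ev_density[where g = "x2 * y1"])
  have "ev (pt 0 0 0 1 0 0 1 0) (x2 * y1 :: 'k poly2) \<noteq> 0" by (simp add: ev_simps ev_pt_vars)
  then show "x2 * y1 \<noteq> (0 :: 'k poly2)" by (metis ev_0)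
next
  fix \<rho> assume \<rho>: "ev \<rho> (x2 * y1 :: 'k poly2) \<noteq> 0"
  obtain t a b c s d e f where pt: "\<rho> = pt t a b c s d e f" by (rule pt_surj)
  \<comment> \<open>\<open>c\<close> being nonzero keeps the determinant of the base change
    \<open>?h\<close> from vanishing identically in \<open>z\<close>; \<open>e\<close> being nonzero
    makes the lower left entry \<open>?f\<close> nonconstant in \<open>z\<close>.\<close>
  have ce: "c \<noteq> 0" "e \<noteq> 0" using \<rho> by (auto simp: pt ev_simps ev_pt_vars)
  have generic: "ev (pt t a b c s d e (2 * d * z + e * z * z)) p = 0"
    if z: "c - 2 * a * z - b * z * z \<noteq> 0" for z
  proof -
    \<comment> \<open>This \<open>?f\<close> is the entry for which \<open>(1, z)\<close> is an
      eigenvector with eigenvalue \<open>d + e * z\<close>.\<close>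
    let ?f = "2 * d * z + e * z * z" and ?h = "mat2 1 (a + b * z) z (c - a * z)"
    have "ev (pt t a b c s d e ?f) p =
        ev (pt t 0 (a * a + b * c) 1 s (d + e * z) (2 * a * d + b * ?f + c * e) 0) p"
    proof (rule Inv_conj[OF assms(1)])
      show "invertible ?h" by (rule invertible_mat2) (use z in \<open>simp add: algebra_simps\<close>)
      show "mat2 a b c (- a) ** ?h = ?h ** mat2 0 (a * a + b * c) 1 (- 0)"
        "mat2 d e ?f (- d) ** ?h =
          ?h ** mat2 (d + e * z) (2 * a * d + b * ?f + c * e) 0 (- (d + e * z))"
        by (simp_all add: mat2_simps mat2_eq_iff algebra_simps)
    qed
    then show ?thesis by (simp add: slice)
  qed
  obtain P where P: "\<And>z. ev (pt t a b c s d e z) p = poly P z"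
    using pt_curve[of "\<lambda>n. [[:t:], [:a:], [:b:], [:c:], [:s:], [:d:], [:e:], [:0, 1:]] ! n" p] by auto
  have "pcompose P [:0, 2 * d, e:] = 0"
  proof (rule poly_eq_0_cofinite)
    show "[:c, - 2 * a, - b:] \<noteq> 0" using ce by simp
    fix z assume "poly [:c, - 2 * a, - b:] z \<noteq> 0"
    then show "poly (pcompose P [:0, 2 * d, e:]) z = 0"
      using generic[of z] P by (simp add: poly_pcompose algebra_simps)
  qed
  then have "P = 0" by (rule pcompose_eq_0) (use ce in simp)
  then show "ev \<rho> p = 0" using P[of f] by (simp add: pt)
qed

text \<open>On the slice \<open>p\<close> is \<open>E + y F\<close> with \<open>E\<close> and
  \<open>F\<close> in the generated algebra. All three are even in \<open>y\<close>, so
  \<open>y F\<close> vanishes there, and an invariant is determined by its restriction to the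
  slice.\<close>

theorem Inv_Rinv:
  fixes p :: "'k::field_char_0 poly2"
  assumes "Inv p"
  shows "Rinv p"
proof -
  obtain E F where EF: "Rinv E" "Rinv F" and p: "\<And>t a s y w.
    ev (pt t 0 a 1 s y w 0) p = ev (pt t 0 a 1 s y w 0) E + y * ev (pt t 0 a 1 s y w 0) F"
    using slice_decomposition[of p] by blast
  have "p - E = 0"
  proof (rule slice_zero)
    show "Inv (p - E)" using assms EF by (simp add: Inv_closed Rinv_Inv)
    fix t a s y w
    have "ev (pt t 0 a 1 s y w 0) E + y * ev (pt t 0 a 1 s y w 0) F =
        ev (pt t 0 a 1 s y w 0) E + (- y) * ev (pt t 0 a 1 s y w 0) F"
      using p[of t a s y w] p[of t a s "- y" w] slice_even[OF assms, of t a s y w]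
        slice_even[OF Rinv_Inv[OF EF(1)], of t a s y w] slice_even[OF Rinv_Inv[OF EF(2)], of t a s y w]
      by simp
    then show "ev (pt t 0 a 1 s y w 0) (p - E) = 0"
      by (simp add: ev_diff p)
  qed
  then show ?thesis using EF by simp
qed

subsection \<open>Invariants vanishing on diagonal pairs\<close>

text \<open>Division by \<open>Disc\<close> as a monic quadratic in \<open>qb\<close>; for products
  one uses \<open>qb * qb = Disc + 4 * qa * qc\<close>.\<close>

lemma Disc_division:
  assumes "Rinv (p :: 'k::field poly2)"
  shows "\<exists>Q A B. Rinv Q \<and> Rdiag A \<and> Rdiag B \<and> p = Disc * Q + A + qb * B"
  using assms
proof (induction rule: Rinv.induct)
  case (add p q)
  then obtain Q A B Q' A' B' where *: "Rinv Q" "Rinv Q'" "Rdiag A" "Rdiag A'" "Rdiag B" "Rdiag B'"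
    and "p = Disc * Q + A + qb * B" "q = Disc * Q' + A' + qb * B'" by blast
  then show ?case
    by (intro exI[of _ "Q + Q'"] exI[of _ "A + A'"] exI[of _ "B + B'"] conjI Rinv.add Rdiag.add *)
      (simp add: algebra_simps)
next
  case (mult p q)
  then obtain Q A B Q' A' B' where *: "Rinv Q" "Rinv Q'" "Rdiag A" "Rdiag A'" "Rdiag B" "Rdiag B'"
    and pq: "p = Disc * Q + A + qb * B" "q = Disc * Q' + A' + qb * B'" by blast
  show ?case
  proof (rule exI[of _ "p * Q' + Q * (A' + qb * B') + B * B'"],
      rule exI[of _ "A * A' + 4 * qa * qc * (B * B')"], rule exI[of _ "A * B' + A' * B"], intro conjI)
    show "p * q = Disc * (p * Q' + Q * (A' + qb * B') + B * B') + (A * A' + 4 * qa * qc * (B * B')) +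
        qb * (A * B' + A' * B)"
      unfolding pq Disc_def by (simp add: algebra_simps)
    show "Rinv (p * Q' + Q * (A' + qb * B') + B * B')"
      by (intro Rinv.intros mult.hyps * Rdiag_Rinv)
    show "Rdiag (A * A' + 4 * qa * qc * (B * B'))" "Rdiag (A * B' + A' * B)"
      by (intro Rdiag.intros Rdiag_consts *)+
  qed
next
  case qb
  show ?case
    by (rule exI[of _ 0], rule exI[of _ 0], rule exI[of _ 1]) (simp add: Rinv_consts Rdiag_consts)
next
  case (const c)
  show ?case
    by (rule exI[of _ 0], rule exI[of _ "pconst c"], rule exI[of _ 0])
      (simp add: Rinv_consts Rdiag_consts Rdiag.const)
next
  case trX
  show ?case
    by (rule exI[of _ 0], rule exI[of _ trX], rule exI[of _ 0]) (simp add: Rinv_consts Rdiag_consts Rdiag.trX)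
next
  case trY
  show ?case
    by (rule exI[of _ 0], rule exI[of _ trY], rule exI[of _ 0]) (simp add: Rinv_consts Rdiag_consts Rdiag.trY)
next
  case qa
  show ?case
    by (rule exI[of _ 0], rule exI[of _ qa], rule exI[of _ 0]) (simp add: Rinv_consts Rdiag_consts Rdiag.qa)
next
  case qc
  show ?case
    by (rule exI[of _ 0], rule exI[of _ qc], rule exI[of _ 0]) (simp add: Rinv_consts Rdiag_consts Rdiag.qc)
qed

lemma Rdiag_ev_eq:
  assumes "Rdiag p" "ev \<rho> trX = ev \<rho>' trX" "ev \<rho> trY = ev \<rho>' trY" "ev \<rho> qa = ev \<rho>' qa" "ev \<rho> qc = ev \<rho>' qc"
  shows "ev \<rho> p = ev \<rho>' p"
  using assms by (induction rule: Rdiag.induct) (simp_all add: ev_simps)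

lemma poly_squares_eq_0:
  fixes q :: "'k::field_char_0 poly"
  assumes "\<And>z. poly q (z * z) = 0"
  shows "q = 0"
proof -
  have "poly (pcompose q [:0, 0, 1:]) z = 0" for z
    using assms[of z] by (simp add: poly_pcompose)
  then have "pcompose q [:0, 0, 1:] = 0" using poly_all_0_iff_0 by blast
  then show ?thesis by (rule pcompose_eq_0) simp
qed

text \<open>On diagonal pairs \<open>qa\<close> and \<open>qc\<close> take only square values, and
  \<open>k\<close> may lack square roots. But a univariate polynomial vanishing at all squares is
  zero, which frees first \<open>qa\<close> and then \<open>qc\<close>.\<close>

lemma Rdiag_zero:
  fixes p :: "'k::field_char_0 poly2"
  assumes "Rdiag p" and diag: "\<And>t u s v. ev (pt t u 0 0 s v 0 0) p = 0"
  shows "p = 0"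
proof (rule ev_eq_0)
  fix \<rho> :: "(2 \<times> 2) xy \<Rightarrow> 'k"
  obtain t a b c s d e f where pt: "\<rho> = pt t a b c s d e f" by (rule pt_surj)
  have sq: "ev (pt t 0 (u * u) 1 s 0 (v * v) 1) p = 0" for u v
    using Rdiag_ev_eq[OF assms(1), of "pt t 0 (u * u) 1 s 0 (v * v) 1" "pt t u 0 0 s v 0 0"] diag[of t u s v]
    by (simp add: ev_pt ev_pt_vars)
  have half: "ev (pt t 0 z 1 s 0 (v * v) 1) p = 0" for z v
  proof -
    obtain P where P: "\<And>z. ev (pt t 0 z 1 s 0 (v * v) 1) p = poly P z"
      using pt_curve[of "\<lambda>n. [[:t:], [:0:], [:0, 1:], [:1:], [:s:], [:0:], [:v * v:], [:1:]] ! n" p] by auto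
    have "poly P (u * u) = 0" for u using P[of "u * u"] sq[of u v] by simp
    then have "P = 0" by (rule poly_squares_eq_0)
    then show ?thesis using P by simp
  qed
  have full: "ev (pt t 0 z 1 s 0 w 1) p = 0" for z w
  proof -
    obtain P where P: "\<And>w. ev (pt t 0 z 1 s 0 w 1) p = poly P w"
      using pt_curve[of "\<lambda>n. [[:t:], [:0:], [:z:], [:1:], [:s:], [:0:], [:0, 1:], [:1:]] ! n" p] by auto
    have "poly P (u * u) = 0" for u using P[of "u * u"] half[of z u] by simp
    then have "P = 0" by (rule poly_squares_eq_0)
    then show ?thesis using P by simp
  qed
  \<comment> \<open>The pair \<open>(0, z; 1, 0)\<close>, \<open>(0, w; 1, 0)\<close> realizes
    arbitrary values \<open>z\<close> of \<open>qa\<close> and \<open>w\<close> of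
    \<open>qc\<close>.\<close>
  have "ev \<rho> p = ev (pt t 0 (a * a + b * c) 1 s 0 (d * d + e * f) 1) p"
    by (rule Rdiag_ev_eq[OF assms(1)]) (simp_all add: pt ev_pt ev_pt_vars)
  then show "ev \<rho> p = 0" using full by simp
qed

text \<open>On a diagonal pair the remainder is \<open>A + 2 u v B\<close>, where \<open>A\<close>
  and \<open>B\<close> depend on \<open>u\<close> and \<open>v\<close> only through their squares.
  Changing the sign of \<open>u\<close> alone, which is not a conjugation, separates the two
  terms.\<close>

theorem Disc_dvd:
  fixes p :: "'k::field_char_0 poly2"
  assumes "Inv p" "\<And>t u s v. ev (pt t u 0 0 s v 0 0) p = 0"
  shows "\<exists>q. Inv q \<and> p = Disc * q"
proof -
  obtain Q A B where *: "Rinv Q" "Rdiag A" "Rdiag B" and p: "p = Disc * Q + A + qb * B"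
    using Disc_division[OF Inv_Rinv[OF assms(1)]] by blast
  have z: "ev (pt t u 0 0 s v 0 0) A + 2 * u * v * ev (pt t u 0 0 s v 0 0) B = 0" for t u s v
    using assms(2)[of t u s v] by (simp add: p ev_simps ev_pt power2_eq_square)
  have neg: "ev (pt t (- u) 0 0 s v 0 0) A = ev (pt t u 0 0 s v 0 0) A"
    "ev (pt t (- u) 0 0 s v 0 0) B = ev (pt t u 0 0 s v 0 0) B" for t u s v
    by (rule Rdiag_ev_eq[OF *(2)] Rdiag_ev_eq[OF *(3)]; simp add: ev_pt ev_pt_vars)+
  have A0: "ev (pt t u 0 0 s v 0 0) A = 0" for t u s v
    using z[of t u s v] z[of t "- u" s v] neg[of t u s v] by simp
  then have "A = 0" using * by (intro Rdiag_zero)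
  \<comment> \<open>The relation gives \<open>B = 0\<close> only where \<open>u * v\<close> is
    nonzero; the factor \<open>qa * qc\<close> takes care of the other diagonal pairs.\<close>
  have "qa * qc * B = 0"
  proof (rule Rdiag_zero)
    show "Rdiag (qa * qc * B)" by (intro Rdiag.intros *)
    show "ev (pt t u 0 0 s v 0 0) (qa * qc * B) = 0" for t u s v
      using z[of t u s v] A0[of t u s v] by (auto simp: ev_simps ev_pt)
  qed
  then have "B = 0" using xy_poly_no_zero_divisors qa_neq_0 qc_neq_0 by metis
  then show ?thesis using p \<open>A = 0\<close> * Rinv_Inv by auto
qed

subsection \<open>Covariants\<close>

lemma trace_smult: "trace (mat p ** W) = (p :: 'a::comm_ring_1) * trace (W :: 'a mat2)"
  by (simp add: trace_def sum_2 matrix_matrix_mult_def mat_def algebra_simps)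

text \<open>Cramer's rule for the trace form. \<open>X0\<close> and \<open>Y0\<close> have Gram
  matrix \<open>(2 qa, qb; qb, 2 qc)\<close> of determinant \<open>- Disc\<close>, and
  \<open>Mmat\<close> is orthogonal to both with norm \<open>2 Disc\<close>. The numerators are
  divisible by \<open>Disc\<close> because on a diagonal pair \<open>W\<close>, \<open>X0\<close>
  and \<open>Y0\<close> are all multiples of \<open>diag (1, -1)\<close>.\<close>

theorem covariant_expansion:
  fixes W :: "'k::field_char_0 poly2 mat2"
  assumes W: "Cov W" "trace W = 0"
  obtains \<alpha> \<beta> \<gamma> where "Inv \<alpha>" "Inv \<beta>" "Inv \<gamma>" "W = mat \<alpha> ** X0 + mat \<beta> ** Y0 + mat \<gamma> ** Mmat"
proof -
  define p q r where "p = trace (W ** X0)" and "q = trace (W ** Y0)" and "r = trace (W ** Mmat)"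
  have inv: "Inv p" "Inv q" "Inv r"
    unfolding p_def q_def r_def by (intro Inv_trace Cov_mult W Cov_X0 Cov_Y0 Cov_Mmat)+
  obtain w w1 w2 where w: "W = mat2 w w1 w2 (- w)"
  proof
    have "W $ 2 $ 2 = - W $ 1 $ 1" using W(2)
      by (simp add: trace_def sum_2 eq_neg_iff_add_eq_0 add.commute)
    then show "W = mat2 (W $ 1 $ 1) (W $ 1 $ 2) (W $ 2 $ 1) (- (W $ 1 $ 1))"
      by (intro mat2_eqI) simp_all
  qed
  have p: "p = 2 * w * x0 + w1 * x2 + w2 * x1" and q: "q = 2 * w * y0 + w1 * y2 + w2 * y1"
    and r: "r = 2 * w * (x1 * y2 - x2 * y1) + 2 * w1 * (x2 * y0 - x0 * y2) + 2 * w2 * (x0 * y1 - x1 * y0)"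
    unfolding p_def q_def r_def w X0_eq Y0_eq Mmat_eq mat2_simps by (simp_all add: algebra_simps)
  have diag: "ev (pt t u 0 0 s v 0 0) w1 = 0" "ev (pt t u 0 0 s v 0 0) w2 = 0" for t u s v
    using Cov_diag[OF W(1), of t u s v] by (simp_all add: w)
  have "\<exists>\<alpha>. Inv \<alpha> \<and> qb * q - 2 * qc * p = Disc * \<alpha>"
  proof (rule Disc_dvd)
    show "Inv (qb * q - 2 * qc * p)" by (intro Inv_closed inv Inv_qb Inv_qc)
    show "ev (pt t u 0 0 s v 0 0) (qb * q - 2 * qc * p) = 0" for t u s v
      by (simp add: p q ev_simps ev_pt ev_pt_vars diag algebra_simps)
  qed
  then obtain \<alpha> where \<alpha>: "Inv \<alpha>" "qb * q - 2 * qc * p = Disc * \<alpha>" by blast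
  have "\<exists>\<beta>. Inv \<beta> \<and> qb * p - 2 * qa * q = Disc * \<beta>"
  proof (rule Disc_dvd)
    show "Inv (qb * p - 2 * qa * q)" by (intro Inv_closed inv Inv_qb Inv_qa)
    show "ev (pt t u 0 0 s v 0 0) (qb * p - 2 * qa * q) = 0" for t u s v
      by (simp add: p q ev_simps ev_pt ev_pt_vars diag algebra_simps)
  qed
  then obtain \<beta> where \<beta>: "Inv \<beta>" "qb * p - 2 * qa * q = Disc * \<beta>" by blast
  have "\<exists>\<gamma>. Inv \<gamma> \<and> pconst (1 / 2) * r = Disc * \<gamma>"
  proof (rule Disc_dvd)
    show "Inv (pconst (1 / 2) * r)" by (intro Inv_closed inv)
    show "ev (pt t u 0 0 s v 0 0) (pconst (1 / 2) * r) = 0" for t u s v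
      by (simp add: r ev_simps ev_pt ev_pt_vars diag)
  qed
  then obtain \<gamma> where \<gamma>: "Inv \<gamma>" "pconst (1 / 2) * r = Disc * \<gamma>" by blast
  have \<gamma>': "w * (x1 * y2 - x2 * y1) + w1 * (x2 * y0 - x0 * y2) + w2 * (x0 * y1 - x1 * y0) = Disc * \<gamma>"
    (is "?A = _")
  proof -
    have rA: "r = ?A + ?A" unfolding r by (simp add: algebra_simps)
    have "pconst (1 / 2) * r = ?A" unfolding rA distrib_left[of "pconst (1 / 2)" ?A ?A] by (rule half_add_half)
    then show ?thesis using \<gamma>(2) by (simp only:)
  qed
  have e: "Disc * w = Disc * (\<alpha> * x0 + \<beta> * y0 + \<gamma> * (x1 * y2 - x2 * y1))"
    "Disc * w1 = Disc * (\<alpha> * x1 + \<beta> * y1 + \<gamma> * (2 * (x0 * y1 - x1 * y0)))"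
    "Disc * w2 = Disc * (\<alpha> * x2 + \<beta> * y2 + \<gamma> * (2 * (x2 * y0 - x0 * y2)))"
    unfolding distrib_left mult.assoc[symmetric] \<alpha>(2)[symmetric] \<beta>(2)[symmetric] \<gamma>'[symmetric]
    unfolding Disc_def p q qa_eq qb_eq qc_eq
    by (simp_all add: algebra_simps)
  have "W = mat \<alpha> ** X0 + mat \<beta> ** Y0 + mat \<gamma> ** Mmat"
    using e unfolding xy_poly_mult_cancel[OF Disc_neq_0]
    by (simp add: w X0_eq Y0_eq Mmat_eq mat2_simps mat2_eq_iff algebra_simps)
  then show thesis using that \<alpha> \<beta> \<gamma> by blast
qed

text \<open>The same Cramer identities, read for the zero matrix; the entry at \<open>(2, 2)\<close>
  follows from tracelessness and is left out.\<close>

lemma covariant_independent: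
  fixes \<alpha> \<beta> \<gamma> :: "'k::field_char_0 poly2"
  assumes "mat \<alpha> ** X0 + mat \<beta> ** Y0 + mat \<gamma> ** Mmat = 0"
  shows "\<alpha> = 0" "\<beta> = 0" "\<gamma> = 0"
proof -
  have "mat2 (\<alpha> * x0 + \<beta> * y0 + \<gamma> * (x1 * y2 - x2 * y1))
      (\<alpha> * x1 + \<beta> * y1 + \<gamma> * (2 * (x0 * y1 - x1 * y0)))
      (\<alpha> * x2 + \<beta> * y2 + \<gamma> * (2 * (x2 * y0 - x0 * y2))) 0 $ i $ j = 0" if "i = 1 \<or> j = 1" for i j
    using arg_cong[OF assms, of "\<lambda>W. W $ i $ j"] that exhaust_2[of i] exhaust_2[of j]
    by (auto simp: X0_eq Y0_eq Mmat_eq mat2_simps)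
  from this[of 1 1] this[of 1 2] this[of 2 1]
  have e: "\<alpha> * x0 + \<beta> * y0 + \<gamma> * (x1 * y2 - x2 * y1) = 0" (is "?l = 0")
      "\<alpha> * x1 + \<beta> * y1 + \<gamma> * (2 * (x0 * y1 - x1 * y0)) = 0" (is "?l1 = 0")
      "\<alpha> * x2 + \<beta> * y2 + \<gamma> * (2 * (x2 * y0 - x0 * y2)) = 0" (is "?l2 = 0") by simp_all
  have "Disc * \<alpha> = qb * (2 * ?l * y0 + ?l1 * y2 + ?l2 * y1) - 2 * qc * (2 * ?l * x0 + ?l1 * x2 + ?l2 * x1)"
    "Disc * \<beta> = qb * (2 * ?l * x0 + ?l1 * x2 + ?l2 * x1) - 2 * qa * (2 * ?l * y0 + ?l1 * y2 + ?l2 * y1)"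
    "Disc * \<gamma> = ?l * (x1 * y2 - x2 * y1) + ?l1 * (x2 * y0 - x0 * y2) + ?l2 * (x0 * y1 - x1 * y0)"
    unfolding Disc_def qa_eq qb_eq qc_eq by (simp_all add: algebra_simps)
  then have "Disc * \<alpha> = 0" "Disc * \<beta> = 0" "Disc * \<gamma> = 0"
    unfolding e by simp_all
  then show "\<alpha> = 0" "\<beta> = 0" "\<gamma> = 0" using xy_poly_no_zero_divisors Disc_neq_0 by blast+
qed

subsection \<open>Coordinates on the algebra of 2-by-2 matrices\<close>

type_synonym 'k gca2 = "(2 \<times> 2, 'k) gca"

definition tt :: "'k::comm_ring_1 gca2" where "tt = \<theta> (1, 1) + \<theta> (2, 2)"
definition hh :: "'k::comm_ring_1 gca2" where "hh = \<theta> (1, 1) - \<theta> (2, 2)"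
definition ee :: "'k::comm_ring_1 gca2" where "ee = \<theta> (1, 2)"
definition ff :: "'k::comm_ring_1 gca2" where "ff = \<theta> (2, 1)"

lemma basis_homogeneous:
  "(tt :: 'k::comm_ring_1 gca2) \<in> homogeneous 1" "(hh :: 'k gca2) \<in> homogeneous 1"
  "(ee :: 'k gca2) \<in> homogeneous 1" "(ff :: 'k gca2) \<in> homogeneous 1"
  unfolding tt_def hh_def ee_def ff_def by (intro homogeneous_closed)+

lemma basis_commute_aux:
  fixes a b x :: "'k::field_char_0 gca2"
  assumes "a \<in> homogeneous 1" "b \<in> homogeneous 1"
  shows "a * (b * x) = - (b * (a * x))" "a * (a * x) = 0"
  using homogeneous_1_anticommute[OF assms] homogeneous_1_square[OF assms(1)] by (simp_all flip: mult.assoc)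

text \<open>Oriented as rewrite rules that sort every word into the order \<open>tt\<close>,
  \<open>hh\<close>, \<open>ee\<close>, \<open>ff\<close> and delete repeated factors.\<close>

lemmas basis_commute =
  homogeneous_1_anticommute[OF basis_homogeneous(2) basis_homogeneous(1)]
  homogeneous_1_anticommute[OF basis_homogeneous(3) basis_homogeneous(1)]
  homogeneous_1_anticommute[OF basis_homogeneous(4) basis_homogeneous(1)]
  homogeneous_1_anticommute[OF basis_homogeneous(3) basis_homogeneous(2)]
  homogeneous_1_anticommute[OF basis_homogeneous(4) basis_homogeneous(2)]
  homogeneous_1_anticommute[OF basis_homogeneous(4) basis_homogeneous(3)]
  basis_commute_aux(1)[OF basis_homogeneous(2) basis_homogeneous(1)]
  basis_commute_aux(1)[OF basis_homogeneous(3) basis_homogeneous(1)]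
  basis_commute_aux(1)[OF basis_homogeneous(4) basis_homogeneous(1)]
  basis_commute_aux(1)[OF basis_homogeneous(3) basis_homogeneous(2)]
  basis_commute_aux(1)[OF basis_homogeneous(4) basis_homogeneous(2)]
  basis_commute_aux(1)[OF basis_homogeneous(4) basis_homogeneous(3)]
  homogeneous_1_square[OF basis_homogeneous(1)] homogeneous_1_square[OF basis_homogeneous(2)]
  homogeneous_1_square[OF basis_homogeneous(3)] homogeneous_1_square[OF basis_homogeneous(4)]
  basis_commute_aux(2)[OF basis_homogeneous(1) basis_homogeneous(1)]
  basis_commute_aux(2)[OF basis_homogeneous(2) basis_homogeneous(2)]
  basis_commute_aux(2)[OF basis_homogeneous(3) basis_homogeneous(3)]
  basis_commute_aux(2)[OF basis_homogeneous(4) basis_homogeneous(4)]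

lemmas basis_central =
  of_poly_central[of tt] of_poly_central[of hh] of_poly_central[of ee] of_poly_central[of ff]
  mult_of_poly_left_commute[of tt] mult_of_poly_left_commute[of hh]
  mult_of_poly_left_commute[of ee] mult_of_poly_left_commute[of ff]

lemmas basis_simps = basis_commute basis_central mult.assoc distrib_left distrib_right
  left_diff_distrib right_diff_distrib of_poly_simps

text \<open>Coordinates over the sorted words without \<open>tt\<close>. The entry \<open>w1\<close>
  goes with \<open>ff\<close> and \<open>w2\<close> with \<open>ee\<close> because
  \<open>tr (W \<theta>)\<close> pairs each entry with the transposed one.\<close>

definition raw :: "'k::field_char_0 poly2 \<Rightarrow> 'k poly2 \<Rightarrow> 'k poly2 \<Rightarrow> 'k poly2 \<Rightarrow> 'k poly2 \<Rightarrow> 'k poly2 \<Rightarrow>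
    'k poly2 \<Rightarrow> 'k poly2 \<Rightarrow> 'k gca2" where
  "raw p w w1 w2 v v1 v2 q = of_poly p + of_poly w * hh + of_poly w1 * ff + of_poly w2 * ee +
    of_poly v * (ee * ff) + of_poly v1 * (hh * ff) + of_poly v2 * (hh * ee) + of_poly q * (hh * (ee * ff))"

text \<open>\<open>tt * hh\<close> is \<open>-2\<close> times a product of two generators, so the
  word of all four is a unit multiple of the top basis element.\<close>

lemma top_coefficient:
  fixes p :: "'k::field_char_0 poly2"
  assumes "of_poly p * (tt * (hh * (ee * ff))) = 0"
  shows "p = 0"
proof -
  let ?d = "\<theta> (1, 1) * (\<theta> (2, 2) * (\<theta> (1, 2) * \<theta> (2, 1))) :: 'k gca2"
  have "tt * (hh * x) = - (\<theta> (1, 1) * (\<theta> (2, 2) * x) + \<theta> (1, 1) * (\<theta> (2, 2) * x))" for x :: "'k gca2"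
    using basis_commute_aux[of "\<theta> (2, 2)" "\<theta> (1, 1)" x]
      basis_commute_aux(2)[of "\<theta> (1, 1)" "\<theta> (2, 2)" x] basis_commute_aux(2)[of "\<theta> (2, 2)" "\<theta> (1, 1)" x]
    by (simp add: tt_def hh_def homogeneous_closed algebra_simps del: One_nat_def)
  then have top: "tt * (hh * (ee * ff)) = - (?d + ?d)"
    by (simp add: ee_def ff_def)
  let ?a = "(1, 1) :: 2 \<times> 2" and ?b = "(2, 2) :: 2 \<times> 2" and ?c = "(1, 2) :: 2 \<times> 2"
  have "UNIV - {?a} - {?b} - {?c} = {(2, 1)}"
    unfolding UNIV_Times_UNIV[symmetric] UNIV_2 by auto
  then have "coef ?d UNIV =
      koszul_sign {?a} (UNIV - {?a}) * (koszul_sign {?b} (UNIV - {?a} - {?b}) *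
      koszul_sign {?c} (UNIV - {?a} - {?b} - {?c}))"
    by (simp add: coef_theta_mult coef_simps)
  \<comment> \<open>The sign depends on the enumeration of the index pairs; it suffices that its
    square is 1.\<close>
  moreover have "(x * (y * z)) * (x * (y * z)) = 1" if "x * x = 1" "y * y = 1" "z * z = 1" for x y z :: "'k poly2"
  proof -
    have "(x * (y * z)) * (x * (y * z)) = (x * x) * ((y * y) * (z * z))" by (simp only: mult_ac)
    then show ?thesis by (simp add: that)
  qed
  ultimately have "coef ?d UNIV * coef ?d UNIV = 1" by simp
  then obtain c :: "'k poly2" where c: "coef ?d UNIV = c" "c * c = 1" by blast
  have "coef (of_poly p * (tt * (hh * (ee * ff)))) UNIV = - (p * c + p * c)"
    by (simp add: top coef_of_poly_mult coef_simps c algebra_simps)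
  then have "p * c + p * c = 0"
    using assms by (simp add: coef_simps)
  then have "p * c = 0"
    using half_add_half[of "p * c"] by (simp flip: distrib_left)
  moreover have "p = p * c * c" using c(2) by (simp add: mult.assoc)
  ultimately show "p = 0" by simp
qed

text \<open>Right multiplication by the complementary word turns each coefficient into a top
  coefficient. Working upwards in degree, the coefficients already known to vanish cannot
  interfere.\<close>

lemma tt_raw_eq_0:
  assumes z: "tt * raw p w w1 w2 v v1 v2 q = 0"
  shows "p = 0 \<and> w = 0 \<and> w1 = 0 \<and> w2 = 0 \<and> v = 0 \<and> v1 = 0 \<and> v2 = 0 \<and> q = 0"
proof -
  have m: "tt * raw p w w1 w2 v v1 v2 q * x = 0" for x using z by simp
  have p: "p = 0"
    using m[of "hh * (ee * ff)"] by (intro top_coefficient) (simp add: raw_def basis_simps)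
  have w: "w = 0"
    using m[of "ee * ff"] by (intro top_coefficient) (simp add: raw_def basis_simps p)
  have w1: "w1 = 0"
    using m[of "hh * ee"] by (intro top_coefficient) (simp add: raw_def basis_simps p)
  have w2: "w2 = 0"
    using m[of "hh * ff"] by (intro top_coefficient) (simp add: raw_def basis_simps p)
  have v: "v = 0"
    using m[of hh] by (intro top_coefficient) (simp add: raw_def basis_simps p w w1 w2)
  have v1: "v1 = 0"
    using m[of ee] by (intro top_coefficient) (simp add: raw_def basis_simps p w w1 w2)
  have v2: "v2 = 0"
    using m[of ff] by (intro top_coefficient) (simp add: raw_def basis_simps p w w1 w2)
  have q: "q = 0"
    using z by (intro top_coefficient) (simp add: raw_def basis_simps p w w1 w2 v v1 v2)
  show ?thesis using p w w1 w2 v v1 v2 q by simp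
qed

text \<open>Multiplication by \<open>tt\<close> kills the second summand, so the first can be
  treated alone.\<close>

lemma raw_unique:
  assumes "raw p w w1 w2 v v1 v2 q + tt * raw p' w' w1' w2' v' v1' v2' q' = 0"
  shows "p = 0 \<and> w = 0 \<and> w1 = 0 \<and> w2 = 0 \<and> v = 0 \<and> v1 = 0 \<and> v2 = 0 \<and> q = 0 \<and>
    p' = 0 \<and> w' = 0 \<and> w1' = 0 \<and> w2' = 0 \<and> v' = 0 \<and> v1' = 0 \<and> v2' = 0 \<and> q' = 0"
proof -
  let ?A = "raw p w w1 w2 v v1 v2 q" and ?B = "raw p' w' w1' w2' v' v1' v2' q'"
  have "tt * ?A = tt * (?A + tt * ?B)" by (simp add: distrib_left basis_commute)
  then have A: "p = 0 \<and> w = 0 \<and> w1 = 0 \<and> w2 = 0 \<and> v = 0 \<and> v1 = 0 \<and> v2 = 0 \<and> q = 0"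
    using assms by (intro tt_raw_eq_0) simp
  then have "?A = 0" by (simp add: raw_def of_poly_simps)
  then have "tt * ?B = 0" using assms by simp
  from tt_raw_eq_0[OF this] A show ?thesis by blast
qed

lemma raw_spans:
  fixes F :: "'k::field_char_0 gca2"
  obtains p w w1 w2 v v1 v2 q p' w' w1' w2' v' v1' v2' q'
    where "F = raw p w w1 w2 v v1 v2 q + tt * raw p' w' w1' w2' v' v1' v2' q'"
proof -
  define S where "S F \<longleftrightarrow> (\<exists>p w w1 w2 v v1 v2 q. F = raw p w w1 w2 v v1 v2 q)" for F :: "'k gca2"
  have S_add: "S (F + G)" if "S F" "S G" for F G
  proof -
    from that obtain p w w1 w2 v v1 v2 q p' w' w1' w2' v' v1' v2' q' where
      "F = raw p w w1 w2 v v1 v2 q" "G = raw p' w' w1' w2' v' v1' v2' q'" unfolding S_def by blast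
    then have "F + G = raw (p + p') (w + w') (w1 + w1') (w2 + w2') (v + v') (v1 + v1') (v2 + v2') (q + q')"
      by (simp add: raw_def basis_simps)
    then show ?thesis unfolding S_def by blast
  qed
  have S_mult: "S (of_poly r * F)" "S (hh * F)" "S (ee * F)" "S (ff * F)" if "S F" for r F
  proof -
    from that obtain p w w1 w2 v v1 v2 q where F: "F = raw p w w1 w2 v v1 v2 q" unfolding S_def by blast
    have "of_poly r * F = raw (r * p) (r * w) (r * w1) (r * w2) (r * v) (r * v1) (r * v2) (r * q)"
      "hh * F = raw 0 p 0 0 0 w1 w2 v" "ee * F = raw 0 0 0 p w1 0 (- w) (- v1)"
      "ff * F = raw 0 0 p 0 (- w2) (- w) 0 v2"
      by (simp_all add: F raw_def basis_simps)
    then show "S (of_poly r * F)" "S (hh * F)" "S (ee * F)" "S (ff * F)" unfolding S_def by blast+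
  qed
  have S_uminus: "S (- F)" if "S F" for F
    using S_mult(1)[OF that, of "- 1"] by (simp add: of_poly_simps)
  define T where "T F \<longleftrightarrow> (\<exists>A B. S A \<and> S B \<and> F = A + tt * B)" for F :: "'k gca2"
  have S0: "S 0" and S1: "S 1"
    unfolding S_def
    by (rule exI[of _ 0] exI[of _ 1], (rule exI[of _ 0])+, simp add: raw_def of_poly_simps)+
  have T_add: "T (F + G)" if "T F" "T G" for F G
  proof -
    from that obtain A B A' B' where *: "S A" "S A'" "S B" "S B'" and "F = A + tt * B" "G = A' + tt * B'"
      unfolding T_def by blast
    then have "F + G = (A + A') + tt * (B + B')" by (simp add: algebra_simps)
    then show ?thesis using * S_add unfolding T_def by blast
  qed
  have T_mult: "T (of_poly r * F)" "T (hh * F)" "T (ee * F)" "T (ff * F)" "T (tt * F)" if "T F" for r F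
  proof -
    from that obtain A B where *: "S A" "S B" and F: "F = A + tt * B" unfolding T_def by blast
    have TI: "T (A + tt * B)" if "S A" "S B" for A B using that unfolding T_def by blast
    have eqs: "of_poly r * F = of_poly r * A + tt * (of_poly r * B)" "hh * F = hh * A + tt * (- (hh * B))"
      "ee * F = ee * A + tt * (- (ee * B))" "ff * F = ff * A + tt * (- (ff * B))" "tt * F = 0 + tt * A"
      by (simp_all add: F basis_simps)
    show "T (of_poly r * F)" "T (hh * F)" "T (ee * F)" "T (ff * F)" "T (tt * F)"
      unfolding eqs by (intro TI S_mult S_uminus S0 *)+
  qed
  have \<theta>: "\<theta> (1, 1) = of_poly (pconst (1 / 2)) * (tt + hh :: 'k gca2)" "\<theta> (1, 2) = (ee :: 'k gca2)"
    "\<theta> (2, 1) = (ff :: 'k gca2)"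
    "\<theta> (2, 2) = of_poly (pconst (1 / 2)) * (tt + of_poly (- 1) * (hh :: 'k gca2))"
  proof -
    have "of_poly (pconst (1 / 2)) * (x + x) = (x :: 'k gca2)" for x
    proof -
      have "of_poly (pconst (1 / 2)) * (x + x) = of_poly (pconst (1 / 2) * 1 + pconst (1 / 2) * 1) * x"
        by (simp only: of_poly_simps(3) distrib_left distrib_right mult_1_right)
      also have "\<dots> = x" by (simp only: half_add_half) (simp add: of_poly_simps)
      finally show ?thesis .
    qed
    then show "\<theta> (1, 1) = of_poly (pconst (1 / 2)) * (tt + hh :: 'k gca2)" "\<theta> (1, 2) = (ee :: 'k gca2)"
    "\<theta> (2, 1) = (ff :: 'k gca2)"
      "\<theta> (2, 2) = of_poly (pconst (1 / 2)) * (tt + of_poly (- 1) * (hh :: 'k gca2))"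
      by (simp_all add: tt_def hh_def ee_def ff_def of_poly_simps)
  qed
  have "T F"
  proof (induction F rule: gca_induct)
    case one
    have "1 = 1 + tt * (0 :: 'k gca2)" by simp
    then show ?case unfolding T_def using S0 S1 by blast
  next
    case (theta i f)
    have "T (\<theta> (1, 1) * f)" "T (\<theta> (1, 2) * f)" "T (\<theta> (2, 1) * f)" "T (\<theta> (2, 2) * f)"
      unfolding \<theta> distrib_right mult.assoc using theta by (auto intro!: T_mult T_add)
    then show ?case using exhaust_2[of "fst i"] exhaust_2[of "snd i"] by (cases i) auto
  qed (simp_all add: T_add T_mult)
  then show thesis using that unfolding T_def S_def by blast
qed

section \<open>Coordinates by trace forms\<close>

definition ctr :: "'k::comm_ring_1 poly2 mat2 \<Rightarrow> 'k gca2 mat2 \<Rightarrow> 'k gca2" where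
  "ctr W Z = (\<Sum>i\<in>UNIV. \<Sum>j\<in>UNIV. of_poly (W $ i $ j) * Z $ j $ i)"

definition Th :: "'k::comm_ring_1 gca2 mat2" where "Th = (\<chi> i j. \<theta> (i, j))"

text \<open>The word \<open>hh * (ee * ff)\<close> is \<open>tr (\<theta>\<^sup>3) / 3\<close>; the
  explicit word makes the comparison with \<open>raw\<close> immediate.\<close>

definition form :: "'k::comm_ring_1 poly2 \<Rightarrow> 'k poly2 mat2 \<Rightarrow> 'k poly2 mat2 \<Rightarrow> 'k poly2 \<Rightarrow> 'k gca2" where
  "form p W V q = of_poly p + ctr W Th + ctr V (Th ** Th) + of_poly q * (hh * (ee * ff))"

lemma Th_eq: "Th = mat2 (\<theta> (1, 1)) ee ff (\<theta> (2, 2))"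
  by (rule mat2_eqI) (simp_all add: Th_def ee_def ff_def)

text \<open>The scalar part of \<open>Th\<close> is odd and anticommutes with the entries of the
  traceless part, so \<open>tt\<close> cancels from the square.\<close>

lemma Th_square: "Th ** Th = mat2 (ee * ff) (hh * ee) (- (hh * ff)) (- (ee * ff :: 'k::field_char_0 gca2))"
proof -
  have "ee * \<theta> (2, 2) = - (\<theta> (2, 2) * ee :: 'k gca2)" "ff * \<theta> (1, 1) = - (\<theta> (1, 1) * ff :: 'k gca2)"
    by (rule homogeneous_1_anticommute; intro basis_homogeneous homogeneous_closed)+
  then show ?thesis
    unfolding Th_eq mat2_simps mat2_eq_iff
    by (simp add: hh_def left_diff_distrib theta_square basis_commute)
qed

lemma ctr_Th: "ctr (mat2 w w1 w2 (- w)) Th = of_poly w * hh + of_poly w1 * ff + of_poly w2 * (ee :: 'k::field_char_0 gca2)"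
  by (simp add: ctr_def sum_2 Th_eq hh_def of_poly_simps algebra_simps)

lemma ctr_Th_square: "ctr (mat2 v v1 v2 (- v)) (Th ** Th) =
    of_poly (v + v) * (ee * ff) + of_poly (- v1) * (hh * ff) + of_poly v2 * (hh * ee :: 'k::field_char_0 gca2)"
  unfolding of_poly_simps(3,5) distrib_right by (simp add: ctr_def sum_2 Th_square of_poly_simps)

lemma form_raw:
  "form p (mat2 w w1 w2 (- w)) (mat2 v v1 v2 (- v)) q = raw p w w1 w2 (v + v) (- v1) v2 q"
  by (simp add: form_def raw_def ctr_Th ctr_Th_square)

lemma trace_0_mat2:
  fixes W :: "'a::ab_group_add mat2"
  shows "W $ 1 $ 1 + W $ 2 $ 2 = 0 \<Longrightarrow> \<exists>w w1 w2. W = mat2 w w1 w2 (- w)"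
  by (rule exI[of _ "W $ 1 $ 1"], rule exI[of _ "W $ 1 $ 2"], rule exI[of _ "W $ 2 $ 1"], rule mat2_eqI)
    (simp_all add: eq_neg_iff_add_eq_0 add.commute)

lemma form_eq_0:
  fixes p :: "'k::field_char_0 poly2"
  assumes z: "form p W V q + tt * form p' W' V' q' = 0"
    and t: "trace W = 0" "trace V = 0" "trace W' = 0" "trace V' = 0"
  shows "p = 0 \<and> W = 0 \<and> V = 0 \<and> q = 0 \<and> p' = 0 \<and> W' = 0 \<and> V' = 0 \<and> q' = 0"
proof -
  obtain w w1 w2 v v1 v2 w' w1' w2' v' v1' v2' where
    W: "W = mat2 w w1 w2 (- w)" and V: "V = mat2 v v1 v2 (- v)" and
    W': "W' = mat2 w' w1' w2' (- w')" and V': "V' = mat2 v' v1' v2' (- v')"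
    using t[unfolded trace_def sum_2, THEN trace_0_mat2] by metis
  have "p = 0 \<and> w = 0 \<and> w1 = 0 \<and> w2 = 0 \<and> v + v = 0 \<and> - v1 = 0 \<and> v2 = 0 \<and> q = 0 \<and>
    p' = 0 \<and> w' = 0 \<and> w1' = 0 \<and> w2' = 0 \<and> v' + v' = 0 \<and> - v1' = 0 \<and> v2' = 0 \<and> q' = 0"
    using z unfolding W V W' V' form_raw by (rule raw_unique)
  moreover have "r = 0" if "r + r = 0" for r :: "'k poly2"
    using half_add_half[of r] that by (metis distrib_left mult_zero_right)
  ultimately have "p = 0 \<and> w = 0 \<and> w1 = 0 \<and> w2 = 0 \<and> v = 0 \<and> v1 = 0 \<and> v2 = 0 \<and> q = 0 \<and>
    p' = 0 \<and> w' = 0 \<and> w1' = 0 \<and> w2' = 0 \<and> v' = 0 \<and> v1' = 0 \<and> v2' = 0 \<and> q' = 0"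
    unfolding neg_equal_0_iff_equal by blast
  moreover have "mat2 0 0 0 0 = (0 :: 'k poly2 mat2)" by (rule mat2_eqI) simp_all
  ultimately show ?thesis unfolding W V W' V' by auto
qed

lemma form_diff: "form p W V q - form p' W' V' q' = form (p - p') (W - W') (V - V') (q - q')"
  by (simp add: form_def ctr_def sum_2 of_poly_simps algebra_simps)

lemma form_unique:
  fixes p :: "'k::field_char_0 poly2"
  assumes "form p W V q + tt * form p' W' V' q' = form r A B s + tt * form r' A' B' s'"
    and "trace W = 0" "trace V = 0" "trace W' = 0" "trace V' = 0"
      "trace A = 0" "trace B = 0" "trace A' = 0" "trace B' = 0"
  shows "p = r \<and> W = A \<and> V = B \<and> q = s \<and> p' = r' \<and> W' = A' \<and> V' = B' \<and> q' = s'"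
proof -
  have "form (p - r) (W - A) (V - B) (q - s) + tt * form (p' - r') (W' - A') (V' - B') (q' - s') = 0"
    using assms(1) by (simp add: algebra_simps flip: form_diff)
  from form_eq_0[OF this] assms(2-) show ?thesis by (simp add: trace_sub)
qed

lemma form_spans:
  fixes F :: "'k::field_char_0 gca2"
  obtains p W V q p' W' V' q' where "F = form p W V q + tt * form p' W' V' q'"
    "trace W = 0" "trace V = 0" "trace W' = 0" "trace V' = 0"
proof -
  obtain p w w1 w2 v v1 v2 q p' w' w1' w2' v' v1' v2' q'
    where F: "F = raw p w w1 w2 v v1 v2 q + tt * raw p' w' w1' w2' v' v1' v2' q'" by (rule raw_spans)
  let ?m = "\<lambda>w w1 w2. mat2 w w1 w2 (- w) :: 'k poly2 mat2"
  have "F = form p (?m w w1 w2) (?m (pconst (1 / 2) * v) (- v1) v2) q +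
      tt * form p' (?m w' w1' w2') (?m (pconst (1 / 2) * v') (- v1') v2') q'"
    unfolding F form_raw half_add_half by simp
  then show thesis by (rule that) (simp_all add: mat2_simps)
qed

subsection \<open>Conjugation\<close>

definition conj_theta :: "'k::field mat2 \<Rightarrow> 2 \<times> 2 \<Rightarrow> 'k gca2" where
  "conj_theta g = (\<lambda>(i, j). \<Sum>l\<in>UNIV. \<Sum>m\<in>UNIV. scale (g $ i $ l * matrix_inv g $ m $ j) (\<theta> (l, m)))"

lemma conj_action_eq: "conj_action g = gca_hom (conj_subst g) (conj_theta g)"
  by (simp add: conj_action_def conj_subst_def conj_theta_def)

lemma conj_theta_homogeneous: "conj_theta g i \<in> homogeneous 1"
  unfolding conj_theta_def by (cases i) (auto intro!: homogeneous_sum homogeneous_closed simp del: One_nat_def)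

lemma conj_action_mult: "conj_action g (F * G) = conj_action g F * conj_action (g :: 'k::field_char_0 mat2) G"
  unfolding conj_action_eq by (rule gca_hom_mult) (rule conj_theta_homogeneous)

lemma conj_action_simps:
  "conj_action g (F + G) = conj_action g F + conj_action g G"
  "conj_action g (F - G) = conj_action g F - conj_action g G"
  "conj_action g (of_poly p * F) = of_poly (psubst (conj_subst g) p) * conj_action g F"
  "conj_action g (of_poly p) = of_poly (psubst (conj_subst g) p)"
  unfolding conj_action_eq by (rule gca_hom_add gca_hom_diff gca_hom_of_poly_mult gca_hom_of_poly)+

lemma of_poly_collect: "of_poly p * (of_poly q * F) = of_poly (p * q) * (F :: ('i::enum, 'k::comm_ring_1) gca)"
  by (simp add: of_poly_simps mult.assoc)

lemma conj_action_Th: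
  "map_mat (conj_action g) Th =
    map_mat of_poly (map_mat pconst g) ** Th ** map_mat of_poly (map_mat pconst (matrix_inv (g :: 'k::field mat2)))"
proof -
  have "conj_action g (\<theta> (i, j)) = conj_theta g (i, j)" for i j
    by (simp add: conj_action_eq gca_hom_theta)
  then show ?thesis
    by (simp add: vec_eq_iff forall_2 Th_def matrix_matrix_mult_def sum_2 conj_theta_def scale_eq
      of_poly_collect pconst_simps of_poly_central[of "\<theta> (_, _)"] algebra_simps)
qed

text \<open>Cyclicity of the trace, valid here because only polynomial entries, which are central,
  are moved around.\<close>

lemma ctr_conj: "ctr W (map_mat of_poly A ** Z ** map_mat of_poly B) = ctr (B ** W ** A) Z"
  by (simp add: ctr_def sum_2 matrix_matrix_mult_def of_poly_simps(3) of_poly_collect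
      of_poly_central[of "Z $ _ $ _"] algebra_simps)

lemma conj_action_ctr:
  "conj_action g (ctr W Z) = ctr (map_mat (psubst (conj_subst g)) W) (map_mat (conj_action g) Z)"
  by (simp add: ctr_def sum_2 conj_action_simps)

lemma ctr_mat_1_Th: "ctr (mat 1) Th = tt"
  by (simp add: ctr_def sum_2 Th_eq mat2_simps(3) tt_def of_poly_simps)

text \<open>Shows that \<open>hh * (ee * ff)\<close> is fixed by conjugation, since it is a trace up
  to the factor 3.\<close>

lemma ctr_mat_1_Th3: "ctr (mat 1) (Th ** (Th ** Th)) = of_poly 3 * (hh * (ee * ff) :: 'k::field_char_0 gca2)"
proof -
  have *: "\<theta> (1, 1) * (ee * ff) = hh * (ee * ff) + \<theta> (2, 2) * (ee * ff :: 'k gca2)"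
    by (simp add: hh_def left_diff_distrib)
  have "of_poly 3 = (1 + 1 + 1 :: 'k gca2)" unfolding of_poly_numeral by simp
  then have 3: "of_poly 3 * x = x + x + x" for x :: "'k gca2" by (simp only: distrib_right mult_1_left)
  show ?thesis
    unfolding Th_square 3 by (simp add: ctr_def sum_2 mat2_simps Th_eq of_poly_simps * basis_simps)
qed

lemma conj_action_form:
  fixes g :: "'k::field_char_0 mat2"
  assumes g: "invertible g"
  defines "G \<equiv> map_mat pconst g" and "H \<equiv> map_mat pconst (matrix_inv g)" and "\<sigma> \<equiv> psubst (conj_subst g)"
  shows "conj_action g (form p W V q) =
      form (\<sigma> p) (H ** map_mat \<sigma> W ** G) (H ** map_mat \<sigma> V ** G) (\<sigma> q)"
    "conj_action g tt = tt"
proof -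
  let ?G = "map_mat of_poly G :: 'k gca2 mat2" and ?H = "map_mat of_poly H :: 'k gca2 mat2"
  have HG: "?H ** ?G = mat 1"
    unfolding G_def H_def
    by (simp add: map_mat_pconst_inv[OF g] of_poly_simps mat2_simps(3) flip: map_mat_mult)
  have Th: "map_mat (conj_action g) Th = ?G ** Th ** ?H"
    unfolding G_def H_def by (rule conj_action_Th)
  have mult: "map_mat (conj_action g) (A ** B) = map_mat (conj_action g) A ** map_mat (conj_action g) B" for A B
    by (rule map_mat_mult) (simp_all add: conj_action_simps conj_action_mult)
  have "?G ** A ** ?H ** (?G ** B ** ?H) = ?G ** (A ** (?H ** ?G) ** B) ** ?H" for A B
    by (simp add: matrix_mul_assoc)
  then have GH: "?G ** A ** ?H ** (?G ** B ** ?H) = ?G ** (A ** B) ** ?H" for A B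
    by (simp add: HG)
  have one: "H ** map_mat \<sigma> (mat 1) ** G = mat 1"
    unfolding G_def H_def \<sigma>_def by (simp add: mat2_simps(3) psubst_simps)
      (simp add: map_mat_pconst_inv[OF g] flip: mat2_simps(3))
  have Th2: "map_mat (conj_action g) (Th ** Th) = ?G ** (Th ** Th) ** ?H"
    and Th3: "map_mat (conj_action g) (Th ** (Th ** Th)) = ?G ** (Th ** (Th ** Th)) ** ?H"
    unfolding mult Th GH by simp_all
  show "conj_action g tt = tt"
    unfolding ctr_mat_1_Th[symmetric] conj_action_ctr Th ctr_conj one[unfolded \<sigma>_def] ..
  have "conj_action g (of_poly 3 * (hh * (ee * ff))) = of_poly 3 * (hh * (ee * ff))"
    unfolding ctr_mat_1_Th3[symmetric] conj_action_ctr Th3 ctr_conj one[unfolded \<sigma>_def] ..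
  then have "of_poly (pconst (1 / 3)) * (of_poly 3 * conj_action g (hh * (ee * ff))) =
      of_poly (pconst (1 / 3)) * (of_poly 3 * (hh * (ee * ff)))"
    by (simp add: conj_action_simps psubst_simps)
  moreover have "pconst (1 / 3) * 3 = (1 :: 'k poly2)"
    using pconst_simps(4)[of "1 / 3 :: 'k" 3] by (simp add: pconst_simps pconst_numeral)
  ultimately have "conj_action g (hh * (ee * ff)) = hh * (ee * ff)"
    unfolding of_poly_collect by (simp add: of_poly_simps)
  then show "conj_action g (form p W V q) =
      form (\<sigma> p) (H ** map_mat \<sigma> W ** G) (H ** map_mat \<sigma> V ** G) (\<sigma> q)"
    unfolding form_def conj_action_simps conj_action_ctr Th Th2 ctr_conj \<sigma>_def by simp
qed

text \<open>Conjugation by \<open>g\<close> replaces a coordinate matrix by its substituted form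
  conjugated back with the inverse of \<open>g\<close>. By uniqueness of coordinates, being fixed is
  the same as covariance of each matrix.\<close>

lemma conj_action_fix_iff:
  fixes p :: "'k::field_char_0 poly2"
  assumes t: "trace W = 0" "trace V = 0" "trace W' = 0" "trace V' = 0"
  shows "(\<forall>g. invertible g \<longrightarrow>
      conj_action g (form p W V q + tt * form p' W' V' q') = form p W V q + tt * form p' W' V' q') \<longleftrightarrow>
    Inv p \<and> Cov W \<and> Cov V \<and> Inv q \<and> Inv p' \<and> Cov W' \<and> Cov V' \<and> Inv q'"
proof -
  have conj_iff: "map_mat pconst (matrix_inv g) ** A ** map_mat pconst g = B \<longleftrightarrow>
      A = map_mat pconst g ** B ** map_mat pconst (matrix_inv g)"
    if "invertible g" for g :: "'k mat2" and A B :: "'k poly2 mat2"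
  proof -
    let ?G = "map_mat pconst g :: 'k poly2 mat2" and ?H = "map_mat pconst (matrix_inv g) :: 'k poly2 mat2"
    have "?G ** (?H ** A ** ?G) ** ?H = (?G ** ?H) ** A ** (?G ** ?H)"
      "?H ** (?G ** B ** ?H) ** ?G = (?H ** ?G) ** B ** (?H ** ?G)"
      by (simp_all add: matrix_mul_assoc)
    then have "?G ** (?H ** A ** ?G) ** ?H = A" "?H ** (?G ** B ** ?H) ** ?G = B"
      by (simp_all add: map_mat_pconst_inv[OF that])
    then show ?thesis by auto
  qed
  \<comment> \<open>Uniqueness holds for traceless coordinates, so the transformed matrices must be
    seen to be traceless too.\<close>
  have tr: "trace (map_mat pconst (matrix_inv g) ** map_mat (psubst (conj_subst g)) A ** map_mat pconst g) = 0"
    if "trace A = 0" "invertible g" for g :: "'k mat2" and A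
  proof -
    have "trace (map_mat pconst (matrix_inv g) ** map_mat (psubst (conj_subst g)) A ** map_mat pconst g) =
        trace (map_mat pconst g ** (map_mat pconst (matrix_inv g) ** map_mat (psubst (conj_subst g)) A))"
      by (rule trace_mul_sym)
    also have "\<dots> = trace (map_mat (psubst (conj_subst g)) A)"
      by (simp add: matrix_mul_assoc map_mat_pconst_inv[OF that(2)])
    also have "\<dots> = psubst (conj_subst g) (trace A)" by (simp add: trace_def sum_2 psubst_simps)
    finally show ?thesis using that by (simp add: psubst_simps)
  qed
  have "conj_action g (form p W V q + tt * form p' W' V' q') = form p W V q + tt * form p' W' V' q' \<longleftrightarrow>
    psubst (conj_subst g) p = p \<and>
    map_mat (psubst (conj_subst g)) W = map_mat pconst g ** W ** map_mat pconst (matrix_inv g) \<and>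
    map_mat (psubst (conj_subst g)) V = map_mat pconst g ** V ** map_mat pconst (matrix_inv g) \<and>
    psubst (conj_subst g) q = q \<and> psubst (conj_subst g) p' = p' \<and>
    map_mat (psubst (conj_subst g)) W' = map_mat pconst g ** W' ** map_mat pconst (matrix_inv g) \<and>
    map_mat (psubst (conj_subst g)) V' = map_mat pconst g ** V' ** map_mat pconst (matrix_inv g) \<and>
    psubst (conj_subst g) q' = q'" if g: "invertible g" for g
    unfolding conj_iff[OF g, symmetric] conj_action_simps conj_action_mult conj_action_form[OF g]
    using form_unique[OF _ tr[OF t(1) g] tr[OF t(2) g] tr[OF t(3) g] tr[OF t(4) g] t] by metis
  then show ?thesis unfolding Inv_def Cov_def by blast
qed

subsection \<open>The differential\<close>

lemma koszul_diff_add: "koszul_diff a (f + g) = koszul_diff a f + koszul_diff a g"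
  by (rule gca_eqI) (simp add: koszul_diff_def coef_simps distrib_left sum.distrib)

lemma koszul_diff_of_poly_mult: "koszul_diff a (of_poly p * f) = of_poly p * koszul_diff a f"
  by (rule gca_eqI) (simp add: koszul_diff_def coef_of_poly_mult sum_distrib_left mult_ac)

lemma koszul_diff_uminus: "koszul_diff a (- f) = - koszul_diff a f"
  using koszul_diff_of_poly_mult[of a "- 1" f] by (simp add: of_poly_simps)

lemma koszul_diff_minus: "koszul_diff a (f - g) = koszul_diff a f - koszul_diff a g"
  using koszul_diff_add[of a f "- g"] by (simp add: koszul_diff_uminus)

lemma koszul_diff_odd_mult:
  "t \<in> homogeneous 1 \<Longrightarrow> koszul_diff a (t * f) = koszul_diff a t * f - t * koszul_diff a f"
  using koszul_diff_mult[of t 1 a f] by simp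

definition dd :: "'k::field gca2 \<Rightarrow> 'k gca2" where
  "dd = koszul_diff (\<lambda>(i, j). Mmat $ i $ j)"

lemma DRep_eq: "DRep = free_dga (\<lambda>(i, j). Mmat $ i $ j :: 'k::field poly2)"
proof -
  have "Mmat $ i $ j = (\<Sum>l\<in>UNIV. pvar (XVar (i, l)) * pvar (YVar (l, j)) -
      pvar (YVar (i, l)) * pvar (XVar (l, j)) :: 'k poly2)" for i j
    by (simp add: Mmat_def Xmat_def Ymat_def matrix_matrix_mult_def sum_2)
  then show ?thesis by (simp add: DRep_def)
qed

lemmas dd_linear =
  koszul_diff_add[of "\<lambda>(i, j). Mmat $ i $ j", folded dd_def]
  koszul_diff_minus[of "\<lambda>(i, j). Mmat $ i $ j", folded dd_def]
  koszul_diff_uminus[of "\<lambda>(i, j). Mmat $ i $ j", folded dd_def]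
  koszul_diff_of_poly_mult[of "\<lambda>(i, j). Mmat $ i $ j", folded dd_def]
  koszul_diff_of_poly[of "\<lambda>(i, j). Mmat $ i $ j", folded dd_def]

lemma trace_Mmat: "trace Mmat = (0 :: 'k::field poly2)"
  unfolding Mmat_def trace_sub by (simp add: trace_mul_sym[of Xmat])

lemma dd_basis:
  assumes M: "Mmat = mat2 m m1 m2 (- m :: 'k::field poly2)"
  shows "dd (tt :: 'k gca2) = 0" "dd hh = of_poly (m + m)" "dd ee = of_poly m1" "dd ff = of_poly m2"
proof -
  have th: "dd (\<theta> (i, j)) = of_poly (Mmat $ i $ j :: 'k poly2)" for i j
    unfolding dd_def koszul_diff_theta by simp
  show "dd (tt :: 'k gca2) = 0" "dd hh = of_poly (m + m)" "dd ee = of_poly m1" "dd ff = of_poly m2"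
    unfolding of_poly_simps(3) by (simp_all add: tt_def hh_def ee_def ff_def dd_linear th M of_poly_simps)
qed

lemma dd_odd:
  "dd (tt * F) = dd tt * F - tt * dd F" "dd (hh * F) = dd hh * F - hh * dd F"
  "dd (ee * F) = dd ee * F - ee * dd F" "dd (ff * F) = dd ff * F - ff * dd F"
  unfolding dd_def by (intro koszul_diff_odd_mult basis_homogeneous)+

lemma Mmat_mat2: obtains m m1 m2 where "Mmat = mat2 m m1 m2 (- m :: 'k::field poly2)"
  using trace_0_mat2[of "Mmat :: 'k poly2 mat2"] trace_Mmat[where 'k = 'k] by (auto simp: trace_def sum_2)

lemma dd_tt_mult: "dd (tt * F) = - (tt * dd F)"
proof -
  obtain m m1 m2 where "Mmat = mat2 m m1 m2 (- m :: 'a poly2)" by (rule Mmat_mat2)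
  then show ?thesis by (simp add: dd_odd dd_basis)
qed

lemma dd_raw:
  assumes M: "Mmat = mat2 m m1 m2 (- m :: 'k::field_char_0 poly2)"
  shows "dd (raw p w w1 w2 v v1 v2 q) =
    raw (w * (m + m) + w1 * m2 + w2 * m1) (- (v1 * m2) - v2 * m1) (v * m1 + v1 * (m + m))
      (- (v * m2) + v2 * (m + m)) (q * (m + m)) (- (q * m1)) (q * m2) 0"
  unfolding raw_def by (simp add: dd_linear dd_odd dd_basis[OF M] basis_simps del: of_poly_numeral)

text \<open>The Leibniz rule for \<open>\<theta>\<close> with \<open>d \<theta> = M\<close>:
  \<open>d (\<theta>\<^sup>2) = M \<theta> - \<theta> M\<close> gives the commutator after cyclic
  rotation, and \<open>d (tr (\<theta>\<^sup>3)) = 3 tr (M \<theta>\<^sup>2)\<close>.\<close>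

lemma dd_form:
  fixes p :: "'k::field_char_0 poly2"
  assumes "trace W = 0" "trace V = 0"
  shows "dd (form p W V q) = form (trace (W ** Mmat)) (V ** Mmat - Mmat ** V) (mat q ** Mmat) 0"
proof -
  obtain m m1 m2 where M: "Mmat = mat2 m m1 m2 (- m :: 'k poly2)" by (rule Mmat_mat2)
  obtain w w1 w2 v v1 v2 where W: "W = mat2 w w1 w2 (- w)" and V: "V = mat2 v v1 v2 (- v)"
    using assms[unfolded trace_def sum_2, THEN trace_0_mat2] by metis
  have e: "V ** Mmat - Mmat ** V = mat2 (v1 * m2 - v2 * m1) ((v + v) * m1 - v1 * (m + m))
      (v2 * (m + m) - (v + v) * m2) (- (v1 * m2 - v2 * m1))"
    "mat q ** Mmat = mat2 (q * m) (q * m1) (q * m2) (- (q * m))"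
    "trace (W ** Mmat) = w * (m + m) + w1 * m2 + w2 * m1"
    unfolding V W M mat2_simps mat2_diff mat2_eq_iff by (simp_all add: algebra_simps)
  show ?thesis
    unfolding e unfolding W V form_raw dd_raw[OF M] by (simp add: algebra_simps)
qed

text \<open>For the trace form \<open>Mmat\<close> is orthogonal to \<open>X0\<close> and
  \<open>Y0\<close>. Commutation with \<open>Mmat\<close> preserves their span, and its coefficient
  matrix there squares to \<open>4 Disc\<close>, which is the matrix factorization.\<close>

lemma trace_X0_Mmat: "trace (X0 ** Mmat) = (0 :: 'k::field_char_0 poly2)"
  and trace_Y0_Mmat: "trace (Y0 ** Mmat) = (0 :: 'k poly2)"
  and trace_Mmat_Mmat: "trace (Mmat ** Mmat) = Disc + (Disc :: 'k poly2)"
  and X0_Mmat: "X0 ** Mmat - Mmat ** X0 = mat (- (2 * qb)) ** X0 + mat (4 * qa) ** (Y0 :: 'k poly2 mat2)"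
  and Y0_Mmat: "Y0 ** Mmat - Mmat ** Y0 = mat (- (4 * qc)) ** X0 + mat (2 * qb) ** (Y0 :: 'k poly2 mat2)"
  unfolding X0_eq Y0_eq Mmat_eq Disc_def qa_eq qb_eq qc_eq mat2_simps mat2_diff mat2_eq_iff
  by (simp_all add: algebra_simps)

lemma trace_X0: "trace X0 = (0 :: 'k::field_char_0 poly2)" and trace_Y0: "trace Y0 = (0 :: 'k poly2)"
  by (simp_all add: X0_eq Y0_eq mat2_simps)

lemma covariant_combination:
  fixes \<alpha> \<beta> \<gamma> :: "'k::field_char_0 poly2"
  assumes "Inv \<alpha>" "Inv \<beta>" "Inv \<gamma>"
  shows "Cov (mat \<alpha> ** X0 + mat \<beta> ** Y0 + mat \<gamma> ** Mmat)" "trace (mat \<alpha> ** X0 + mat \<beta> ** Y0 + mat \<gamma> ** Mmat) = 0"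
  using assms
  by (auto intro!: Cov_add Cov_mult Cov_mat Cov_X0 Cov_Y0 Cov_Mmat simp: trace_add trace_smult trace_X0 trace_Y0 trace_Mmat)

lemma commutator_combination:
  fixes \<alpha> \<beta> \<gamma> :: "'k::field_char_0 poly2"
  defines "V \<equiv> mat \<alpha> ** X0 + mat \<beta> ** Y0 + mat \<gamma> ** Mmat"
  shows "V ** Mmat - Mmat ** V =
    mat (- (2 * qb * \<alpha>) - 4 * qc * \<beta>) ** X0 + mat (4 * qa * \<alpha> + 2 * qb * \<beta>) ** Y0"
proof -
  have "V ** Mmat - Mmat ** V = mat \<alpha> ** (X0 ** Mmat - Mmat ** X0) + mat \<beta> ** (Y0 ** Mmat - Mmat ** Y0)"
    unfolding V_def
    by (rule mat2_eqI) (simp_all add: matrix_matrix_mult_def sum_2 mat_def algebra_simps)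
  also have "\<dots> = mat (- (2 * qb * \<alpha>) - 4 * qc * \<beta>) ** X0 + mat (4 * qa * \<alpha> + 2 * qb * \<beta>) ** Y0"
    unfolding X0_Mmat Y0_Mmat
    by (rule mat2_eqI) (simp_all add: matrix_matrix_mult_def sum_2 mat_def algebra_simps)
  finally show ?thesis .
qed

lemma double_eq_0:
  fixes r :: "('i, 'k::field_char_0) xy_poly"
  assumes "r + r = 0"
  shows "r = 0"
  using half_add_half[of r] assms by (simp flip: distrib_left)

text \<open>Orthogonality to \<open>Mmat\<close> removes the \<open>Mmat\<close> part of
  \<open>W\<close>, because \<open>Disc\<close> is not a zero divisor. Commutation with
  \<open>Mmat\<close> is injective on the span of \<open>X0\<close> and \<open>Y0\<close>, so only
  the \<open>Mmat\<close> part of \<open>V\<close> survives.\<close>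

lemma cycle_components:
  fixes q :: "'k::field_char_0 poly2" and W V :: "'k poly2 mat2"
  assumes W: "Cov W" "trace W = 0" "trace (W ** Mmat) = 0"
    and V: "Cov V" "trace V = 0" "V ** Mmat - Mmat ** V = 0" and q: "mat q ** Mmat = 0"
  obtains \<alpha> \<beta> \<gamma> where "Inv \<alpha>" "Inv \<beta>" "Inv \<gamma>" "W = mat \<alpha> ** X0 + mat \<beta> ** Y0" "V = mat \<gamma> ** Mmat" "q = 0"
proof -
  have mat0: "mat 0 ** A = 0" for A :: "'k poly2 mat2"
    by (rule mat2_eqI) (simp_all add: matrix_matrix_mult_def sum_2 mat_def)
  obtain \<alpha> \<beta> \<delta> where abd: "Inv \<alpha>" "Inv \<beta>" "W = mat \<alpha> ** X0 + mat \<beta> ** Y0 + mat \<delta> ** Mmat"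
    using covariant_expansion[OF W(1,2)] by metis
  have "trace (W ** Mmat) = \<alpha> * trace (X0 ** Mmat) + \<beta> * trace (Y0 ** Mmat) + \<delta> * trace (Mmat ** Mmat)"
    unfolding abd(3) by (simp add: trace_def sum_2 matrix_matrix_mult_def mat_def algebra_simps)
  also have "\<dots> = Disc * \<delta> + Disc * \<delta>"
    by (simp add: trace_X0_Mmat trace_Y0_Mmat trace_Mmat_Mmat algebra_simps)
  finally have "Disc * \<delta> = 0" using W(3) double_eq_0 by metis
  then have "\<delta> = 0" using xy_poly_no_zero_divisors Disc_neq_0 by blast
  obtain \<alpha>' \<beta>' \<gamma> where abg: "Inv \<gamma>" "V = mat \<alpha>' ** X0 + mat \<beta>' ** Y0 + mat \<gamma> ** Mmat"
    using covariant_expansion[OF V(1,2)] by metis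
  have "mat (- (2 * qb * \<alpha>') - 4 * qc * \<beta>') ** X0 + mat (4 * qa * \<alpha>' + 2 * qb * \<beta>') ** Y0 + mat 0 ** Mmat = 0"
    using V(3) unfolding abg(2) commutator_combination by (simp add: mat0)
  note e = covariant_independent(1,2)[OF this]
  \<comment> \<open>Half the factorization matrix is applied to its own output, which gives
    \<open>2 Disc\<close> times the input.\<close>
  have "Disc * \<alpha>' + Disc * \<alpha>' = - qb * (- (2 * qb * \<alpha>') - 4 * qc * \<beta>') - 2 * qc * (4 * qa * \<alpha>' + 2 * qb * \<beta>')"
    "Disc * \<beta>' + Disc * \<beta>' = 2 * qa * (- (2 * qb * \<alpha>') - 4 * qc * \<beta>') + qb * (4 * qa * \<alpha>' + 2 * qb * \<beta>')"
    unfolding Disc_def by (simp_all add: algebra_simps)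
  then have "Disc * \<alpha>' = 0" "Disc * \<beta>' = 0"
    unfolding e by (simp_all add: double_eq_0)
  then have "\<alpha>' = 0" "\<beta>' = 0" using xy_poly_no_zero_divisors Disc_neq_0 by blast+
  moreover have "q = 0"
    using covariant_independent(3)[of 0 0 q] q by (simp add: mat0)
  ultimately show thesis
    using that[of \<alpha> \<beta> \<gamma>] abd abg \<open>\<delta> = 0\<close> by (simp add: mat0)
qed

subsection \<open>The Harish-Chandra homomorphism on coordinates\<close>

definition diag_subst :: "(2 \<times> 2) xy \<Rightarrow> (2, 'k::field) xy_poly" where
  "diag_subst = (\<lambda>v. case v of
        XVar (i, j) \<Rightarrow> if i = j then pvar (XVar i) else 0
      | YVar (i, j) \<Rightarrow> if i = j then pvar (YVar i) else 0)"

abbreviation \<phi> :: "'k::field poly2 \<Rightarrow> (2, 'k) xy_poly" where "\<phi> \<equiv> psubst diag_subst"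

definition diag_theta :: "2 \<times> 2 \<Rightarrow> (2, 'k::field) gca" where
  "diag_theta = (\<lambda>(i, j). if i = j then \<theta> i else 0)"

lemma Phi_eq: "\<Phi> = gca_hom diag_subst diag_theta"
  by (simp add: \<Phi>_def diag_subst_def diag_theta_def)

lemma diag_theta_homogeneous: "diag_theta i \<in> homogeneous 1"
  unfolding diag_theta_def by (cases i) (auto simp: homogeneous_closed simp del: One_nat_def)

lemma Phi_mult: "\<Phi> (F * G) = \<Phi> F * \<Phi> (G :: 'k::field_char_0 gca2)"
  unfolding Phi_eq by (rule gca_hom_mult) (rule diag_theta_homogeneous)

lemma Phi_simps:
  "\<Phi> (F + G) = \<Phi> F + \<Phi> (G :: 'k::field gca2)" "\<Phi> (F - G) = \<Phi> F - \<Phi> (G :: 'k::field gca2)"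
  "\<Phi> (- F) = - \<Phi> (F :: 'k::field gca2)"
  "\<Phi> (of_poly p * F) = of_poly (\<phi> p) * \<Phi> (F :: 'k::field gca2)"
  "\<Phi> (of_poly p) = of_poly (\<phi> (p :: 'k::field poly2))"
  "\<Phi> (0 :: 'k::field gca2) = 0"
  unfolding Phi_eq
  by (rule gca_hom_add gca_hom_diff gca_hom_uminus gca_hom_of_poly_mult gca_hom_of_poly gca_hom_0)+

lemma Phi_basis:
  "\<Phi> (tt :: 'k::field_char_0 gca2) = \<theta> 1 + \<theta> 2" "\<Phi> (hh :: 'k gca2) = \<theta> 1 - \<theta> 2"
  "\<Phi> (ee :: 'k gca2) = 0" "\<Phi> (ff :: 'k gca2) = 0"
  unfolding Phi_eq tt_def hh_def ee_def ff_def gca_hom_add gca_hom_diff gca_hom_theta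
  by (simp_all add: diag_theta_def)

lemma Phi_form:
  fixes p :: "'k::field_char_0 poly2"
  assumes "trace W = 0" "trace V = 0"
  shows "\<Phi> (form p W V q) = of_poly (\<phi> p) + of_poly (\<phi> (W $ 1 $ 1)) * (\<theta> 1 - \<theta> 2)"
proof -
  obtain w w1 w2 v v1 v2 where W: "W = mat2 w w1 w2 (- w)" and V: "V = mat2 v v1 v2 (- v)"
    using assms[unfolded trace_def sum_2, THEN trace_0_mat2] by metis
  show ?thesis unfolding W V form_raw by (simp add: raw_def Phi_simps Phi_mult Phi_basis)
qed

text \<open>Every coefficient of a boundary lies in the ideal generated by the \<open>a i\<close>;
  for \<open>\<Phi>\<close> these are entries of a commutator of diagonal matrices.\<close>

lemma gca_hom_koszul_diff:
  assumes "\<And>i. psubst \<sigma> (a i) = 0"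
  shows "gca_hom \<sigma> \<tau> (koszul_diff a f) = 0"
  by (simp add: gca_hom_def koszul_diff_def psubst_simps assms of_poly_simps)

lemma phi_Mmat: "\<phi> (Mmat $ i $ j :: 'k::field poly2) = 0"
  using exhaust_2[of i] exhaust_2[of j]
  by (auto simp: Mmat_def Xmat_def Ymat_def matrix_matrix_mult_def sum_2 psubst_simps diag_subst_def)

lemma Phi_dd: "\<Phi> (dd F) = 0"
  unfolding Phi_eq dd_def by (rule gca_hom_koszul_diff) (auto simp: phi_Mmat)

section \<open>Even and odd polynomials on diagonal pairs\<close>

definition du :: "(2, 'k::field) xy_poly" where "du = pconst (1 / 2) * (pvar (XVar 1) - pvar (XVar 2))"
definition dv :: "(2, 'k::field) xy_poly" where "dv = pconst (1 / 2) * (pvar (YVar 1) - pvar (YVar 2))"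

lemma phi_vars:
  "\<phi> x0 = (du :: (2, 'k::field_char_0) xy_poly)" "\<phi> y0 = (dv :: (2, 'k) xy_poly)"
  "\<phi> x1 = (0 :: (2, 'k) xy_poly)" "\<phi> x2 = (0 :: (2, 'k) xy_poly)"
  "\<phi> y1 = (0 :: (2, 'k) xy_poly)" "\<phi> y2 = (0 :: (2, 'k) xy_poly)"
  "\<phi> trX = (pvar (XVar 1) + pvar (XVar 2) :: (2, 'k) xy_poly)"
  "\<phi> trY = (pvar (YVar 1) + pvar (YVar 2) :: (2, 'k) xy_poly)"
  by (simp_all add: x0_def y0_def x1_def x2_def y1_def y2_def du_def dv_def trX_def trY_def trace_def sum_2
      Xmat_def Ymat_def psubst_simps diag_subst_def)

lemma phi_quadrics:
  "\<phi> qa = (du * du :: (2, 'k::field_char_0) xy_poly)" "\<phi> qb = (2 * du * dv :: (2, 'k) xy_poly)"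
  "\<phi> qc = (dv * dv :: (2, 'k) xy_poly)"
  by (simp_all add: qa_eq qb_eq qc_eq psubst_simps phi_vars)

lemma ev_phi:
  fixes \<rho> :: "2 xy \<Rightarrow> 'k::field_char_0"
  shows "ev \<rho> (\<phi> p) = ev (pt ((\<rho> (XVar 1) + \<rho> (XVar 2)) / 2) ((\<rho> (XVar 1) - \<rho> (XVar 2)) / 2) 0 0
    ((\<rho> (YVar 1) + \<rho> (YVar 2)) / 2) ((\<rho> (YVar 1) - \<rho> (YVar 2)) / 2) 0 0) p"
proof -
  have "ev \<rho> (diag_subst v) = pt ((\<rho> (XVar 1) + \<rho> (XVar 2)) / 2) ((\<rho> (XVar 1) - \<rho> (XVar 2)) / 2) 0 0
    ((\<rho> (YVar 1) + \<rho> (YVar 2)) / 2) ((\<rho> (YVar 1) - \<rho> (YVar 2)) / 2) 0 0 v" for v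
    by (cases v; rename_tac w; case_tac w; rename_tac i j; case_tac i rule: exhaust_2[THEN disjE];
        case_tac j rule: exhaust_2[THEN disjE])
      (auto simp: pt_def diag_subst_def ev_simps field_simps)
  then show ?thesis by (simp add: ev_psubst)
qed

lemma phi_eq_0_Disc_dvd:
  fixes p :: "'k::field_char_0 poly2"
  assumes "Inv p" "\<phi> p = 0"
  obtains q where "Inv q" "p = Disc * q"
proof -
  have "ev (pt t u 0 0 s v 0 0) p = 0" for t u s v
    using ev_phi[of "case_xy (\<lambda>i. if i = 1 then t + u else t - u) (\<lambda>i. if i = 1 then s + v else s - v)" p]
    by (simp add: assms(2) ev_simps)
  then show thesis using that Disc_dvd[OF assms(1)] by blast
qed

definition swap_subst :: "2 xy \<Rightarrow> (2, 'k::field) xy_poly" where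
  "swap_subst = (\<lambda>v. case v of XVar i \<Rightarrow> pvar (XVar (if i = 1 then 2 else 1))
    | YVar i \<Rightarrow> pvar (YVar (if i = 1 then 2 else 1)))"

lemma swap_du: "psubst swap_subst du = - (du :: (2, 'k::field) xy_poly)"
  and swap_dv: "psubst swap_subst dv = - (dv :: (2, 'k::field) xy_poly)"
  by (simp_all add: du_def dv_def psubst_simps swap_subst_def algebra_simps)

text \<open>Exchanging the two diagonal entries is conjugation by a permutation matrix.\<close>

lemma swap_phi:
  fixes p :: "'k::field_char_0 poly2"
  assumes "Inv p"
  shows "psubst swap_subst (\<phi> p) = \<phi> p"
proof (rule ev_eqI)
  fix \<rho> :: "2 xy \<Rightarrow> 'k"
  have *: "ev (pt t u 0 0 s v 0 0) p = ev (pt t (- u) 0 0 s (- v) 0 0) p" for t u s v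
    by (rule Inv_conj[OF assms, of "mat2 0 1 1 0"], rule invertible_mat2) (simp_all add: mat2_simps)
  have "ev \<rho> (psubst swap_subst (\<phi> p)) = ev (pt ((\<rho> (XVar 1) + \<rho> (XVar 2)) / 2) (- ((\<rho> (XVar 1) - \<rho> (XVar 2)) / 2)) 0 0
    ((\<rho> (YVar 1) + \<rho> (YVar 2)) / 2) (- ((\<rho> (YVar 1) - \<rho> (YVar 2)) / 2)) 0 0) p"
    unfolding ev_psubst[of \<rho> swap_subst] ev_phi
    by (simp add: swap_subst_def ev_simps add.commute minus_divide_left)
  also have "\<dots> = ev \<rho> (\<phi> p)"
    unfolding ev_phi[of \<rho>] by (rule *[symmetric])
  finally show "ev \<rho> (psubst swap_subst (\<phi> p)) = ev \<rho> (\<phi> p)" .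
qed

text \<open>Restricted invariants give the even polynomials, and \<open>du\<close>,
  \<open>dv\<close> generate the odd ones over them. Products stay in this form since
  \<open>du * du\<close>, \<open>dv * dv\<close> and \<open>du * dv\<close> are the restrictions of
  \<open>qa\<close>, \<open>qc\<close> and half of \<open>qb\<close>.\<close>

lemma phi_decomposition:
  fixes p :: "(2, 'k::field_char_0) xy_poly"
  shows "\<exists>E A B. Inv E \<and> Inv A \<and> Inv B \<and> p = \<phi> E + du * \<phi> A + dv * \<phi> B"
proof (induction p rule: xy_poly_induct)
  case (const c)
  show ?case
    by (rule exI[of _ "pconst c"], rule exI[of _ 0], rule exI[of _ 0]) (simp add: Inv_closed psubst_simps)
next
  case (var v)
  have half: "p = h * (p + q) + h * (p - q)" "q = h * (p + q) - h * (p - q)" if "\<And>r. h * r + h * r = r"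
    for h p q :: "(2, 'k) xy_poly"
    using that[of p] that[of q] by (simp_all add: algebra_simps)
  note h = half[of "pconst (1 / 2)", OF half_add_half]
  define ok where "ok p E A B \<longleftrightarrow> Inv E \<and> Inv A \<and> Inv B \<and> p = \<phi> E + du * \<phi> A + dv * \<phi> B"
    for p and E A B :: "'k poly2"
  have "ok (pvar (XVar 1)) (pconst (1 / 2) * trX) 1 0" "ok (pvar (XVar 2)) (pconst (1 / 2) * trX) (- 1) 0"
    "ok (pvar (YVar 1)) (pconst (1 / 2) * trY) 0 1" "ok (pvar (YVar 2)) (pconst (1 / 2) * trY) 0 (- 1)"
    unfolding ok_def
    using h(1)[of "pvar (XVar 1)" "pvar (XVar 2)"] h(2)[of "pvar (XVar 2)" "pvar (XVar 1)"]
      h(1)[of "pvar (YVar 1)" "pvar (YVar 2)"] h(2)[of "pvar (YVar 2)" "pvar (YVar 1)"]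
    by (simp_all add: Inv_closed Inv_trX Inv_trY psubst_simps phi_vars du_def dv_def)
  then have "\<exists>E A B. ok (pvar v) E A B"
    by (cases v; rename_tac i; case_tac i rule: exhaust_2[THEN disjE]) blast+
  then show ?case unfolding ok_def .
next
  case (add p q)
  then obtain E A B E' A' B' where *: "Inv E" "Inv E'" "Inv A" "Inv A'" "Inv B" "Inv B'"
    and "p = \<phi> E + du * \<phi> A + dv * \<phi> B" "q = \<phi> E' + du * \<phi> A' + dv * \<phi> B'" by blast
  then have "p + q = \<phi> (E + E') + du * \<phi> (A + A') + dv * \<phi> (B + B')"
    by (simp add: psubst_simps algebra_simps)
  moreover have "Inv (E + E')" "Inv (A + A')" "Inv (B + B')"
    by (intro Inv_closed *)+
  ultimately show ?case by blast
next
  case (mult p q)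
  then obtain E A B E' A' B' where *: "Inv E" "Inv E'" "Inv A" "Inv A'" "Inv B" "Inv B'"
    and pq: "p = \<phi> E + du * \<phi> A + dv * \<phi> B" "q = \<phi> E' + du * \<phi> A' + dv * \<phi> B'" by blast
  have b: "\<phi> (pconst (1 / 2) * qb :: 'k poly2) = du * dv"
    by (simp only: psubst_mult psubst_pconst phi_quadrics mult_2 distrib_right distrib_left half_add_half)
  have "p * q = \<phi> (E * E' + qa * (A * A') + qc * (B * B') + (pconst (1 / 2) * qb) * (A * B' + A' * B)) +
      du * \<phi> (E * A' + E' * A) + dv * \<phi> (E * B' + E' * B)"
    unfolding pq psubst_add psubst_mult[of _ "pconst (1 / 2) * qb"] b
    by (simp add: psubst_mult phi_quadrics algebra_simps)
  moreover have "Inv (E * E' + qa * (A * A') + qc * (B * B') + (pconst (1 / 2) * qb) * (A * B' + A' * B))"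
    "Inv (E * A' + E' * A)" "Inv (E * B' + E' * B)"
    by (intro Inv_closed * Inv_qa Inv_qb Inv_qc)+
  ultimately show ?case by blast
qed

lemma du_neq_0: "du \<noteq> (0 :: (2, 'k::field_char_0) xy_poly)"
  and dv_neq_0: "dv \<noteq> (0 :: (2, 'k) xy_poly)"
proof -
  let ?\<rho> = "case_xy (\<lambda>i. if i = 1 then 2 else 0) (\<lambda>i. if i = 1 then 2 else 0) :: 2 xy \<Rightarrow> 'k"
  have "ev ?\<rho> du = 1" "ev ?\<rho> dv = 1" by (simp_all add: du_def dv_def ev_simps)
  then show "du \<noteq> (0 :: (2, 'k) xy_poly)" "dv \<noteq> (0 :: (2, 'k) xy_poly)" by (auto simp: ev_0)
qed

text \<open>\<open>du\<close> and \<open>dv\<close> form a regular sequence. The substitution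
  \<open>\<sigma>\<close> replaces both diagonal entries of \<open>Y\<close> by their mean: it kills
  \<open>dv\<close>, fixes \<open>du\<close>, and changes any polynomial by a multiple of
  \<open>dv\<close>.\<close>

lemma du_dv_syzygy:
  fixes p q :: "(2, 'k::field_char_0) xy_poly"
  assumes "p * du + q * dv = 0"
  obtains r where "p = dv * r" "q = - (du * r)"
proof -
  define \<sigma> :: "2 xy \<Rightarrow> (2, 'k) xy_poly" where "\<sigma> = (\<lambda>v. case v of XVar i \<Rightarrow> pvar (XVar i)
    | YVar i \<Rightarrow> pconst (1 / 2) * (pvar (YVar 1) + pvar (YVar 2)))"
  have "\<exists>r. p - psubst \<sigma> p = dv * r" for p
  proof (induction p rule: xy_poly_induct)
    case (const c)
    show ?case by (rule exI[of _ 0]) (simp add: psubst_simps)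
  next
    case (var v)
    show ?case
    proof (cases v)
      case (XVar i)
      show ?thesis by (rule exI[of _ 0]) (simp add: psubst_simps XVar \<sigma>_def)
    next
      case (YVar i)
      have "pvar (YVar i) - psubst \<sigma> (pvar (YVar i)) = dv * (if i = 1 then 1 else - 1)"
        using exhaust_2[of i] half_add_half[of "pvar (YVar 1) :: (2, 'k) xy_poly"]
          half_add_half[of "pvar (YVar 2) :: (2, 'k) xy_poly"]
        by (auto simp: psubst_simps \<sigma>_def dv_def algebra_simps)
      then show ?thesis unfolding YVar by blast
    qed
  next
    case (add p q)
    then obtain r s where "p - psubst \<sigma> p = dv * r" "q - psubst \<sigma> q = dv * s" by blast
    then have "p + q - psubst \<sigma> (p + q) = dv * (r + s)"
      by (simp add: psubst_simps algebra_simps)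
    then show ?case by blast
  next
    case (mult p q)
    then obtain r s where rs: "p - psubst \<sigma> p = dv * r" "q - psubst \<sigma> q = dv * s" by blast
    have "p * q - psubst \<sigma> (p * q) = (p - psubst \<sigma> p) * q + psubst \<sigma> p * (q - psubst \<sigma> q)"
      by (simp add: psubst_simps algebra_simps)
    also have "\<dots> = dv * (r * q + psubst \<sigma> p * s)"
      unfolding rs by (simp add: algebra_simps)
    finally show ?case by blast
  qed
  then obtain r where r: "p - psubst \<sigma> p = dv * r" by blast
  have "psubst \<sigma> du = du" "psubst \<sigma> dv = 0"
    by (simp_all add: du_def dv_def psubst_simps \<sigma>_def)
  then have "psubst \<sigma> p * du = 0"
    using arg_cong[OF assms, of "psubst \<sigma>"] by (simp add: psubst_simps)
  then have "psubst \<sigma> p = 0" using xy_poly_no_zero_divisors du_neq_0 by blast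
  then have p: "p = dv * r" using r by simp
  have "dv * (q + du * r) = 0" using assms unfolding p by (simp add: algebra_simps)
  then have "q + du * r = 0" using xy_poly_no_zero_divisors dv_neq_0 by blast
  then show thesis using that p by (simp add: eq_neg_iff_add_eq_0)
qed

text \<open>The two generators of the syzygies are the coordinates of the commutators of \<open>X0\<close> and of \<open>Y0\<close>
  with \<open>Mmat\<close>.\<close>

lemma invariant_syzygy:
  fixes \<alpha> \<beta> :: "'k::field_char_0 poly2"
  assumes inv: "Inv \<alpha>" "Inv \<beta>" and z: "\<phi> \<alpha> * du + \<phi> \<beta> * dv = 0"
  obtains A B where "Inv A" "Inv B" "\<alpha> = - (2 * qb * A) - 4 * qc * B" "\<beta> = 4 * qa * A + 2 * qb * B"
proof -
  obtain r where r: "\<phi> \<alpha> = dv * r" "\<phi> \<beta> = - (du * r)" using du_dv_syzygy[OF z] .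
  obtain E A B where EAB: "Inv E" "Inv A" "Inv B" and r': "r = \<phi> E + du * \<phi> A + dv * \<phi> B"
    using phi_decomposition by blast
  have e: "dv * \<phi> E = \<phi> \<alpha> - dv * du * \<phi> A - dv * dv * \<phi> B"
    unfolding r r' by (simp add: algebra_simps)
  \<comment> \<open>By \<open>e\<close> the product \<open>dv * \<phi> E\<close> is a sum of even
    terms, yet it is an odd factor times an even one, so it vanishes.\<close>
  have "psubst swap_subst (dv * \<phi> E) = dv * \<phi> E"
    unfolding e by (simp add: psubst_diff psubst_mult swap_phi inv EAB swap_du swap_dv)
  then have "dv * \<phi> E + dv * \<phi> E = 0"
    by (simp add: psubst_mult swap_phi EAB swap_dv)
  then have "\<phi> E = 0" using double_eq_0 xy_poly_no_zero_divisors dv_neq_0 by blast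
  \<comment> \<open>\<open>2 * qb\<close> and \<open>4 * qc\<close> restrict to
    \<open>4 * du * dv\<close> and \<open>4 * dv * dv\<close>, and both occur with a minus sign;
    hence the factor \<open>- 1 / 4\<close>.\<close>
  define A' B' where "A' = pconst (- 1 / 4) * A" and "B' = pconst (- 1 / 4) * B"
  have m4: "4 * (pconst (- 1 / 4) * p) = - p" for p :: "(2, 'k) xy_poly"
  proof -
    have "4 * (pconst (- 1 / 4) * p) = pconst (4 * (- 1 / 4)) * p"
      unfolding pconst_simps(4) pconst_numeral by (simp add: mult.assoc)
    then show ?thesis by (simp add: pconst_simps)
  qed
  have AB': "Inv A'" "Inv B'" "4 * \<phi> A' = - \<phi> A" "4 * \<phi> B' = - \<phi> B"
    unfolding A'_def B'_def psubst_mult psubst_pconst m4 by (simp_all add: Inv_closed EAB)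
  have \<alpha>: "\<phi> (\<alpha> + 2 * qb * A' + 4 * qc * B') = 0"
  proof -
    have "\<phi> (\<alpha> + 2 * qb * A' + 4 * qc * B') = \<phi> \<alpha> + du * dv * (4 * \<phi> A') + dv * dv * (4 * \<phi> B')"
      by (simp add: psubst_simps phi_quadrics algebra_simps)
    then show ?thesis unfolding AB' r r' by (simp add: \<open>\<phi> E = 0\<close> algebra_simps)
  qed
  have \<beta>: "\<phi> (\<beta> - 4 * qa * A' - 2 * qb * B') = 0"
  proof -
    have "\<phi> (\<beta> - 4 * qa * A' - 2 * qb * B') = \<phi> \<beta> - du * du * (4 * \<phi> A') - du * dv * (4 * \<phi> B')"
      by (simp add: psubst_simps phi_quadrics algebra_simps)
    then show ?thesis unfolding AB' r r' by (simp add: \<open>\<phi> E = 0\<close> algebra_simps)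
  qed
  have inv': "Inv (\<alpha> + 2 * qb * A' + 4 * qc * B')" "Inv (\<beta> - 4 * qa * A' - 2 * qb * B')"
    by (intro Inv_closed AB' inv Inv_qa Inv_qb Inv_qc)+
  obtain a where a: "Inv a" "\<alpha> + 2 * qb * A' + 4 * qc * B' = Disc * a"
    using phi_eq_0_Disc_dvd[OF inv'(1) \<alpha>] .
  obtain b where b: "Inv b" "\<beta> - 4 * qa * A' - 2 * qb * B' = Disc * b"
    using phi_eq_0_Disc_dvd[OF inv'(2) \<beta>] .
  let ?h = "pconst (1 / 2) :: 'k poly2"
  have h2: "2 * (?h * p) = p" "4 * (?h * p) = 2 * p" for p
  proof -
    show "2 * (?h * p) = p" unfolding mult_2 by (rule half_add_half)
    moreover have "4 * (?h * p) = 2 * (2 * (?h * p))" by simp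
    ultimately show "4 * (?h * p) = 2 * p" by (simp only:)
  qed
  show thesis
  proof
    \<comment> \<open>The corrections absorb \<open>Disc * a\<close> and \<open>Disc * b\<close>:
      the matrix taking \<open>(A, B)\<close> to \<open>(\<alpha>, \<beta>)\<close> squares to
      \<open>4 Disc\<close>, so a quarter of its value at \<open>(a, b)\<close> is added to
      \<open>(A', B')\<close>.\<close>
    show "Inv (A' - ?h * (qb * a) - qc * b)" "Inv (B' + qa * a + ?h * (qb * b))"
      by (intro Inv_closed AB' a b Inv_qa Inv_qb Inv_qc)+
    have "\<alpha> = Disc * a - 2 * qb * A' - 4 * qc * B'" using a(2) by (simp add: algebra_simps)
    also have "\<dots> = qb * (qb * a) - 4 * qa * qc * a - 2 * qb * A' - 4 * qc * B'"
      by (simp add: Disc_def algebra_simps)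
    also have "\<dots> = qb * (2 * (?h * (qb * a))) - 4 * qa * qc * a - 2 * qb * A' - 4 * qc * B' +
        2 * qb * (qc * b) - qc * (4 * (?h * (qb * b)))"
      unfolding h2 by (simp add: algebra_simps)
    also have "\<dots> = - (2 * qb * (A' - ?h * (qb * a) - qc * b)) - 4 * qc * (B' + qa * a + ?h * (qb * b))"
      by (simp add: algebra_simps)
    finally show "\<alpha> = \<dots>" .
    have "\<beta> = Disc * b + 4 * qa * A' + 2 * qb * B'" using b(2) by (simp add: algebra_simps)
    also have "\<dots> = qb * (qb * b) - 4 * qa * qc * b + 4 * qa * A' + 2 * qb * B'"
      by (simp add: Disc_def algebra_simps)
    also have "\<dots> = qb * (2 * (?h * (qb * b))) - 4 * qa * qc * b + 4 * qa * A' + 2 * qb * B' +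
        2 * qb * (qa * a) - qa * (4 * (?h * (qb * a)))"
      unfolding h2 by (simp add: algebra_simps)
    also have "\<dots> = 4 * qa * (A' - ?h * (qb * a) - qc * b) + 2 * qb * (B' + qa * a + ?h * (qb * b))"
      by (simp add: algebra_simps)
    finally show "\<beta> = \<dots>" .
  qed
qed

subsection \<open>Cycles and boundaries of the invariant subalgebra\<close>

definition GL_inv :: "'k::field gca2 \<Rightarrow> bool" where
  "GL_inv F \<longleftrightarrow> (\<forall>g. invertible g \<longrightarrow> conj_action g F = F)"

lemma GL_inv_form:
  fixes p :: "'k::field_char_0 poly2"
  assumes "Inv p" "Cov W" "Cov V" "Inv q" "trace W = 0" "trace V = 0"
  shows "GL_inv (form p W V q)" "GL_inv (tt * form p W V q)"
proof -
  have z: "Inv (0 :: 'k poly2)" "Cov (0 :: 'k poly2 mat2)" "trace 0 = (0 :: 'k poly2)" "form 0 0 0 0 = (0 :: 'k gca2)"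
    using Cov_mat[OF Inv_closed(2)]
    by (simp_all add: Inv_closed trace_def form_def ctr_def of_poly_simps mat_0)
  show "GL_inv (form p W V q)" "GL_inv (tt * form p W V q)"
    using conj_action_fix_iff[of W V 0 0 p q 0 0] conj_action_fix_iff[of 0 0 W V 0 0 p q] assms z
    unfolding GL_inv_def by simp_all
qed

lemma GL_inv_add: "GL_inv F \<Longrightarrow> GL_inv G \<Longrightarrow> GL_inv (F + G)"
  and GL_inv_diff: "GL_inv F \<Longrightarrow> GL_inv G \<Longrightarrow> GL_inv (F - G)"
  by (simp_all add: GL_inv_def conj_action_simps)

lemma GL_inv_0: "GL_inv 0"
  by (simp add: GL_inv_def conj_action_eq gca_hom_0)

lemma trace_commutator: "trace (V ** W - W ** V) = (0 :: 'k::comm_ring_1)"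
  by (simp add: trace_sub trace_mul_sym[of V])

lemma trace_neg: "trace (- W) = - trace (W :: 'k::comm_ring_1 mat2)"
  by (simp add: trace_def sum_2)

lemma tt_form_uminus: "- (tt * form p W V q) = tt * form (- p) (- W) (- V) (- q)"
  by (simp add: form_def ctr_def sum_2 of_poly_simps algebra_simps)

lemma GL_inv_cycle:
  fixes z :: "'k::field_char_0 gca2"
  assumes "GL_inv z" "dd z = 0"
  obtains p \<alpha> \<beta> \<gamma> p' \<alpha>' \<beta>' \<gamma>' where
    "Inv p" "Inv \<alpha>" "Inv \<beta>" "Inv \<gamma>" "Inv p'" "Inv \<alpha>'" "Inv \<beta>'" "Inv \<gamma>'"
    "z = form p (mat \<alpha> ** X0 + mat \<beta> ** Y0) (mat \<gamma> ** Mmat) 0 +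
      tt * form p' (mat \<alpha>' ** X0 + mat \<beta>' ** Y0) (mat \<gamma>' ** Mmat) 0"
proof -
  obtain p W V q p' W' V' q' where z: "z = form p W V q + tt * form p' W' V' q'"
    and t: "trace W = 0" "trace V = 0" "trace W' = 0" "trace V' = 0" by (rule form_spans)
  have inv: "Inv p" "Cov W" "Cov V" "Inv q" "Inv p'" "Cov W'" "Cov V'" "Inv q'"
    using assms(1) conj_action_fix_iff[OF t, of p q p' q'] unfolding GL_inv_def z by blast+
  have "form (trace (W ** Mmat)) (V ** Mmat - Mmat ** V) (mat q ** Mmat) 0 +
      tt * form (- trace (W' ** Mmat)) (- (V' ** Mmat - Mmat ** V')) (- (mat q' ** Mmat)) (- 0) = 0"
    using assms(2) unfolding z tt_form_uminus[symmetric] by (simp add: dd_linear dd_tt_mult dd_form t)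
  from form_eq_0[OF this]
  have e: "trace (W ** Mmat) = 0" "V ** Mmat - Mmat ** V = 0" "mat q ** Mmat = 0"
    "trace (W' ** Mmat) = 0" "V' ** Mmat - Mmat ** V' = 0" "mat q' ** Mmat = 0"
    by (simp_all add: trace_commutator trace_neg trace_smult trace_Mmat)
  obtain \<alpha> \<beta> \<gamma> where 1: "Inv \<alpha>" "Inv \<beta>" "Inv \<gamma>" "W = mat \<alpha> ** X0 + mat \<beta> ** Y0" "V = mat \<gamma> ** Mmat" "q = 0"
    using cycle_components[OF inv(2) t(1) e(1) inv(3) t(2) e(2,3)] .
  obtain \<alpha>' \<beta>' \<gamma>' where 2: "Inv \<alpha>'" "Inv \<beta>'" "Inv \<gamma>'" "W' = mat \<alpha>' ** X0 + mat \<beta>' ** Y0"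
      "V' = mat \<gamma>' ** Mmat" "q' = 0"
    using cycle_components[OF inv(6) t(3) e(4) inv(7) t(4) e(5,6)] .
  show thesis using that[OF inv(1) 1(1-3) inv(5) 2(1-3)] z 1(4-6) 2(4-6) by simp
qed

lemma combination_X0_Y0:
  fixes \<alpha> \<beta> :: "'k::field_char_0 poly2"
  assumes "Inv \<alpha>" "Inv \<beta>"
  shows "Cov (mat \<alpha> ** X0 + mat \<beta> ** Y0)" "trace (mat \<alpha> ** X0 + mat \<beta> ** Y0) = 0"
    "trace ((mat \<alpha> ** X0 + mat \<beta> ** Y0) ** Mmat) = 0"
    "\<phi> ((mat \<alpha> ** X0 + mat \<beta> ** Y0) $ 1 $ 1) = \<phi> \<alpha> * du + \<phi> \<beta> * dv"
proof -
  have "mat \<alpha> ** X0 + mat \<beta> ** Y0 = mat \<alpha> ** X0 + mat \<beta> ** Y0 + mat 0 ** Mmat"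
    by (rule mat2_eqI) (simp_all add: matrix_matrix_mult_def sum_2 mat_def)
  then show "Cov (mat \<alpha> ** X0 + mat \<beta> ** Y0)" "trace (mat \<alpha> ** X0 + mat \<beta> ** Y0) = 0"
    using covariant_combination[OF assms Inv_closed(2)] by simp_all
  have "trace ((mat \<alpha> ** X0 + mat \<beta> ** Y0) ** Mmat) = \<alpha> * trace (X0 ** Mmat) + \<beta> * trace (Y0 ** Mmat)"
    by (simp add: trace_def sum_2 matrix_matrix_mult_def mat_def algebra_simps)
  then show "trace ((mat \<alpha> ** X0 + mat \<beta> ** Y0) ** Mmat) = 0"
    by (simp add: trace_X0_Mmat trace_Y0_Mmat)
  show "\<phi> ((mat \<alpha> ** X0 + mat \<beta> ** Y0) $ 1 $ 1) = \<phi> \<alpha> * du + \<phi> \<beta> * dv"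
    by (simp add: X0_eq Y0_eq mat2_simps psubst_simps phi_vars)
qed

lemma combination_Mmat:
  fixes \<gamma> :: "'k::field_char_0 poly2"
  assumes "Inv \<gamma>"
  shows "Cov (mat \<gamma> ** Mmat)" "trace (mat \<gamma> ** Mmat) = 0"
  using assms by (simp_all add: Cov_mult Cov_mat Cov_Mmat trace_smult trace_Mmat)

lemma Cov_0: "Cov 0" and trace_zero: "trace (0 :: 'k::field poly2 mat2) = 0"
  using Cov_mat[OF Inv_closed(2)] by (simp_all add: mat_0 trace_def)

text \<open>The three components are hit separately: \<open>p = Disc * r\<close> by half of
  \<open>r Mmat\<close>, whose trace against \<open>Mmat\<close> is \<open>Disc * r\<close>; the
  syzygy by commutators with \<open>Mmat\<close>; and \<open>\<gamma> Mmat\<close> by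
  \<open>\<gamma>\<close> times the top word \<open>hh * (ee * ff)\<close>.\<close>

lemma form_boundary:
  fixes p \<alpha> \<beta> \<gamma> :: "'k::field_char_0 poly2"
  assumes inv: "Inv p" "Inv \<alpha>" "Inv \<beta>" "Inv \<gamma>" and p: "\<phi> p = 0" and \<alpha>\<beta>: "\<phi> \<alpha> * du + \<phi> \<beta> * dv = 0"
  obtains W V q where "Cov W" "Cov V" "Inv q" "trace W = 0" "trace V = 0"
    "dd (form 0 W V q) = form p (mat \<alpha> ** X0 + mat \<beta> ** Y0) (mat \<gamma> ** Mmat) 0"
proof -
  obtain r where r: "Inv r" "p = Disc * r" using phi_eq_0_Disc_dvd[OF inv(1) p] .
  obtain A B where AB: "Inv A" "Inv B" "\<alpha> = - (2 * qb * A) - 4 * qc * B" "\<beta> = 4 * qa * A + 2 * qb * B"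
    using invariant_syzygy[OF inv(2,3) \<alpha>\<beta>] .
  let ?W = "mat (pconst (1 / 2) * r) ** Mmat" and ?V = "mat A ** X0 + mat B ** Y0"
  have W: "Cov ?W" "trace ?W = 0" and V: "Cov ?V" "trace ?V = 0"
    using combination_Mmat[of "pconst (1 / 2) * r"] combination_X0_Y0 AB r by (simp_all add: Inv_closed)
  have "trace (?W ** Mmat) = pconst (1 / 2) * (Disc * r) + pconst (1 / 2) * (Disc * r)"
    by (simp add: matrix_mul_assoc[symmetric] trace_smult trace_Mmat_Mmat algebra_simps)
  then have 1: "trace (?W ** Mmat) = p" by (simp only: half_add_half r)
  have "?V = mat A ** X0 + mat B ** Y0 + mat 0 ** Mmat"
    by (rule mat2_eqI) (simp_all add: matrix_matrix_mult_def sum_2 mat_def)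
  then have 2: "?V ** Mmat - Mmat ** ?V = mat \<alpha> ** X0 + mat \<beta> ** Y0"
    unfolding AB(3,4) using commutator_combination[of A B 0] by simp
  show thesis
  proof
    show "dd (form 0 ?W ?V \<gamma>) = form p (mat \<alpha> ** X0 + mat \<beta> ** Y0) (mat \<gamma> ** Mmat) 0"
      unfolding dd_form[OF W(2) V(2)] 1 2 ..
  qed (use W V inv in simp_all)
qed

section \<open>Comparison of coefficients in the diagonal algebra\<close>

lemma diag_product: "(\<theta> 1 + \<theta> 2) * (\<theta> 1 - \<theta> 2) = - (\<theta> 1 * \<theta> 2 + \<theta> 1 * (\<theta> 2 :: (2, 'k::comm_ring_1) gca))"
  using theta_anticommute[of "2 :: 2" 1, where 'k = 'k] by (simp add: algebra_simps theta_square)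

lemma coef_theta_12:
  obtains c where "c = 1 \<or> c = - 1" "coef (\<theta> 1 * \<theta> 2 :: (2, 'k::field_char_0) gca) UNIV = c"
proof -
  have "UNIV - {1} = {2 :: 2}" unfolding UNIV_2 by auto
  then show thesis
    using that koszul_sign_cases[of "{1 :: 2}" "{2}", where 'a = "(2, 'k) xy_poly"]
    by (auto simp: coef_theta_mult coef_simps)
qed

text \<open>The coefficients at 1, \<open>\<theta> 1\<close>, \<open>\<theta> 2\<close> and
  \<open>\<theta> 1 * \<theta> 2\<close> are \<open>a\<close>, \<open>b + c\<close>,
  \<open>c - b\<close> and \<open>- 2 d\<close>, which can be solved as 2 is invertible.\<close>

lemma diag_independent:
  fixes a b c d :: "(2, 'k::field_char_0) xy_poly"
  assumes "of_poly a + of_poly b * (\<theta> 1 - \<theta> 2) + (\<theta> 1 + \<theta> 2) * (of_poly c + of_poly d * (\<theta> 1 - \<theta> 2)) = 0"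
  shows "a = 0" "b = 0" "c = 0" "d = 0"
proof -
  have z: "of_poly a + of_poly b * (\<theta> 1 - \<theta> 2) + of_poly c * (\<theta> 1 + \<theta> 2) -
      of_poly (d + d) * (\<theta> 1 * \<theta> 2) = 0" (is "?F = 0")
  proof -
    have "(\<theta> 1 + \<theta> 2) * (of_poly c + of_poly d * (\<theta> 1 - \<theta> 2)) =
        of_poly c * (\<theta> 1 + \<theta> 2) + of_poly d * ((\<theta> 1 + \<theta> 2) * (\<theta> 1 - \<theta> 2))"
      by (simp only: distrib_left[of "\<theta> 1 + \<theta> 2"] of_poly_central[of "\<theta> 1 + \<theta> 2"] mult_of_poly_left_commute)
    also have "\<dots> = of_poly c * (\<theta> 1 + \<theta> 2) - of_poly (d + d) * (\<theta> 1 * \<theta> 2)"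
      unfolding diag_product of_poly_simps(3) by (simp add: algebra_simps)
    finally show ?thesis using assms by (simp only: add_diff_eq)
  qed
  have ne: "(UNIV :: 2 set) \<noteq> {1}" "(UNIV :: 2 set) \<noteq> {2}" "(UNIV :: 2 set) \<noteq> {}"
    using two_neq_one by blast+
  have T: "coef (\<theta> 1 * \<theta> 2 :: (2, 'k) gca) {} = 0" "coef (\<theta> 1 * \<theta> 2 :: (2, 'k) gca) {1} = 0"
    "coef (\<theta> 1 * \<theta> 2 :: (2, 'k) gca) {2} = 0"
    by (simp_all add: coef_theta_mult coef_simps)
  have "coef ?F {} = 0" "coef ?F {1} = 0" "coef ?F {2} = 0" "coef ?F UNIV = 0"
    unfolding z by (simp_all add: coef_simps)
  note this[unfolded coef_simps coef_of_poly_mult T]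
  then have a: "a = 0" and 1: "b + c = 0" and 2: "- b + c = 0"
    and 3: "(d + d) * coef (\<theta> 1 * \<theta> 2 :: (2, 'k) gca) UNIV = 0"
    using ne by (auto simp: coef_simps)
  have "c + c = (b + c) + (- b + c)" by simp
  then have "c = 0" using double_eq_0[of c] unfolding 1 2 by simp
  obtain e :: "(2, 'k) xy_poly" where e: "e = 1 \<or> e = - 1" "coef (\<theta> 1 * \<theta> 2 :: (2, 'k) gca) UNIV = e"
    by (rule coef_theta_12)
  have "d + d = 0"
    using e(1) 3[unfolded e(2)]
    by (elim disjE) (simp_all only: mult_1_right mult_minus1_right neg_equal_0_iff_equal)
  then show "a = 0" "b = 0" "c = 0" "d = 0" using a 1 \<open>c = 0\<close> by (simp_all add: double_eq_0)
qed

lemma GL_inv_boundary: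
  fixes z :: "'k::field_char_0 gca2"
  assumes "GL_inv z" "dd z = 0" "\<Phi> z = 0"
  obtains w where "GL_inv w" "dd w = z"
proof -
  obtain p \<alpha> \<beta> \<gamma> p' \<alpha>' \<beta>' \<gamma>' where
    inv: "Inv p" "Inv \<alpha>" "Inv \<beta>" "Inv \<gamma>" and inv': "Inv p'" "Inv \<alpha>'" "Inv \<beta>'" "Inv \<gamma>'" and
    z: "z = form p (mat \<alpha> ** X0 + mat \<beta> ** Y0) (mat \<gamma> ** Mmat) 0 +
      tt * form p' (mat \<alpha>' ** X0 + mat \<beta>' ** Y0) (mat \<gamma>' ** Mmat) 0"
    using GL_inv_cycle[OF assms(1,2)] .
  have "of_poly (\<phi> p) + of_poly (\<phi> \<alpha> * du + \<phi> \<beta> * dv) * (\<theta> 1 - \<theta> 2) +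
      (\<theta> 1 + \<theta> 2) * (of_poly (\<phi> p') + of_poly (\<phi> \<alpha>' * du + \<phi> \<beta>' * dv) * (\<theta> 1 - \<theta> 2)) = 0"
    using assms(3) unfolding z Phi_simps Phi_mult Phi_basis
    by (simp only: Phi_form[OF combination_X0_Y0(2) combination_Mmat(2)] inv inv' combination_X0_Y0(4))
  note e = diag_independent[OF this]
  obtain W V q where 1: "Cov W" "Cov V" "Inv q" "trace W = 0" "trace V = 0"
    "dd (form 0 W V q) = form p (mat \<alpha> ** X0 + mat \<beta> ** Y0) (mat \<gamma> ** Mmat) 0"
    using form_boundary[OF inv e(1,2)] .
  obtain W' V' q' where 2: "Cov W'" "Cov V'" "Inv q'" "trace W' = 0" "trace V' = 0"
    "dd (form 0 W' V' q') = form p' (mat \<alpha>' ** X0 + mat \<beta>' ** Y0) (mat \<gamma>' ** Mmat) 0"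
    using form_boundary[OF inv' e(3,4)] .
  show thesis
  proof
    \<comment> \<open>The minus sign offsets the one that arises when the differential passes
      \<open>tt\<close>.\<close>
    show "GL_inv (form 0 W V q - tt * form 0 W' V' q')"
      by (intro GL_inv_diff GL_inv_form Inv_closed 1 2)
    show "dd (form 0 W V q - tt * form 0 W' V' q') = z"
      by (simp add: dd_linear dd_tt_mult 1 2 z)
  qed
qed

subsection \<open>Symmetric elements of the diagonal algebra\<close>

lemma perm_action_eq: "perm_action \<pi> = gca_hom (\<lambda>v. case v of XVar i \<Rightarrow> pvar (XVar (\<pi> i)) | YVar i \<Rightarrow> pvar (YVar (\<pi> i)))
    (\<lambda>i. \<theta> (\<pi> i))"
  by (simp add: perm_action_def)

lemma perm_action_mult:
  "perm_action \<pi> (F * G) = perm_action \<pi> F * perm_action \<pi> (G :: (2, 'k::field_char_0) gca)"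
  unfolding perm_action_eq by (rule gca_hom_mult) (rule homogeneous_closed)

lemma psubst_pvar_id: "psubst pvar p = p"
  by (induction p rule: xy_poly_induct) (simp_all add: psubst_simps)

lemma perm_2:
  fixes \<pi> :: "2 \<Rightarrow> 2"
  assumes "bij \<pi>"
  shows "\<pi> 1 = 1 \<and> \<pi> 2 = 2 \<or> \<pi> 1 = 2 \<and> \<pi> 2 = 1"
  using bij_is_inj[OF assms, THEN injD, of 1 2] exhaust_2[of "\<pi> 1"] exhaust_2[of "\<pi> 2"] by auto

definition swap2 :: "2 \<Rightarrow> 2" where "swap2 i = (if i = 1 then 2 else 1)"

lemma bij_swap2: "bij swap2"
  by (rule o_bij[of swap2]) (simp_all add: fun_eq_iff forall_2 swap2_def)

lemma perm_action_swap_simps: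
  "perm_action swap2 (F + G) = perm_action swap2 F + perm_action swap2 (G :: (2, 'k::field) gca)"
  "perm_action swap2 (F - G) = perm_action swap2 F - perm_action swap2 (G :: (2, 'k::field) gca)"
  "perm_action swap2 (of_poly p * F) = of_poly (psubst swap_subst p) * perm_action swap2 (F :: (2, 'k::field) gca)"
  "perm_action swap2 (of_poly p :: (2, 'k::field) gca) = of_poly (psubst swap_subst p)"
  "perm_action swap2 (\<theta> 1) = (\<theta> 2 :: (2, 'k::field) gca)" "perm_action swap2 (\<theta> 2) = (\<theta> 1 :: (2, 'k::field) gca)"
proof -
  have "(\<lambda>v. case v of XVar i \<Rightarrow> pvar (XVar (swap2 i)) | YVar i \<Rightarrow> pvar (YVar (swap2 i))) =
      (swap_subst :: 2 xy \<Rightarrow> (2, 'k) xy_poly)"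
    by (auto simp: swap_subst_def swap2_def fun_eq_iff split: xy.split)
  then have e: "perm_action swap2 = gca_hom (swap_subst :: 2 xy \<Rightarrow> (2, 'k) xy_poly) (\<lambda>i. \<theta> (swap2 i))"
    by (simp add: perm_action_eq)
  show "perm_action swap2 (F + G) = perm_action swap2 F + perm_action swap2 (G :: (2, 'k) gca)"
    "perm_action swap2 (F - G) = perm_action swap2 F - perm_action swap2 (G :: (2, 'k) gca)"
    "perm_action swap2 (of_poly p * F) = of_poly (psubst swap_subst p) * perm_action swap2 (F :: (2, 'k) gca)"
    "perm_action swap2 (of_poly p :: (2, 'k) gca) = of_poly (psubst swap_subst p)"
    unfolding e by (rule gca_hom_add gca_hom_diff gca_hom_of_poly_mult gca_hom_of_poly)+
  show "perm_action swap2 (\<theta> 1) = (\<theta> 2 :: (2, 'k) gca)" "perm_action swap2 (\<theta> 2) = (\<theta> 1 :: (2, 'k) gca)"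
    unfolding e gca_hom_theta by (simp_all add: swap2_def)
qed

lemma symmetric_iff:
  fixes F :: "(2, 'k::field_char_0) gca"
  shows "(\<forall>\<pi>. bij \<pi> \<longrightarrow> perm_action \<pi> F = F) \<longleftrightarrow> perm_action swap2 F = F"
proof
  assume s: "perm_action swap2 F = F"
  show "\<forall>\<pi>. bij \<pi> \<longrightarrow> perm_action \<pi> F = F"
  proof (intro allI impI)
    fix \<pi> :: "2 \<Rightarrow> 2" assume "bij \<pi>"
    from perm_2[OF this] show "perm_action \<pi> F = F"
    proof
      assume "\<pi> 1 = 1 \<and> \<pi> 2 = 2"
      then have \<pi>: "\<pi> i = i" for i using exhaust_2[of i] by auto
      have "(\<lambda>v. case v of XVar i \<Rightarrow> pvar (XVar (\<pi> i)) | YVar i \<Rightarrow> pvar (YVar (\<pi> i))) =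
          (pvar :: 2 xy \<Rightarrow> (2, 'k) xy_poly)"
        by (auto simp: \<pi> fun_eq_iff split: xy.split)
      then have e: "perm_action \<pi> F = gca_hom pvar \<theta> F" by (simp add: perm_action_eq \<pi>)
      show ?thesis unfolding e
      proof (induction F rule: gca_induct)
        case (theta i f)
        then show ?case using gca_hom_theta_mult[of \<theta> pvar i f] homogeneous_closed(8) by metis
      qed (simp_all add: gca_hom_1 gca_hom_add gca_hom_of_poly_mult psubst_pvar_id)
    next
      assume "\<pi> 1 = 2 \<and> \<pi> 2 = 1"
      then have "\<pi> i = swap2 i" for i using exhaust_2[of i] by (auto simp: swap2_def)
      then have "\<pi> = swap2" by blast
      then show ?thesis using s by simp
    qed
  qed
qed (use bij_swap2 in blast)

text \<open>The coefficient \<open>\<phi> (W $ 1 $ 1)\<close> is a combination of \<open>du\<close>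
  and \<open>dv\<close>, hence odd, and so is \<open>\<theta> 1 - \<theta> 2\<close>; their product
  is symmetric.\<close>

lemma Phi_symmetric:
  fixes F :: "'k::field_char_0 gca2"
  assumes "GL_inv F"
  shows "perm_action swap2 (\<Phi> F) = \<Phi> F"
proof -
  obtain p W V q p' W' V' q' where F: "F = form p W V q + tt * form p' W' V' q'"
    and t: "trace W = 0" "trace V = 0" "trace W' = 0" "trace V' = 0" by (rule form_spans)
  have inv: "Inv p" "Cov W" "Inv p'" "Cov W'"
    using assms conj_action_fix_iff[OF t, of p q p' q'] unfolding GL_inv_def F by blast+
  have anti: "psubst swap_subst (\<phi> (W $ 1 $ 1)) = - \<phi> (W $ 1 $ 1)"
    if W: "Cov W" "trace W = 0" for W :: "'k poly2 mat2"
  proof -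
    obtain \<alpha> \<beta> \<gamma> where "Inv \<alpha>" "Inv \<beta>" "W = mat \<alpha> ** X0 + mat \<beta> ** Y0 + mat \<gamma> ** Mmat"
      using covariant_expansion[OF W] by metis
    moreover from this have "\<phi> (W $ 1 $ 1) = \<phi> \<alpha> * du + \<phi> \<beta> * dv"
      by (simp add: X0_eq Y0_eq Mmat_eq mat2_simps psubst_simps phi_vars)
    ultimately show ?thesis by (simp add: psubst_simps swap_phi swap_du swap_dv)
  qed
  show ?thesis
    unfolding F Phi_simps Phi_mult Phi_basis Phi_form[OF t(1,2)] Phi_form[OF t(3,4)]
    by (simp add: perm_action_swap_simps perm_action_mult anti inv t swap_phi of_poly_simps algebra_simps)
qed

lemma diag_expansion:
  fixes F :: "(2, 'k::field_char_0) gca"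
  shows "F = of_poly (coef F {}) + (of_poly (coef F {1}) * \<theta> 1 + of_poly (coef F {2}) * \<theta> 2) +
    of_poly (coef F UNIV) * \<theta>set UNIV"
proof (rule gca_eqI)
  fix S :: "2 set"
  have "S \<in> Pow {1, 2}" using exhaust_2 by blast
  then have "S \<in> {{}, {1}, {2}, UNIV}" unfolding UNIV_2 by (simp add: Pow_insert) blast
  moreover have "(UNIV :: 2 set) \<noteq> {1}" "(UNIV :: 2 set) \<noteq> {2}" "(UNIV :: 2 set) \<noteq> {}"
    using two_neq_one by blast+
  ultimately show "coef F S = coef (of_poly (coef F {}) + (of_poly (coef F {1}) * \<theta> 1 + of_poly (coef F {2}) * \<theta> 2) +
    of_poly (coef F UNIV) * \<theta>set UNIV) S"
    by (auto simp: coef_simps coef_of_poly_mult \<theta>set_def)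
qed

lemma theta_12:
  obtains c :: "(2, 'k::field_char_0) xy_poly" where "c = 1 \<or> c = - 1"
    "\<theta>set UNIV = of_poly c * (\<theta> 1 * \<theta> 2 :: (2, 'k) gca)"
proof -
  have "\<theta>set (insert 1 {2}) = of_poly (koszul_sign {1 :: 2} {2}) * (\<theta> 1 * \<theta>set {2} :: (2, 'k) gca)"
    by (rule \<theta>set_insert) simp
  moreover have "\<theta>set {2} = (\<theta> 2 :: (2, 'k) gca)" by (simp add: \<theta>_def \<theta>set_def)
  moreover have "insert 1 {2} = (UNIV :: 2 set)" unfolding UNIV_2 by simp
  ultimately have "\<theta>set UNIV = of_poly (koszul_sign {1 :: 2} {2}) * (\<theta> 1 * \<theta> 2 :: (2, 'k) gca)" by simp
  then show thesis using that koszul_sign_cases by blast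
qed

text \<open>Closed because \<open>Mmat\<close> is orthogonal to \<open>X0\<close> and
  \<open>Y0\<close>; together with their multiples by \<open>tt\<close> these represent all homology
  classes.\<close>

lemma form_cycle:
  fixes p \<alpha> \<beta> :: "'k::field_char_0 poly2"
  assumes "Inv p" "Inv \<alpha>" "Inv \<beta>"
  defines "F \<equiv> form p (mat \<alpha> ** X0 + mat \<beta> ** Y0) 0 0"
  shows "GL_inv F" "GL_inv (tt * F)" "dd F = 0" "dd (tt * F) = 0"
    "\<Phi> F = of_poly (\<phi> p) + of_poly (\<phi> \<alpha> * du + \<phi> \<beta> * dv) * (\<theta> 1 - \<theta> 2)"
proof -
  note W = combination_X0_Y0[OF assms(2,3)]
  show "GL_inv F" "GL_inv (tt * F)"
    unfolding F_def by (intro GL_inv_form assms W Cov_0 trace_zero Inv_closed)+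
  have "mat 0 ** Mmat = (0 :: 'k poly2 mat2)" "0 ** Mmat - Mmat ** 0 = (0 :: 'k poly2 mat2)"
    by (rule mat2_eqI; simp add: matrix_matrix_mult_def sum_2 mat_def)+
  moreover have "form 0 0 0 0 = (0 :: 'k gca2)"
    by (simp add: form_def ctr_def of_poly_simps)
  ultimately show "dd F = 0"
    unfolding F_def dd_form[OF W(2) trace_zero] W(3) by simp
  then show "dd (tt * F) = 0" by (simp add: dd_tt_mult)
  show "\<Phi> F = of_poly (\<phi> p) + of_poly (\<phi> \<alpha> * du + \<phi> \<beta> * dv) * (\<theta> 1 - \<theta> 2)"
    unfolding F_def Phi_form[OF W(2) trace_zero] W(4) ..
qed

lemma ctr_Th_homogeneous: "ctr W Th \<in> homogeneous 1"
  unfolding ctr_def Th_def by (intro homogeneous_sum homogeneous_closed(4)) (simp add: homogeneous_closed del: One_nat_def)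

lemma form_homogeneous:
  fixes p :: "'k::field_char_0 poly2"
  shows "form p 0 0 0 \<in> homogeneous 0" "form 0 W 0 0 \<in> homogeneous 1"
proof -
  have "form p 0 0 0 = of_poly p" "form 0 W 0 0 = ctr W Th"
    by (simp_all add: form_def ctr_def of_poly_simps)
  then show "form p 0 0 0 \<in> homogeneous 0" "form 0 W 0 0 \<in> homogeneous 1"
    by (simp_all only: homogeneous_closed ctr_Th_homogeneous)
qed

text \<open>In a symmetric element the coefficient of 1 is even, those of \<open>\<theta> 1\<close>
  and \<open>\<theta> 2\<close> are exchanged, and that of their product is odd. Even parts lift to
  invariants, odd parts times \<open>\<theta> 1 - \<theta> 2\<close> lift to
  \<open>tr (W \<theta>)\<close>, and \<open>\<theta> 1 + \<theta> 2\<close> lifts to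
  \<open>tt\<close>.\<close>

lemma symmetric_lift:
  fixes F :: "(2, 'k::field_char_0) gca"
  assumes "perm_action swap2 F = F"
  obtains z0 z1 z2 where "GL_inv z0" "GL_inv z1" "GL_inv z2" "dd z0 = 0" "dd z1 = 0" "dd z2 = 0"
    "z0 \<in> homogeneous 0" "z1 \<in> homogeneous 1" "z2 \<in> homogeneous 2"
    "\<Phi> z0 = of_poly (coef F {})" "\<Phi> z1 = of_poly (coef F {1}) * \<theta> 1 + of_poly (coef F {2}) * \<theta> 2"
    "\<Phi> z2 = of_poly (coef F UNIV) * \<theta>set UNIV"
proof -
  let ?s = "psubst swap_subst :: (2, 'k) xy_poly \<Rightarrow> _"
  obtain c :: "(2, 'k) xy_poly" where c: "c = 1 \<or> c = - 1"
    "\<theta>set UNIV = of_poly c * (\<theta> 1 * \<theta> 2 :: (2, 'k) gca)" by (rule theta_12)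
  have sc: "?s c = c" using c(1) by (auto simp: psubst_simps)
  have s12: "perm_action swap2 (\<theta>set UNIV) = - (\<theta>set UNIV :: (2, 'k) gca)"
    unfolding c(2) perm_action_swap_simps perm_action_mult sc using theta_anticommute[of "2 :: 2" 1, where 'k = 'k]
    by simp
  have s: "F = of_poly (?s (coef F {})) + (of_poly (?s (coef F {2})) * \<theta> 1 + of_poly (?s (coef F {1})) * \<theta> 2) +
      of_poly (- ?s (coef F UNIV)) * \<theta>set UNIV" (is "_ = ?G")
  proof -
    have "F = perm_action swap2 (of_poly (coef F {}) + (of_poly (coef F {1}) * \<theta> 1 + of_poly (coef F {2}) * \<theta> 2) +
        of_poly (coef F UNIV) * \<theta>set UNIV)"
      using assms diag_expansion[of F] by simp
    also have "\<dots> = ?G"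
      by (simp add: perm_action_swap_simps s12 of_poly_simps algebra_simps)
    finally show ?thesis .
  qed
  have ne: "(UNIV :: 2 set) \<noteq> {1}" "(UNIV :: 2 set) \<noteq> {2}" "(UNIV :: 2 set) \<noteq> {}"
    using two_neq_one by blast+
  note cs = arg_cong[OF s, of "\<lambda>F. coef F S" for S]
  have s0: "?s (coef F {}) = coef F {}" and s1: "?s (coef F {1}) = coef F {2}"
    and s2': "coef F UNIV = - ?s (coef F UNIV)"
    using cs[of "{}"] cs[of "{2}"] cs[of UNIV] ne ne[symmetric]
    by (simp_all add: coef_simps coef_of_poly_mult \<theta>set_def)
  have s2: "?s (coef F UNIV) = - coef F UNIV" by (subst s2') simp
  have sd: "?s (\<phi> E + du * \<phi> A + dv * \<phi> B) = \<phi> E - du * \<phi> A - dv * \<phi> B"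
    if "Inv E" "Inv A" "Inv B" for E A B
    using that by (simp add: psubst_simps swap_phi swap_du swap_dv)
  have half: "x = 0" if "x = - x" for x :: "(2, 'k) xy_poly"
    using that double_eq_0[of x] by (simp add: eq_neg_iff_add_eq_0)
  obtain E0 A0 B0 where 0: "Inv E0" "Inv A0" "Inv B0" "coef F {} = \<phi> E0 + du * \<phi> A0 + dv * \<phi> B0"
    using phi_decomposition by blast
  have "du * \<phi> A0 + dv * \<phi> B0 = 0"
    using s0 sd[OF 0(1-3)] unfolding 0(4) by (intro half) (simp add: algebra_simps)
  then have F0: "coef F {} = \<phi> E0" unfolding 0(4) by (simp add: add.assoc)
  obtain E1 A1 B1 where 1: "Inv E1" "Inv A1" "Inv B1" "coef F {1} = \<phi> E1 + du * \<phi> A1 + dv * \<phi> B1"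
    using phi_decomposition by blast
  have F2: "coef F {2} = \<phi> E1 - du * \<phi> A1 - dv * \<phi> B1"
    using s1 sd[OF 1(1-3)] unfolding 1(4) by simp
  obtain E2 A2 B2 where 2: "Inv E2" "Inv A2" "Inv B2" "coef F UNIV = \<phi> E2 + du * \<phi> A2 + dv * \<phi> B2"
    using phi_decomposition by blast
  have "\<phi> E2 = 0"
    using s2 sd[OF 2(1-3)] unfolding 2(4) by (intro half) (simp add: algebra_simps)
  then have F12: "coef F UNIV = du * \<phi> A2 + dv * \<phi> B2" unfolding 2(4) by simp
  \<comment> \<open>\<open>k\<close> is \<open>- c / 2\<close>: it offsets the factor
    \<open>-2\<close> in \<open>diag_product\<close> and the sign \<open>c\<close> of the chosen
    basis product.\<close>
  define k :: "'k poly2" where "k = pconst (if c = 1 then - 1 / 2 else 1 / 2)"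
  have k: "Inv k" "\<phi> k + \<phi> k = - c"
  proof -
    show "Inv k" by (simp add: k_def Inv_closed)
    have "\<phi> k + \<phi> k = pconst ((if c = 1 then - 1 / 2 else 1 / 2) + (if c = 1 then - 1 / 2 else 1 / 2))"
      unfolding k_def psubst_pconst pconst_simps(3) ..
    also have "(if c = 1 then - 1 / 2 else 1 / 2) + (if c = 1 then - 1 / 2 else 1 / 2) = (if c = 1 then - 1 else 1 :: 'k)"
      by simp
    finally show "\<phi> k + \<phi> k = - c" using c(1) by (simp add: pconst_simps split: if_splits)
  qed
  have m0: "mat 0 ** X0 + mat 0 ** Y0 = (0 :: 'k poly2 mat2)"
    by (rule mat2_eqI) (simp_all add: matrix_matrix_mult_def sum_2 mat_def)
  note f0 = form_cycle[OF 0(1) Inv_closed(2) Inv_closed(2), unfolded m0]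
  note f1 = form_cycle[OF Inv_closed(2) 1(2,3)]
  note f1' = form_cycle[OF 1(1) Inv_closed(2) Inv_closed(2), unfolded m0]
  note f2 = form_cycle[OF Inv_closed(2) Inv_closed(7)[OF k(1) 2(2)] Inv_closed(7)[OF k(1) 2(3)]]
  let ?z1 = "form 0 (mat A1 ** X0 + mat B1 ** Y0) 0 0 + tt * form E1 0 0 0"
  let ?z2 = "tt * form 0 (mat (k * A2) ** X0 + mat (k * B2) ** Y0) 0 0"
  show thesis
  proof
    show "GL_inv (form E0 0 0 0)" "GL_inv ?z1" "GL_inv ?z2"
      by (intro f0 f1 f1' f2 GL_inv_add)+
    show "dd (form E0 0 0 0) = 0" "dd ?z1 = 0" "dd ?z2 = 0"
      by (simp_all add: dd_linear f0 f1 f1' f2)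
    show "form E0 0 0 0 \<in> homogeneous 0" by (rule form_homogeneous)
    show "?z1 \<in> homogeneous 1"
      using homogeneous_mult[OF basis_homogeneous(1) form_homogeneous(1)[of E1]]
      by (intro homogeneous_closed form_homogeneous) simp
    show "?z2 \<in> homogeneous 2"
      using homogeneous_mult[OF basis_homogeneous(1) form_homogeneous(2)[of "mat (k * A2) ** X0 + mat (k * B2) ** Y0"]]
      by (simp add: numeral_2_eq_2)
    show "\<Phi> (form E0 0 0 0) = of_poly (coef F {})"
      unfolding f0(5) F0 by (simp add: psubst_simps of_poly_simps)
    show "\<Phi> ?z1 = of_poly (coef F {1}) * \<theta> 1 + of_poly (coef F {2}) * \<theta> 2"
      unfolding Phi_simps Phi_mult Phi_basis f1(5) f1'(5) 1(4) F2
      by (simp add: psubst_simps of_poly_simps of_poly_central[of "\<theta> _"] algebra_simps)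
    have "\<Phi> ?z2 = (\<theta> 1 + \<theta> 2) * (of_poly (\<phi> k * coef F UNIV) * (\<theta> 1 - \<theta> 2))"
      unfolding Phi_mult Phi_basis f2(5) F12 by (simp add: psubst_simps of_poly_simps algebra_simps)
    also have "\<dots> = of_poly (\<phi> k * coef F UNIV) * - (\<theta> 1 * \<theta> 2 + \<theta> 1 * \<theta> 2)"
      unfolding mult_of_poly_left_commute diag_product ..
    also have "\<dots> = of_poly (- (\<phi> k + \<phi> k) * coef F UNIV) * (\<theta> 1 * \<theta> 2)"
      by (simp only: of_poly_simps distrib_left distrib_right mult_minus_left mult_minus_right mult.assoc)
    also have "\<dots> = of_poly (coef F UNIV) * \<theta>set UNIV"
      unfolding k(2) c(2) of_poly_collect by (simp add: mult.commute)
    finally show "\<Phi> ?z2 = of_poly (coef F UNIV) * \<theta>set UNIV" .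
  qed
qed

subsection \<open>Passing to homology\<close>

lemma free_dga_simps:
  "carrier (free_dga a) = UNIV" "monoid.mult (free_dga a) = (*)" "monoid.one (free_dga a) = 1" "ring.zero (free_dga a) = 0"
  "ring.add (free_dga a) = (+)" "module.smult (free_dga a) = scale" "degree_part (free_dga a) = homogeneous"
  "differential (free_dga a) = koszul_diff a"
  by (simp_all add: free_dga_def)

lemma invariants_simps:
  "carrier (invariants A G) = {a \<in> carrier A. \<forall>\<phi>\<in>G. \<phi> a = a}"
  "monoid.mult (invariants A G) = monoid.mult A" "monoid.one (invariants A G) = monoid.one A" "ring.zero (invariants A G) = ring.zero A"
  "ring.add (invariants A G) = ring.add A" "module.smult (invariants A G) = module.smult A"
  "degree_part (invariants A G) = (\<lambda>p. {a \<in> degree_part A p. \<forall>\<phi>\<in>G. \<phi> a = a})"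
  "differential (invariants A G) = differential A"
  by (simp_all add: invariants_def)

lemma homology_simps:
  "carrier (homology A) = homology_class A ` cycles A"
  "monoid.one (homology A) = homology_class A (monoid.one A)"
  "ring.add (homology A) X Y = (\<Union>x\<in>X. \<Union>y\<in>Y. {ring.add A x y})"
  "monoid.mult (homology A) X Y = (\<Union>x\<in>X. \<Union>y\<in>Y. homology_class A (monoid.mult A x y))"
  "module.smult (homology A) c X = (\<Union>z\<in>X. homology_class A (module.smult A c z))"
  "degree_part (homology A) p = homology_class A ` (cycles A \<inter> degree_part A p)"
  "homology_class A z = (\<Union>b\<in>boundaries A. {ring.add A b z})"
  by (auto simp: homology_def Let_def FactRing_def A_RCOSETS_def' homology_class_def a_r_coset_def'
      rcoset_mult_def set_add_def')

lemma koszul_diff_zero: "koszul_diff (\<lambda>_. 0) f = 0"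
  by (rule gca_eqI) (simp add: koszul_diff_def coef_simps)

text \<open>Products and sums of cosets are compared through their images under \<open>f\<close>, which is constant on
  each coset.\<close>

lemma quasi_isomorphism_to_zero_differential:
  fixes a :: "'i::enum \<Rightarrow> ('i, 'k::field_char_0) xy_poly" and f :: "('i, 'k) gca \<Rightarrow> ('j::enum, 'k) gca"
    and G :: "(('i, 'k) gca \<Rightarrow> ('i, 'k) gca) set" and G' :: "(('j, 'k) gca \<Rightarrow> ('j, 'k) gca) set"
  defines "A \<equiv> invariants (free_dga a) G" and "B \<equiv> invariants (free_dga (\<lambda>_. 0)) G'"
  assumes hom: "dga_hom A B f"
    and G: "\<And>\<phi>. \<phi> \<in> G \<Longrightarrow> \<phi> 0 = 0" "\<And>\<phi> x y. \<phi> \<in> G \<Longrightarrow> \<phi> (x + y) = \<phi> x + \<phi> y"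
      "\<And>\<phi> x y. \<phi> \<in> G \<Longrightarrow> \<phi> (x - y) = \<phi> x - \<phi> y"
    and G': "\<And>\<phi>. \<phi> \<in> G' \<Longrightarrow> \<phi> 0 = 0"
    and f: "f 0 = 0" "\<And>x y. f (x + y) = f x + f y" "\<And>x y. f (x - y) = f x - f y"
      "\<And>x y. f (x * y) = f x * f y" "f 1 = 1" "\<And>c x. f (scale c x) = scale c (f x)"
      "\<And>x. f (koszul_diff a x) = 0"
    and inj: "\<And>z. z \<in> cycles A \<Longrightarrow> f z = 0 \<Longrightarrow> z \<in> boundaries A"
    and surj: "\<And>b. b \<in> carrier B \<Longrightarrow> \<exists>z\<in>cycles A. f z = b"
    and surj_degree: "\<And>b p. b \<in> degree_part B p \<Longrightarrow> \<exists>z\<in>cycles A \<inter> degree_part A p. f z = b"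
  shows "quasi_isomorphism A B f \<and> graded_algebra_isomorphic (homology A) B"
proof -
  note simps = A_def B_def invariants_simps free_dga_simps
  have b0: "0 \<in> boundaries A"
    using G(1) f(1) unfolding boundaries_def simps
    by (intro image_eqI[of _ _ 0]) (auto simp: koszul_diff_def coef_simps intro!: gca_eqI)
  have b_add: "x + y \<in> boundaries A" if xy: "x \<in> boundaries A" "y \<in> boundaries A" for x y
  proof -
    from xy obtain v w where "\<forall>\<phi>\<in>G. \<phi> v = v" "\<forall>\<phi>\<in>G. \<phi> w = w" "x = koszul_diff a v" "y = koszul_diff a w"
      unfolding boundaries_def simps by auto
    then show ?thesis unfolding boundaries_def simps
      by (intro image_eqI[of _ _ "v + w"]) (auto simp: koszul_diff_add G)
  qed
  have fb: "f x = 0" if "x \<in> boundaries A" for x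
    using that f(7) unfolding boundaries_def simps by auto
  have cls: "homology_class A z = {b + z |b. b \<in> boundaries A}" for z
    unfolding homology_simps(7) by (auto simp: simps)
  have f_cls: "f x = f z" if "x \<in> homology_class A z" for x z
    using that fb by (auto simp: cls f)
  have cls_self: "z \<in> homology_class A z" for z
    unfolding cls using b0 by force
  have cls_sub: "homology_class A y \<subseteq> homology_class A z" if "y \<in> cycles A" "z \<in> cycles A" "f y = f z" for y z
  proof -
    \<comment> \<open>Cycles with the same image differ by a cycle in the kernel of
      \<open>f\<close>, hence by a boundary.\<close>
    have "y - z \<in> cycles A"
      using that unfolding cycles_def simps by (auto simp: koszul_diff_minus G)
    then have "y - z \<in> boundaries A" by (rule inj) (simp add: that f)
    then have "b + (y - z) \<in> boundaries A" if "b \<in> boundaries A" for b using b_add that by blast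
    moreover have "b + y = (b + (y - z)) + z" for b by simp
    ultimately show ?thesis unfolding cls by blast
  qed
  then have cls_eq: "homology_class A y = homology_class A z" if "y \<in> cycles A" "z \<in> cycles A" "f y = f z" for y z
    using that by (metis subset_antisym)
  have bB: "boundaries B = {0}"
    unfolding boundaries_def simps using G' by (auto simp: koszul_diff_zero intro!: image_eqI[of _ _ 0])
  have clsB: "homology_class B z = {z}" for z
    unfolding homology_simps(7) bB by (simp add: simps)
  have fc: "f z \<in> carrier B" if "z \<in> cycles A" for z
    using that hom unfolding dga_hom_def ring_hom_def cycles_def by auto
  have fd: "f z \<in> degree_part B p" if "z \<in> degree_part A p" for z p
    using that hom unfolding dga_hom_def by auto
  have f_image: "f ` homology_class A z = {f z}" for z
  proof
    show "f ` homology_class A z \<subseteq> {f z}" using f_cls by blast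
    show "{f z} \<subseteq> f ` homology_class A z" using cls_self by blast
  qed
  have map: "homology_map A B f (homology_class A z) = {f z}" for z
    unfolding homology_map_def clsB UNION_singleton_eq_range by (rule f_image)
  have degB: "degree_part (homology B) p = (\<lambda>b. {b}) ` degree_part B p" for p
  proof -
    have "cycles B \<inter> degree_part B p = degree_part B p"
      unfolding cycles_def simps by (auto simp: koszul_diff_zero)
    then show ?thesis unfolding homology_simps(6) clsB by simp
  qed
  have qi: "quasi_isomorphism A B f"
    unfolding quasi_isomorphism_def
  proof (intro conjI allI hom)
    fix p
    show "bij_betw (homology_map A B f) (degree_part (homology A) p) (degree_part (homology B) p)"
    proof (rule bij_betw_imageI)
      show "inj_on (homology_map A B f) (degree_part (homology A) p)"
        unfolding homology_simps(6) by (rule inj_onI) (clarsimp simp: map, rule cls_eq)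
      have "f ` (cycles A \<inter> degree_part A p) = degree_part B p"
        using surj_degree fd by fastforce
      then show "homology_map A B f ` degree_part (homology A) p = degree_part (homology B) p"
        unfolding degB homology_simps(6)[of A] by (auto simp: map image_image)
    qed
  qed
  define h where "h X = the_elem (f ` X)" for X
  have h: "h X = b" if "X \<noteq> {}" "\<And>x. x \<in> X \<Longrightarrow> f x = b" for X b
  proof -
    have "f ` X = {b}" using that by auto
    then show ?thesis by (simp add: h_def)
  qed
  have h_cls: "h (homology_class A z) = f z" for z
    unfolding h_def f_image by simp
  have opA: "ring.add A = (+)" "monoid.mult A = (*)" "monoid.one A = 1" "module.smult A = scale"
    and opB: "ring.add B = (+)" "monoid.mult B = (*)" "monoid.one B = 1" "module.smult B = scale"
    by (simp_all add: simps)
  have h_add: "h (ring.add (homology A) X Y) = h X + h Y"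
    and h_mult: "h (monoid.mult (homology A) X Y) = h X * h Y"
    if XY: "X \<in> carrier (homology A)" "Y \<in> carrier (homology A)" for X Y
  proof -
    obtain x y where X: "X = homology_class A x" and Y: "Y = homology_class A y"
      using XY unfolding homology_simps(1) by blast
    show "h (ring.add (homology A) X Y) = h X + h Y"
      unfolding homology_simps(3) X Y h_cls opA
    proof (rule h)
      show "(\<Union>u\<in>homology_class A x. \<Union>v\<in>homology_class A y. {u + v}) \<noteq> {}"
        using cls_self[of x] cls_self[of y] by blast
    qed (auto simp: f dest!: f_cls)
    show "h (monoid.mult (homology A) X Y) = h X * h Y"
      unfolding homology_simps(4) X Y h_cls opA
    proof (rule h)
      show "(\<Union>u\<in>homology_class A x. \<Union>v\<in>homology_class A y. homology_class A (u * v)) \<noteq> {}"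
        using cls_self[of x] cls_self[of y] cls_self by blast
    qed (auto simp: f dest!: f_cls)
  qed
  have h_smult: "h (module.smult (homology A) c X) = scale c (h X)" if cX: "X \<in> carrier (homology A)" for c X
  proof -
    obtain x where X: "X = homology_class A x" using cX unfolding homology_simps(1) by blast
    show ?thesis
      unfolding homology_simps(5) X h_cls opA
    proof (rule h)
      show "(\<Union>z\<in>homology_class A x. homology_class A (scale c z)) \<noteq> {}"
        using cls_self[of x] cls_self by blast
    qed (auto simp: f dest!: f_cls)
  qed
  have image: "h ` homology_class A ` Z = f ` Z" for Z
    unfolding image_image h_cls ..
  have "h \<in> ring_hom (homology A) B"
    unfolding ring_hom_def
    by (auto simp: h_add h_mult opB homology_simps(2) h_cls opA f) (auto simp: homology_simps(1) h_cls fc)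
  moreover have "bij_betw h (carrier (homology A)) (carrier B)"
  proof (rule bij_betw_imageI)
    show "inj_on h (carrier (homology A))"
      unfolding homology_simps(1) by (rule inj_onI) (clarsimp simp: h_cls, rule cls_eq)
    show "h ` carrier (homology A) = carrier B"
      unfolding homology_simps(1) image using surj fc by fastforce
  qed
  moreover have "linear_on (homology A) B h"
    unfolding linear_on_def by (simp add: h_add h_smult opB)
  moreover have "h ` degree_part (homology A) p = degree_part B p" for p
    unfolding homology_simps(6) image using surj_degree fd by fastforce
  ultimately have "graded_algebra_isomorphic (homology A) B"
    unfolding graded_algebra_isomorphic_def ring_iso_def by blast
  then show ?thesis using qi by blast
qed

lemma Phi_scale: "\<Phi> (scale c (F :: 'k::field gca2)) = scale c (\<Phi> F)"
  unfolding Phi_eq by (rule gca_hom_scale)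

lemma Phi_homogeneous: "F \<in> homogeneous p \<Longrightarrow> \<Phi> (F :: 'k::field gca2) \<in> homogeneous p"
  unfolding Phi_eq by (rule gca_hom_homogeneous) (rule diag_theta_homogeneous)

lemma Phi_1: "\<Phi> (1 :: 'k::field gca2) = 1"
  unfolding Phi_eq by (rule gca_hom_1)

lemma symmetric_lift_degree:
  fixes F :: "(2, 'k::field_char_0) gca"
  assumes "perm_action swap2 F = F" "F \<in> homogeneous p"
  obtains z where "GL_inv z" "dd z = 0" "z \<in> homogeneous p" "\<Phi> z = F"
proof -
  obtain z0 z1 z2 where z: "GL_inv z0" "GL_inv z1" "GL_inv z2" "dd z0 = 0" "dd z1 = 0" "dd z2 = 0"
    "z0 \<in> homogeneous 0" "z1 \<in> homogeneous 1" "z2 \<in> homogeneous 2" and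
    Phi: "\<Phi> z0 = of_poly (coef F {})" "\<Phi> z1 = of_poly (coef F {1}) * \<theta> 1 + of_poly (coef F {2}) * \<theta> 2"
    "\<Phi> z2 = of_poly (coef F UNIV) * \<theta>set UNIV"
    using symmetric_lift[OF assms(1)] .
  have F: "F = \<Phi> z0 + \<Phi> z1 + \<Phi> z2" unfolding Phi by (rule diag_expansion)
  have "card (UNIV :: 2 set) = 2" by simp
  then have c: "p \<noteq> 0 \<Longrightarrow> coef F {} = 0" "p \<noteq> 1 \<Longrightarrow> coef F {1} = 0" "p \<noteq> 1 \<Longrightarrow> coef F {2} = 0"
    "p \<noteq> 2 \<Longrightarrow> coef F UNIV = 0"
    using assms(2) by (auto simp: homogeneous_def)
  consider "p = 0" | "p = 1" | "p = 2" | "p \<noteq> 0 \<and> p \<noteq> 1 \<and> p \<noteq> 2" by blast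
  then show thesis
  proof cases
    case 1
    then have "\<Phi> z1 = 0" "\<Phi> z2 = 0" using c by (simp_all add: Phi of_poly_simps)
    then have "\<Phi> z0 = F" by (simp add: F)
    then show ?thesis using that[of z0] z 1 by simp
  next
    case 2
    then have "\<Phi> z0 = 0" "\<Phi> z2 = 0" using c by (simp_all add: Phi of_poly_simps)
    then have "\<Phi> z1 = F" by (simp add: F)
    then show ?thesis using that[of z1] z 2 by simp
  next
    case 3
    then have "\<Phi> z0 = 0" "\<Phi> z1 = 0" using c by (simp_all add: Phi of_poly_simps)
    then have "\<Phi> z2 = F" by (simp add: F)
    then show ?thesis using that[of z2] z 3 by simp
  next
    case 4
    then have "\<Phi> z0 = 0" "\<Phi> z1 = 0" "\<Phi> z2 = 0" using c by (simp_all add: Phi of_poly_simps)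
    then have "F = 0" by (simp add: F)
    moreover have "(0 :: 'k gca2) \<in> homogeneous p" by (rule homogeneous_closed)
    ultimately show ?thesis
      using that[of 0] GL_inv_0 dd_linear(5)[of 0] by (simp add: Phi_simps of_poly_simps)
  qed
qed

theorem theorem4p1:
  shows "quasi_isomorphism
           (DRep_GL :: ('k::field_char_0, (2 \<times> 2, 'k) gca) dga)
           (diag_algebra_S :: ('k, (2, 'k) gca) dga)
           \<Phi> \<and>
         graded_algebra_isomorphic
           (homology (DRep_GL :: ('k, (2 \<times> 2, 'k) gca) dga))
           (diag_algebra_S :: ('k, (2, 'k) gca) dga)"
proof -
  let ?A = "DRep_GL :: ('k, 'k gca2) dga" and ?B = "diag_algebra_S :: ('k, (2, 'k) gca) dga"
  have A: "?A = invariants (free_dga (\<lambda>(i, j). Mmat $ i $ j)) (conj_action ` {g. invertible g})"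
    and B: "?B = invariants (free_dga (\<lambda>_. 0)) (perm_action ` {\<pi>. bij \<pi>})"
    by (simp_all add: DRep_GL_def DRep_eq diag_algebra_S_def diag_algebra_def)
  have cA: "carrier ?A = {F. GL_inv F}" and dA: "degree_part ?A p = {F \<in> homogeneous p. GL_inv F}"
    and diffA: "differential ?A = dd" for p
    by (auto simp: A invariants_simps free_dga_simps GL_inv_def dd_def)
  have cB: "carrier ?B = {F. perm_action swap2 F = F}"
    and dB: "degree_part ?B p = {F \<in> homogeneous p. perm_action swap2 F = F}" for p
    unfolding B invariants_simps free_dga_simps symmetric_iff[symmetric] by auto
  have cyc: "cycles ?A = {F. GL_inv F \<and> dd F = 0}"
    unfolding cycles_def cA diffA by (simp add: A invariants_simps free_dga_simps)
  have diffB: "differential ?B F = 0" for F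
    by (simp add: B invariants_simps free_dga_simps koszul_diff_zero)
  have ops: "ring.add ?A = (+)" "monoid.mult ?A = (*)" "monoid.one ?A = 1" "module.smult ?A = scale"
    "ring.add ?B = (+)" "monoid.mult ?B = (*)" "monoid.one ?B = 1" "module.smult ?B = scale"
    by (simp_all add: A B invariants_simps free_dga_simps)
  have hom: "dga_hom ?A ?B \<Phi>"
    unfolding dga_hom_def ring_hom_def linear_on_def ops cA cB dA dB diffA diffB
    by (auto simp: Phi_symmetric Phi_mult Phi_simps Phi_1 Phi_scale Phi_homogeneous Phi_dd)
  show ?thesis
    unfolding A B
  proof (rule quasi_isomorphism_to_zero_differential; (unfold A[symmetric] B[symmetric])?)
    show "dga_hom ?A ?B \<Phi>" by (rule hom)
    show "z \<in> boundaries ?A" if "z \<in> cycles ?A" "\<Phi> z = 0" for z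
      using that GL_inv_boundary[of z] unfolding boundaries_def cyc cA diffA by blast
    show "\<exists>z\<in>cycles ?A \<inter> degree_part ?A p. \<Phi> z = b" if "b \<in> degree_part ?B p" for b p
      using that symmetric_lift_degree[of b p] unfolding cyc dA dB by blast
    \<comment> \<open>A symmetric element may mix degrees, so the lifts of its three components are
      added.\<close>
    show "\<exists>z\<in>cycles ?A. \<Phi> z = b" if "b \<in> carrier ?B" for b
    proof -
      from that have "perm_action swap2 b = b" unfolding cB by simp
      then obtain z0 z1 z2 where z: "GL_inv z0" "GL_inv z1" "GL_inv z2" "dd z0 = 0" "dd z1 = 0" "dd z2 = 0" and
        Phi: "\<Phi> z0 = of_poly (coef b {})" "\<Phi> z1 = of_poly (coef b {1}) * \<theta> 1 + of_poly (coef b {2}) * \<theta> 2"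
        "\<Phi> z2 = of_poly (coef b UNIV) * \<theta>set UNIV"
        using symmetric_lift[of b] by blast
      have "\<Phi> (z0 + z1 + z2) = b" unfolding Phi_simps Phi by (rule diag_expansion[symmetric])
      moreover have "z0 + z1 + z2 \<in> cycles ?A"
        unfolding cyc by (simp add: GL_inv_add z dd_linear)
      ultimately show ?thesis by blast
    qed
    show "\<Phi> (koszul_diff (\<lambda>(i, j). Mmat $ i $ j) F) = 0" for F :: "'k gca2"
      using Phi_dd[of F] unfolding dd_def .
  qed (auto simp: conj_action_eq perm_action_eq gca_hom_0 gca_hom_add gca_hom_diff Phi_simps Phi_mult Phi_1
      Phi_scale)
qed

end
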